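(* There exist universal constants $0<c\le C<\infty$ such that the following holds for all positive integers $d,N$ with $d\le N/2$. Let $C_N$ be the cycle of length $N$, and consider two independent continuous-time simple symmetric random walks on $C_N$ whose starting vertices are at distance $d$ from each other. Let $\mathcal{I}_{C_N}$ be the interface, i.e. the set of edges of $C_N$ whose two endpoints are claimed by different walkers. Then $$c\ln\left(1+\frac{N}{d}\right)\le \mathbb{E}\,|\mathcal{I}_{C_N}|\le C\ln\left(1+\frac{N}{d}\right).$$
   Context: $C_N$ is identified with $\mathbb{Z}/N\mathbb{Z}$, with edges $\{n-1,n\}$ for $n\in\mathbb{Z}/N\mathbb{Z}$. A continuous-time simple symmetric random walk on $C_N$ waits independent exponential times of mean one between successive jumps, and at each jump moves to one of the two neighbouring vertices with probability $1/2$ each, independently of everything else. Each vertex is claimed by the walker that visits it first (a walker visits its starting vertex at time $0$), and remains claimed by that walker thereafter. Almost surely every vertex is eventually visited and there are no ties. $|\cdot|$ denotes cardinality. "Universal" means not depending on $d$ or $N$. *)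

theory Defs
  imports "HOL-Probability.Probability"
begin

text \<open>The cycle: the vertex set Z/NZ is represented by the residues 0, ..., N - 1 in \<^typ>\<open>int\<close>.\<close>

definition cycle_verts :: "nat \<Rightarrow> int set" where
  "cycle_verts N = {0..<int N}"

definition cycle_edges :: "nat \<Rightarrow> int set set" where
  "cycle_edges N = {{(n - 1) mod int N, n} | n. n \<in> cycle_verts N}"

definition cycle_adj :: "nat \<Rightarrow> (int \<times> int) set" where
  "cycle_adj N = {(u, v). {u, v} \<in> cycle_edges N}"

definition cycle_dist :: "nat \<Rightarrow> int \<Rightarrow> int \<Rightarrow> nat" where
  "cycle_dist N u v = (LEAST k. (u, v) \<in> cycle_adj N ^^ k)"

text \<open>
  The randomness driving one walk is an i.i.d. sequence of pairs (waiting time, increment) with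
  independent components; a pair of independent walks is driven by the product of two copies.
  The law of the two walks is determined by their description, so nothing is lost by realising
  them on this space, and constants are then visibly independent of any choice of sample space.
\<close>

definition jump_law :: "(real \<times> int) measure" where
  "jump_law = density lborel (\<lambda>t. ennreal (exponential_density 1 t))
                \<Otimes>\<^sub>M measure_pmf (pmf_of_set {-1, 1})"

definition walk_law :: "(nat \<Rightarrow> real \<times> int) measure" where
  "walk_law = (\<Pi>\<^sub>M k\<in>UNIV. jump_law)"

definition two_walks_law :: "((nat \<Rightarrow> real \<times> int) \<times> (nat \<Rightarrow> real \<times> int)) measure" where
  "two_walks_law = walk_law \<Otimes>\<^sub>M walk_law"

text \<open>\<open>jump_time w n\<close> is the time of the \<open>n\<close>-th jump (and 0 for \<open>n = 0\<close>).\<close>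

definition jump_time :: "(nat \<Rightarrow> real \<times> int) \<Rightarrow> nat \<Rightarrow> real" where
  "jump_time w n = (\<Sum>k<n. fst (w k))"

text \<open>
  The number of jumps made up to and including time \<open>t\<close>. The minimum exists for all \<open>t\<close> whenever
  the jump times are unbounded, hence almost surely.
\<close>

definition num_jumps :: "(nat \<Rightarrow> real \<times> int) \<Rightarrow> real \<Rightarrow> nat" where
  "num_jumps w t = (LEAST n. t < jump_time w (Suc n))"

definition walk :: "nat \<Rightarrow> int \<Rightarrow> (nat \<Rightarrow> real \<times> int) \<Rightarrow> real \<Rightarrow> int" where
  "walk N x w t = (x + (\<Sum>k<num_jumps w t. snd (w k))) mod int N"

text \<open>
  \<open>claims X Y v\<close>: the walker with trajectory \<open>X\<close> visits \<open>v\<close> strictly before the walker with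
  trajectory \<open>Y\<close> does. In case of a tie (a null event for walks with distinct starting vertices)
  nobody claims \<open>v\<close>.
\<close>

definition claims :: "(real \<Rightarrow> 'v) \<Rightarrow> (real \<Rightarrow> 'v) \<Rightarrow> 'v \<Rightarrow> bool" where
  "claims X Y v \<longleftrightarrow> (\<exists>t\<ge>0. X t = v \<and> (\<forall>s\<in>{0..t}. Y s \<noteq> v))"

definition interface_edges :: "nat \<Rightarrow> (real \<Rightarrow> int) \<Rightarrow> (real \<Rightarrow> int) \<Rightarrow> int set set" where
  "interface_edges N X Y = {e \<in> cycle_edges N. \<exists>u v. e = {u, v} \<and> claims X Y u \<and> claims Y X v}"

definition expected_interface :: "nat \<Rightarrow> int \<Rightarrow> int \<Rightarrow> real" where
  "expected_interface N x y =
     (\<integral>\<omega>. real (card (interface_edges N (walk N x (fst \<omega>)) (walk N y (snd \<omega>)))) \<partial>two_walks_law)"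

lemma prob_space_jump_law: "prob_space jump_law"
proof -
  interpret A: prob_space "density lborel (\<lambda>t. ennreal (exponential_density 1 t))"
    by (rule prob_space_exponential_density) simp
  interpret pair_prob_space "density lborel (\<lambda>t. ennreal (exponential_density 1 t))"
    "measure_pmf (pmf_of_set {-1, 1 :: int})" ..
  show ?thesis unfolding jump_law_def by unfold_locales
qed

lemma prob_space_walk_law: "prob_space walk_law"
  unfolding walk_law_def by (intro prob_space_PiM prob_space_jump_law)

lemma prob_space_two_walks_law: "prob_space two_walks_law"
proof -
  interpret A: prob_space walk_law by (rule prob_space_walk_law)
  interpret pair_prob_space walk_law walk_law ..
  show ?thesis unfolding two_walks_law_def by unfold_locales
qed

end

theory Submission
  imports Defs
begin

text \<open>
  Cut the cycle open at an edge \<open>e\<close>; what remains is a path whose two end vertices are the endpoints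
  of \<open>e\<close>. The edge belongs to the interface iff the walkers split its endpoints between them, and the
  expected size of the interface is the sum over all edges of the probability of that event. The
  theorem follows from the estimate that this probability is of the exact order \<open>1 / (r + 1)\<close>, where
  \<open>r\<close> is the larger one of the distances of the two starting vertices to \<open>e\<close>
  (\<open>prob_splits_le\<close>, \<open>prob_splits_ge\<close>): since \<open>r + 1\<close> is at least of order \<open>d\<close> for every edge, and every
  value of \<open>r\<close> is attained by boundedly many edges, the sum is a harmonic sum from \<open>d\<close> to \<open>N\<close>.

  Upper estimate. Let the second walker reach \<open>e\<close> at the time \<open>t\<close>, after the first one. If the endpoints
  are split, then at that time the first walker has visited exactly one endpoint
  (\<open>splits_imp_caught\<close>). The walkers are independent, so \<open>t\<close> may be regarded as fixed. In the path
  picture, having visited exactly one endpoint means that the running maximum (or minus the running minimum)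
  of the first walk equals the distance to that endpoint. The probability \<open>maxpmf n k\<close> that the
  running maximum of \<open>n\<close> simple random walk steps equals \<open>k\<close> is nonincreasing in \<open>k\<close>, hence at most
  \<open>1 / (k + 1)\<close>, and it is at most \<open>1 / sqrt (n + 1)\<close>. The first bound controls the event by the distance
  of the first walker. The second one gives a multiple of \<open>1 / sqrt t\<close>, whose expectation over \<open>t\<close> is of
  order the inverse distance of the second walker, because that walker needs about \<open>k\<^sup>2\<close> jumps to
  travel a distance \<open>k\<close> (\<open>prob_caught_le\<close>).

  Lower estimate. Both walkers reach \<open>e\<close> before a time \<open>T\<close> of order \<open>(r + 1)\<^sup>2\<close> with probability bounded below,
  and almost surely not simultaneously unless both start on \<open>e\<close>. If the walker arriving first then stays away from the other endpoint for
  longer than \<open>T + 1\<close>, while the second one steps across \<open>e\<close> within unit time, the endpoints are split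
  (\<open>overtake_imp_splits\<close>). Staying away has probability at least of order \<open>1 / (r + 1)\<close>: for a walk killed at
  \<open>0\<close> and \<open>L\<close> the function \<open>sin (\<pi> p / L)\<close> is an eigenfunction with eigenvalue \<open>cos (\<pi> / L)\<close>, which bounds
  the survival probability from below (\<open>prob_stay_between\<close>).

  Waiting times and steps are independent of each other, so the continuous-time walk is treated as a
  discrete walk together with an independent sequence of jump times, and all conditioning reduces to
  Fubini's theorem and to splitting an i.i.d. sequence at a fixed index.
\<close>

section \<open>The running maximum of the simple random walk\<close>

text \<open>
  The distribution function of the maximum of the partial sums with index at most \<open>n\<close> (\<open>prob_max_le\<close>), given by
  its first-step recursion. The integer argument lets the absorbing values below \<open>0\<close> enter the recursion.
\<close>

fun maxcdf :: "nat \<Rightarrow> int \<Rightarrow> real" where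
  "maxcdf 0 k = (if k < 0 then 0 else 1)"
| "maxcdf (Suc n) k = (if k < 0 then 0 else (maxcdf n (k - 1) + maxcdf n (k + 1)) / 2)"

definition maxpmf :: "nat \<Rightarrow> nat \<Rightarrow> real" where
  "maxpmf n k = maxcdf n (int k) - maxcdf n (int k - 1)"

lemma maxcdf_neg [simp]: "k < 0 \<Longrightarrow> maxcdf n k = 0"
  by (cases n) auto

lemma maxcdf_bounds: "0 \<le> maxcdf n k \<and> maxcdf n k \<le> 1"
proof (induction n arbitrary: k)
  case (Suc n)
  show ?case using Suc[of "k - 1"] Suc[of "k + 1"] by auto
qed auto

text \<open>
  The increments of \<open>maxcdf\<close> evolve as the law of a walk on the natural numbers that is reflected at \<open>0\<close>
  with holding probability \<open>1 / 2\<close>. Monotonicity in \<open>k\<close> is preserved by this evolution.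
\<close>

lemma maxpmf_Suc_0: "maxpmf (Suc n) 0 = (maxpmf n 0 + maxpmf n 1) / 2"
  by (simp add: maxpmf_def)

lemma maxpmf_Suc_Suc: "maxpmf (Suc n) (Suc k) = (maxpmf n k + maxpmf n (Suc (Suc k))) / 2"
  by (simp add: maxpmf_def field_simps)

text \<open>
  This is the reflection principle: the maximum of \<open>n\<close> steps is \<open>k\<close> as often as the walk ends at whichever of
  \<open>k\<close> and \<open>k + 1\<close> has the parity of \<open>n\<close>.
\<close>

lemma maxpmf_binomial: "maxpmf n k = real (n choose ((n + k + 1) div 2)) / 2 ^ n"
proof (induction n arbitrary: k)
  case 0
  show ?case
  proof (cases k)
    case (Suc j)
    then have "(0::nat) < (k + 1) div 2" by simp
    then show ?thesis using Suc by (simp add: maxpmf_def)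
  qed (simp add: maxpmf_def)
next
  case (Suc n)
  show ?case
  proof (cases k)
    case 0
    have "(n + 1) div 2 = n div 2 \<or> (n + 1) div 2 = n - n div 2" by presburger
    then have sym: "n choose ((n + 1) div 2) = n choose (n div 2)"
      using binomial_symmetric[of "n div 2" n] by auto
    have "(Suc n + 0 + 1) div 2 = Suc (n div 2)" by simp
    then have "Suc n choose ((Suc n + 0 + 1) div 2) = (n choose (n div 2)) + (n choose Suc (n div 2))"
      by simp
    moreover have "(n + 1 + 1) div 2 = Suc (n div 2)" by simp
    ultimately show ?thesis
      unfolding 0 maxpmf_Suc_0 Suc.IH using sym by (simp add: field_simps)
  next
    case k: (Suc j)
    have "(Suc n + k + 1) div 2 = Suc ((n + j + 1) div 2)" using k by simp
    then have "Suc n choose ((Suc n + k + 1) div 2)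
        = (n choose ((n + j + 1) div 2)) + (n choose Suc ((n + j + 1) div 2))"
      by simp
    moreover have "(n + Suc (Suc j) + 1) div 2 = Suc ((n + j + 1) div 2)" by simp
    ultimately show ?thesis
      unfolding k maxpmf_Suc_Suc Suc.IH by (simp add: field_simps)
  qed
qed

lemma maxpmf_antimono_Suc: "maxpmf n (Suc k) \<le> maxpmf n k"
proof (induction n arbitrary: k)
  case 0
  show ?case by (simp add: maxpmf_def)
next
  case (Suc n)
  show ?case
  proof (cases k)
    case 0
    show ?thesis unfolding 0 maxpmf_Suc_0 maxpmf_Suc_Suc
      using Suc[of 0] Suc[of 1] Suc[of 2] by (simp add: numeral_2_eq_2)
  next
    case k: (Suc j)
    show ?thesis unfolding k maxpmf_Suc_Suc
      using Suc[of j] Suc[of "Suc (Suc j)"] by (simp)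
  qed
qed

lemma maxpmf_antimono: "j \<le> k \<Longrightarrow> maxpmf n k \<le> maxpmf n j"
  by (rule lift_Suc_antimono_le[of "maxpmf n"]) (auto intro: maxpmf_antimono_Suc)

lemma maxcdf_eq_sum: "maxcdf n (int k) = (\<Sum>j\<le>k. maxpmf n j)"
proof (induction k)
  case (Suc k)
  show ?case using Suc by (simp add: maxpmf_def)
qed (simp add: maxpmf_def)

text \<open>
  The \<open>k + 1\<close> values up to \<open>k\<close> have at least the probability of \<open>k\<close> each, and their sum is at most \<open>1\<close>.
\<close>

lemma maxpmf_le_inverse: "maxpmf n k \<le> 1 / (real k + 1)"
proof -
  have "(\<Sum>j\<le>k. maxpmf n k) \<le> (\<Sum>j\<le>k. maxpmf n j)"
    by (intro sum_mono maxpmf_antimono) simp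
  also have "\<dots> \<le> 1" using maxcdf_bounds maxcdf_eq_sum[of n k] by metis
  finally show ?thesis by (simp add: field_simps)
qed

lemma central_binomial_Suc:
  "Suc m * ((2 * Suc m) choose Suc m) = 2 * Suc (2 * m) * ((2 * m) choose m)"
proof -
  have "Suc m * ((2 * Suc m) choose Suc m) = Suc (2 * m + 1) * ((2 * m + 1) choose m)"
    using Suc_times_binomial_eq[of "2 * m + 1" m] by (simp del: binomial_Suc_Suc add: mult.commute)
  also have "(2 * m + 1) choose m = (Suc (2 * m)) choose (Suc m)"
    using binomial_symmetric[of m "2 * m + 1"] by (simp del: binomial_Suc_Suc)
  also have "Suc (2 * m + 1) * (Suc (2 * m) choose Suc m) = 2 * (Suc m * (Suc (2 * m) choose Suc m))"
    by (simp del: binomial_Suc_Suc)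
  also have "Suc m * (Suc (2 * m) choose Suc m) = Suc (2 * m) * ((2 * m) choose m)"
    using Suc_times_binomial_eq[of "2 * m" m] by (simp del: binomial_Suc_Suc add: mult.commute)
  finally show ?thesis by simp
qed

text \<open>
  The square of the left-hand side times \<open>2 m + 1\<close> is nonincreasing in \<open>m\<close> and equals \<open>1\<close> for \<open>m = 0\<close>.
\<close>

lemma central_binomial_le: "real ((2 * m) choose m) / 4 ^ m \<le> 1 / sqrt (2 * real m + 1)"
proof -
  have "(real ((2 * m) choose m) / 4 ^ m)\<^sup>2 * (2 * real m + 1) \<le> 1"
  proof (induction m)
    case (Suc m)
    define A where "A = real ((2 * m) choose m) / 4 ^ m"
    define B where "B = real ((2 * Suc m) choose Suc m) / 4 ^ Suc m"
    have "real (Suc m * ((2 * Suc m) choose Suc m)) = real (2 * Suc (2 * m) * ((2 * m) choose m))"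
      using central_binomial_Suc[of m] by presburger
    then have rec: "(real m + 1) * real ((2 * Suc m) choose Suc m) = (4 * real m + 2) * real ((2 * m) choose m)"
      by (simp del: binomial_Suc_Suc add: algebra_simps)
    have "(2 * real m + 2) * B = 2 * ((real m + 1) * real ((2 * Suc m) choose Suc m)) / 4 ^ Suc m"
      unfolding B_def by (simp del: binomial_Suc_Suc add: algebra_simps)
    also have "\<dots> = (2 * real m + 1) * A"
      unfolding rec A_def by (simp add: field_simps)
    finally have "(2 * real m + 2) * B = (2 * real m + 1) * A" .
    then have B: "B = (2 * real m + 1) / (2 * real m + 2) * A"
      by (simp add: field_simps)
    have "(2 * real m + 1) * (2 * real m + 3) \<le> (2 * real m + 2)\<^sup>2"
      by (simp add: power2_eq_square algebra_simps)
    then have le: "(2 * real m + 1) * (2 * real m + 3) / (2 * real m + 2)\<^sup>2 \<le> 1"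
      by (simp add: divide_le_eq)
    have "B\<^sup>2 * (2 * real (Suc m) + 1)
        = (A\<^sup>2 * (2 * real m + 1)) * ((2 * real m + 1) * (2 * real m + 3) / (2 * real m + 2)\<^sup>2)"
      unfolding B by (simp add: power2_eq_square field_simps)
    also have "\<dots> \<le> 1 * 1"
      using Suc le unfolding A_def[symmetric] by (intro mult_mono) auto
    finally show ?case unfolding B_def by simp
  qed simp
  then have "(real ((2 * m) choose m) / 4 ^ m)\<^sup>2 \<le> 1 / (2 * real m + 1)"
    by (simp add: field_simps)
  then have "real ((2 * m) choose m) / 4 ^ m \<le> sqrt (1 / (2 * real m + 1))"
    by (rule real_le_rsqrt)
  then show ?thesis by (simp add: real_sqrt_divide)
qed

lemma maxpmf_0_le: "maxpmf n 0 \<le> 1 / sqrt (real n + 1)"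
proof (cases "even n")
  case True
  then obtain m where n: "n = 2 * m" by blast
  then show ?thesis using central_binomial_le[of m] by (simp add: maxpmf_binomial power_mult)
next
  case False
  then obtain m where n: "n = 2 * m + 1" using oddE by blast
  have "Suc m * ((2 * Suc m) choose Suc m) = Suc m * (2 * (n choose (m + 1)))"
    using Suc_times_binomial_eq[of "2 * m" m] central_binomial_Suc[of m] n
    by (simp del: binomial_Suc_Suc add: mult.commute)
  then have "(2 * Suc m) choose Suc m = 2 * (n choose (m + 1))"
    by (metis mult_cancel1 nat.distinct(1))
  then have "real ((2 * Suc m) choose Suc m) = real (2 * (n choose (m + 1)))" by presburger
  then have "maxpmf n 0 = real ((2 * Suc m) choose Suc m) / 4 ^ Suc m"
    using n by (simp add: maxpmf_binomial power_mult power_add del: binomial_Suc_Suc)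
  also have "\<dots> \<le> 1 / sqrt (2 * real (Suc m) + 1)" by (rule central_binomial_le)
  also have "\<dots> \<le> 1 / sqrt (real n + 1)" using n by (intro divide_left_mono) auto
  finally show ?thesis .
qed

lemma maxpmf_le: "maxpmf n k \<le> 1 / sqrt (real n + 1)"
  using maxpmf_antimono[of 0 k n] maxpmf_0_le[of n] by linarith

lemma maxcdf_le: "maxcdf n (int k) \<le> (real k + 1) / sqrt (real n + 1)"
proof -
  have "maxcdf n (int k) \<le> (\<Sum>j\<le>k. 1 / sqrt (real n + 1))"
    unfolding maxcdf_eq_sum by (intro sum_mono maxpmf_le)
  then show ?thesis by (simp add: field_simps)
qed

text \<open>
  For a walk started at \<open>p\<close> the right-hand side, as a function of \<open>n\<close> and \<open>p\<close>, satisfies the first-step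
  recursion with equality (\<open>S\<^sub>n\<^sup>2 - n\<close> is a martingale), and it is at least \<open>1\<close> once \<open>p\<close> has
  reached \<open>K\<close>. So it dominates the probability to reach \<open>K\<close> within \<open>n\<close> steps.
\<close>

lemma one_minus_maxcdf_le_shifted:
  assumes "0 < K"
  shows "1 - maxcdf n (K - 1 - p) \<le> (real n + (real_of_int p)\<^sup>2) / (real_of_int K)\<^sup>2"
proof (induction n arbitrary: p)
  case 0
  then show ?case using assms by (auto simp: field_simps)
next
  case (Suc n)
  show ?case
  proof (cases "K - 1 - p < 0")
    case True
    then have "(real_of_int K)\<^sup>2 \<le> (real_of_int p)\<^sup>2" using assms by (intro power_mono) auto
    then have "(real_of_int K)\<^sup>2 \<le> real (Suc n) + (real_of_int p)\<^sup>2" by linarith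
    then show ?thesis using True assms by (simp add: le_divide_eq)
  next
    case False
    have "1 - maxcdf (Suc n) (K - 1 - p)
        = ((1 - maxcdf n (K - 1 - (p + 1))) + (1 - maxcdf n (K - 1 - (p - 1)))) / 2"
      using False by (simp add: field_simps)
    also have "\<dots> \<le> ((real n + (real_of_int (p + 1))\<^sup>2) / (real_of_int K)\<^sup>2
        + (real n + (real_of_int (p - 1))\<^sup>2) / (real_of_int K)\<^sup>2) / 2"
      by (intro divide_right_mono add_mono Suc) simp
    also have "\<dots> = (real (Suc n) + (real_of_int p)\<^sup>2) / (real_of_int K)\<^sup>2"
      using assms by (simp add: field_simps power2_eq_square)
    finally show ?thesis .
  qed
qed

lemma one_minus_maxcdf_le:
  assumes "0 < k"
  shows "1 - maxcdf n (int k - 1) \<le> real n / (real k)\<^sup>2"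
  using one_minus_maxcdf_le_shifted[of "int k" n 0] assms by simp

section \<open>Elementary inequalities\<close>

text \<open>
  A form of summation by parts: among weights whose partial sums grow at most at the rate \<open>\<theta>\<close>, constant weights
  make the sum against a nonincreasing sequence largest.
\<close>

lemma sum_mult_antimono_le:
  fixes p c :: "nat \<Rightarrow> real"
  assumes p: "\<And>m. (\<Sum>j<m. p j) \<le> \<theta> * real m"
    and c: "\<And>j. c (Suc j) \<le> c j" "\<And>j. 0 \<le> c j"
  shows "(\<Sum>j<m. p j * c j) \<le> \<theta> * (\<Sum>j<m. c j)"
proof -
  have "c m * (\<Sum>j<m. \<theta> - p j) \<le> (\<Sum>j<m. (\<theta> - p j) * c j)"
  proof (induction m)
    case (Suc m)
    have nn: "0 \<le> (\<Sum>j<Suc m. \<theta> - p j)"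
      using p[of "Suc m"] by (simp add: sum_subtractf mult.commute)
    have "c (Suc m) * (\<Sum>j<Suc m. \<theta> - p j) \<le> c m * (\<Sum>j<Suc m. \<theta> - p j)"
      using c(1) nn by (rule mult_right_mono)
    also have "\<dots> = c m * (\<Sum>j<m. \<theta> - p j) + (\<theta> - p m) * c m"
      by (simp add: algebra_simps)
    finally show ?case using Suc by simp
  qed simp
  moreover have "0 \<le> c m * (\<Sum>j<m. \<theta> - p j)"
    using p[of m] c(2) by (simp add: sum_subtractf mult.commute)
  ultimately have "0 \<le> (\<Sum>j<m. (\<theta> - p j) * c j)" by linarith
  then show ?thesis by (simp add: left_diff_distrib sum_subtractf sum_distrib_left)
qed

lemma sum_inverse_sqrt_le: "(\<Sum>j<m. 1 / sqrt (real j + 1)) \<le> 2 * sqrt (real m)"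
proof (induction m)
  case (Suc m)
  have "1 / sqrt (real m + 1) \<le> 2 * sqrt (real m + 1) - 2 * sqrt (real m)"
  proof -
    have "2 * (sqrt (real m) * sqrt (real m + 1)) \<le> sqrt (real m) ^ 2 + sqrt (real m + 1) ^ 2"
      using sum_squares_bound[of "sqrt (real m)" "sqrt (real m + 1)"] by simp
    then have "1 \<le> (2 * sqrt (real m + 1) - 2 * sqrt (real m)) * sqrt (real m + 1)"
      by (simp add: algebra_simps)
    then show ?thesis by (simp add: field_simps)
  qed
  then show ?case using Suc by (simp add: add.commute)
qed simp

lemma sum_inverse_le_ln:
  assumes "0 < d"
  shows "(\<Sum>j<n. 1 / (real j + 1 + real d)) \<le> ln (1 + real n / real d)"
proof (induction n)
  case (Suc n)
  have "1 / (real n + 1 + real d) \<le> ln (1 + real (Suc n) / real d) - ln (1 + real n / real d)"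
  proof -
    let ?a = "real n + real d"
    have a: "0 < ?a" using assms by simp
    have "ln (?a / (?a + 1)) \<le> ?a / (?a + 1) - 1" using a by (intro ln_le_minus_one) auto
    also have "\<dots> = - (1 / (?a + 1))" using a by (simp add: field_simps)
    finally have "1 / (?a + 1) \<le> ln (?a + 1) - ln ?a" using a by (simp add: ln_div)
    also have "\<dots> = ln (1 + real (Suc n) / real d) - ln (1 + real n / real d)"
    proof -
      have "1 + real (Suc n) / real d = (?a + 1) / real d" "1 + real n / real d = ?a / real d"
        using assms by (auto simp: field_simps)
      then show ?thesis using a assms by (simp add: ln_div)
    qed
    finally show ?thesis by (simp add: algebra_simps)
  qed
  then show ?case using Suc by simp
qed simp

lemma sum_inverse_ge_ln:
  "ln (real (n + d + 1) / real (d + 1)) \<le> (\<Sum>j<n. 1 / (real j + real d + 1))"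
proof (induction n)
  case (Suc n)
  let ?a = "real (n + d + 1)"
  have a: "0 < ?a" by simp
  have "ln ((?a + 1) / ?a) \<le> (?a + 1) / ?a - 1" using a by (intro ln_le_minus_one) auto
  also have "\<dots> = 1 / ?a" using a by (simp add: field_simps)
  finally have "ln (?a + 1) - ln ?a \<le> 1 / ?a" using a by (simp add: ln_div)
  moreover have "ln (real (Suc n + d + 1) / real (d + 1)) - ln (?a / real (d + 1)) = ln (?a + 1) - ln ?a"
  proof -
    have "ln (real (Suc n + d + 1) / real (d + 1)) = ln (?a + 1) - ln (real (d + 1))"
      using ln_div[of "?a + 1" "real (d + 1)"] by (simp add: algebra_simps)
    moreover have "ln (?a / real (d + 1)) = ln ?a - ln (real (d + 1))"
      using ln_div[of ?a "real (d + 1)"] by simp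
    ultimately show ?thesis by simp
  qed
  ultimately show ?case using Suc by (simp add: algebra_simps)
qed simp

text \<open>
  With \<open>a = N / d \<ge> 2\<close> the ratio is at least \<open>(1 + a) / 2\<close>, whose third power exceeds \<open>1 + a\<close>.
\<close>

lemma ln_ratio_ge:
  assumes "0 < d" "2 * d \<le> N"
  shows "ln (1 + real N / real d) / 3 \<le> ln (real (N + 1) / real (d + 1))"
proof -
  define a where "a = real N / real d"
  have a: "2 \<le> a" unfolding a_def using assms by (simp add: field_simps)
  have "real d * (real d - 1) \<le> real N * (real d - 1)" using assms by (intro mult_right_mono) auto
  then have "(1 + a) / 2 \<le> real (N + 1) / real (d + 1)"
    unfolding a_def using assms by (simp add: field_simps)
  then have "ln ((1 + a) / 2) \<le> ln (real (N + 1) / real (d + 1))"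
    using a by (subst ln_le_cancel_iff) auto
  moreover have "ln (1 + a) \<le> ln (((1 + a) / 2) ^ 3)"
  proof (subst ln_le_cancel_iff)
    have "8 * (1 + a) \<le> (1 + a)\<^sup>2 * (1 + a)"
      using a power_mono[of 3 "1 + a" 2] by (intro mult_right_mono) auto
    then show "1 + a \<le> ((1 + a) / 2) ^ 3" by (simp add: power3_eq_cube power2_eq_square field_simps)
  qed (use a in auto)
  ultimately have "ln (1 + a) \<le> 3 * ln (real (N + 1) / real (d + 1))"
    using a by (simp only: ln_realpow[of "(1 + a) / 2" 3])
  then show ?thesis unfolding a_def by simp
qed

lemma cos_ge_exp:
  fixes x :: real
  assumes "x\<^sup>2 \<le> 3 / 2"
  shows "exp (- 2 * x\<^sup>2) \<le> cos x"
proof -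
  have "exp (- 2 * x\<^sup>2) = 1 / exp (2 * x\<^sup>2)" by (simp add: exp_minus field_simps)
  also have "\<dots> \<le> 1 / (1 + 2 * x\<^sup>2)"
    using exp_ge_add_one_self[of "2 * x\<^sup>2"] by (intro divide_left_mono) (auto intro!: mult_pos_pos add_pos_nonneg)
  also have "\<dots> \<le> 1 - x\<^sup>2 / 2"
  proof -
    have "0 \<le> x\<^sup>2 * (3 / 2 - x\<^sup>2)" using assms by simp
    then have "1 \<le> (1 - x\<^sup>2 / 2) * (1 + 2 * x\<^sup>2)" by (simp add: algebra_simps)
    then show ?thesis by (simp add: divide_le_eq add_pos_nonneg)
  qed
  also have "\<dots> \<le> cos x"
  proof -
    have "(sin (x / 2))\<^sup>2 \<le> (x / 2)\<^sup>2"
      using abs_sin_x_le_abs_x[of "x / 2"] by (simp only: abs_le_square_iff)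
    then show ?thesis using cos_double_sin[of "x / 2"] by (simp add: power_divide)
  qed
  finally show ?thesis .
qed

lemma cos_power_sin_nonneg:
  fixes L :: nat
  assumes L: "2 \<le> L"
  shows "0 \<le> cos (pi / L) ^ m * sin (pi / L)"
proof -
  have a: "0 \<le> pi / L" by simp
  have b: "pi / L \<le> pi / 2" using L by (intro divide_left_mono) auto
  have "0 \<le> cos (pi / L)" by (rule cos_ge_zero) (use a b pi_gt_zero in linarith)+
  moreover have "0 \<le> sin (pi / L)" by (rule sin_ge_zero) (use a b pi_gt_zero in linarith)+
  ultimately show ?thesis by simp
qed

lemma sin_ge_half:
  fixes x :: real
  assumes "0 \<le> x" "x \<le> pi / 3"
  shows "x / 2 \<le> sin x"
proof (cases "x = 0")
  case False
  then obtain z where z: "0 < z" "z < x" "sin x - sin 0 = (x - 0) * cos z"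
    using MVT2[of 0 x sin cos] assms by auto
  have "cos (pi / 3) \<le> cos z" using z assms by (intro cos_monotone_0_pi_le) auto
  then have "1 / 2 \<le> cos z" by (simp add: cos_60)
  then have "x * (1 / 2) \<le> x * cos z" using assms by (intro mult_left_mono) auto
  then show ?thesis using z by simp
qed simp

lemma pi_square_le: "pi\<^sup>2 \<le> 10"
proof -
  have "pi\<^sup>2 \<le> (3.15)\<^sup>2" using pi_approx by (intro power_mono) auto
  then show ?thesis by (simp add: power2_eq_square)
qed

type_synonym driver = "(nat \<Rightarrow> real) \<times> (nat \<Rightarrow> int)"

section \<open>Waiting times and steps as independent sequences\<close>

definition exp_law :: "real measure" where
  "exp_law = density lborel (\<lambda>t. ennreal (exponential_density 1 t))"

definition coin_law :: "int measure" where
  "coin_law = measure_pmf (pmf_of_set {-1, 1})"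

definition waits_law :: "(nat \<Rightarrow> real) measure" where
  "waits_law = (\<Pi>\<^sub>M k\<in>UNIV. exp_law)"

definition steps_law :: "(nat \<Rightarrow> int) measure" where
  "steps_law = (\<Pi>\<^sub>M k\<in>UNIV. coin_law)"

definition driver_law :: "driver measure" where
  "driver_law = waits_law \<Otimes>\<^sub>M steps_law"

definition arrival :: "(nat \<Rightarrow> real) \<Rightarrow> nat \<Rightarrow> real" where
  "arrival a n = (\<Sum>k<n. a k)"

definition disp :: "(nat \<Rightarrow> int) \<Rightarrow> nat \<Rightarrow> int" where
  "disp s n = (\<Sum>k<n. s k)"

lemma sets_exp_law [measurable_cong]: "sets exp_law = sets borel"
  by (simp add: exp_law_def)

lemma sets_coin_law [measurable_cong]: "sets coin_law = sets (count_space UNIV)"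
  by (simp add: coin_law_def)

lemma space_exp_law [simp]: "space exp_law = UNIV"
  by (simp add: exp_law_def)

lemma space_coin_law [simp]: "space coin_law = UNIV"
  by (simp add: coin_law_def)

lemma space_waits_law [simp]: "space waits_law = UNIV"
  by (simp add: waits_law_def space_PiM)

lemma space_steps_law [simp]: "space steps_law = UNIV"
  by (simp add: steps_law_def space_PiM)

lemma space_driver_law [simp]: "space driver_law = UNIV"
  by (simp add: driver_law_def space_pair_measure)

lemma prob_space_exp_law: "prob_space exp_law"
  unfolding exp_law_def by (rule prob_space_exponential_density) simp

lemma prob_space_coin_law: "prob_space coin_law"
  unfolding coin_law_def by (rule prob_space_measure_pmf)

lemma prob_space_waits_law: "prob_space waits_law"
  unfolding waits_law_def by (intro prob_space_PiM prob_space_exp_law)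

lemma prob_space_steps_law: "prob_space steps_law"
  unfolding steps_law_def by (intro prob_space_PiM prob_space_coin_law)

interpretation waits: prob_space waits_law by (rule prob_space_waits_law)
interpretation steps: prob_space steps_law by (rule prob_space_steps_law)
interpretation waits_steps: pair_prob_space waits_law steps_law ..

lemma prob_space_driver_law: "prob_space driver_law"
  unfolding driver_law_def by (rule waits_steps.prob_space_axioms)

interpretation driver: prob_space driver_law by (rule prob_space_driver_law)
interpretation two_drivers: pair_prob_space driver_law driver_law ..

abbreviation pair_law :: "(driver \<times> driver) measure" where
  "pair_law \<equiv> driver_law \<Otimes>\<^sub>M driver_law"

abbreviation pair_prob :: "(driver \<Rightarrow> driver \<Rightarrow> bool) \<Rightarrow> real" where
  "pair_prob R \<equiv> \<P>(x in pair_law. R (fst x) (snd x))"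

lemma space_pair_law [simp]: "space pair_law = UNIV"
  by (simp add: space_pair_measure)

lemma sets_driver_law [measurable_cong]: "sets driver_law = sets (waits_law \<Otimes>\<^sub>M steps_law)"
  by (simp add: driver_law_def)

lemma measurable_wait [measurable]: "(\<lambda>a. a k) \<in> borel_measurable waits_law"
proof -
  have "(\<lambda>a. a k) \<in> measurable waits_law exp_law"
    unfolding waits_law_def by (rule measurable_component_singleton) simp
  then show ?thesis by (simp add: measurable_cong_sets[OF refl sets_exp_law])
qed

lemma measurable_step [measurable]: "(\<lambda>s. s k) \<in> measurable steps_law (count_space UNIV)"
proof -
  have "(\<lambda>s. s k) \<in> measurable steps_law coin_law"
    unfolding steps_law_def by (rule measurable_component_singleton) simp
  then show ?thesis by (simp add: measurable_cong_sets[OF refl sets_coin_law])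
qed

lemma measurable_arrival [measurable]: "(\<lambda>a. arrival a n) \<in> borel_measurable waits_law"
  unfolding arrival_def by measurable

lemma measurable_disp [measurable]: "(\<lambda>s. disp s n) \<in> measurable steps_law (count_space UNIV)"
proof (induction n)
  case (Suc n)
  have "(\<lambda>s. (\<lambda>i s. i + s n) (disp s n) s) \<in> measurable steps_law (count_space UNIV)"
    by (rule measurable_compose_countable[OF _ Suc]) measurable
  then show ?case by (simp add: disp_def)
qed (simp add: disp_def)

lemma arrival_0 [simp]: "arrival a 0 = 0" and arrival_Suc: "arrival a (Suc n) = arrival a n + a n"
  by (simp_all add: arrival_def)

lemma disp_0 [simp]: "disp s 0 = 0" and disp_Suc: "disp s (Suc n) = disp s n + s n"
  by (simp_all add: disp_def)

lemma arrival_add: "arrival a (n + m) = arrival a n + arrival (\<lambda>k. a (n + k)) m"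
  by (induction m) (simp_all add: arrival_Suc)

lemma disp_add: "disp s (n + m) = disp s n + disp (\<lambda>k. s (n + k)) m"
  by (induction m) (simp_all add: disp_Suc)

lemma arrival_cong: "(\<And>k. k < n \<Longrightarrow> a k = b k) \<Longrightarrow> arrival a n = arrival b n"
  by (simp add: arrival_def)

lemma disp_cong: "(\<And>k. k < n \<Longrightarrow> a k = b k) \<Longrightarrow> disp a n = disp b n"
  by (simp add: disp_def)

text \<open>
  The Markov property at a deterministic index: a condition on the first \<open>n\<close> entries and a condition on the
  remaining sequence are independent.
\<close>

lemma sequence_split:
  fixes M :: "'a measure"
  defines "S \<equiv> (\<Pi>\<^sub>M k\<in>(UNIV :: nat set). M)"
  assumes M: "prob_space M" and [simp]: "space M = UNIV"
    and Q1 [measurable]: "Measurable.pred S Q1" and Q2 [measurable]: "Measurable.pred S Q2"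
    and prefix: "\<And>\<omega> \<omega>'. (\<And>k. k < n \<Longrightarrow> \<omega> k = \<omega>' k) \<Longrightarrow> Q1 \<omega> \<Longrightarrow> Q1 \<omega>'"
  shows "\<P>(\<omega> in S. Q1 \<omega> \<and> Q2 (\<lambda>k. \<omega> (n + k))) = \<P>(\<omega> in S. Q1 \<omega>) * \<P>(\<omega> in S. Q2 \<omega>)"
proof -
  interpret M: prob_space M by fact
  interpret sequence_space M by unfold_locales
  have [simp]: "space S = UNIV" by (simp add: S_def space_PiM)
  have pS: "prob_space S" unfolding S_def by (intro prob_space_PiM M)
  interpret S: prob_space S by (rule pS)
  interpret SS: pair_prob_space S S ..
  have shift [measurable]: "(\<lambda>\<omega> k. \<omega> (n + k)) \<in> measurable S S"
    unfolding S_def by (rule measurable_PiM_single') (auto intro: measurable_component_singleton)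
  have comb [measurable]: "(\<lambda>(\<omega>, \<omega>'). comb_seq n \<omega> \<omega>') \<in> measurable (S \<Otimes>\<^sub>M S) S"
    unfolding S_def by (rule measurable_comb_seq)
  let ?E = "{\<omega> \<in> space S. Q1 \<omega> \<and> Q2 (\<lambda>k. \<omega> (n + k))}"
  have Q1c: "Q1 (comb_seq n \<omega> \<omega>') \<longleftrightarrow> Q1 \<omega>" for \<omega> \<omega>'
    by (rule iffI; rule prefix; auto simp: comb_seq_def)
  have Q2c: "(\<lambda>k. comb_seq n \<omega> \<omega>' (n + k)) = \<omega>'" for \<omega> \<omega>'
    by (auto simp: comb_seq_def)
  have E: "?E \<in> sets S" by measurable
  have "measure S ?E = measure (distr (S \<Otimes>\<^sub>M S) S (\<lambda>(\<omega>, \<omega>'). comb_seq n \<omega> \<omega>')) ?E"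
    using PiM_comb_seq[of n] by (simp add: S_def)
  also have "\<dots> = measure (S \<Otimes>\<^sub>M S) ((\<lambda>(\<omega>, \<omega>'). comb_seq n \<omega> \<omega>') -` ?E \<inter> space (S \<Otimes>\<^sub>M S))"
    using E by (intro measure_distr) measurable
  also have "(\<lambda>(\<omega>, \<omega>'). comb_seq n \<omega> \<omega>') -` ?E \<inter> space (S \<Otimes>\<^sub>M S)
      = {\<omega> \<in> space S. Q1 \<omega>} \<times> {\<omega> \<in> space S. Q2 \<omega>}"
    by (auto simp: space_pair_measure Q1c Q2c)
  also have "measure (S \<Otimes>\<^sub>M S) \<dots> = \<P>(\<omega> in S. Q1 \<omega>) * \<P>(\<omega> in S. Q2 \<omega>)"
  proof -
    have "{\<omega> \<in> space S. Q1 \<omega>} \<in> sets S" "{\<omega> \<in> space S. Q2 \<omega>} \<in> sets S" by measurable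
    then show ?thesis unfolding measure_def by (simp only: S.emeasure_pair_measure_Times enn2real_mult)
  qed
  finally show ?thesis .
qed

lemmas waits_split = sequence_split[OF prob_space_exp_law space_exp_law, folded waits_law_def]
lemmas steps_split = sequence_split[OF prob_space_coin_law space_coin_law, folded steps_law_def]

lemma PiM_nn_integral_prod:
  fixes M :: "'a measure" and f :: "'i \<Rightarrow> 'a \<Rightarrow> ennreal"
  assumes M: "prob_space M" and J: "finite J"
    and f [measurable]: "\<And>i. f i \<in> borel_measurable M"
  shows "(\<integral>\<^sup>+ \<omega>. (\<Prod>i\<in>J. f i (\<omega> i)) \<partial>(\<Pi>\<^sub>M k\<in>UNIV. M)) = (\<Prod>i\<in>J. \<integral>\<^sup>+ x. f i x \<partial>M)"
proof -
  interpret M: prob_space M by fact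
  interpret product_prob_space "\<lambda>_::'i. M" UNIV by unfold_locales
  have "(\<integral>\<^sup>+ \<omega>. (\<Prod>i\<in>J. f i (\<omega> i)) \<partial>(\<Pi>\<^sub>M k\<in>UNIV. M))
      = (\<integral>\<^sup>+ \<omega>. (\<Prod>i\<in>J. f i (restrict \<omega> J i)) \<partial>(\<Pi>\<^sub>M k\<in>UNIV. M))"
    by (intro nn_integral_cong prod.cong) auto
  also have "\<dots> = (\<integral>\<^sup>+ \<omega>. (\<Prod>i\<in>J. f i (\<omega> i)) \<partial>(distr (\<Pi>\<^sub>M k\<in>UNIV. M) (\<Pi>\<^sub>M k\<in>J. M) (\<lambda>\<omega>. restrict \<omega> J)))"
    by (subst nn_integral_distr) measurable
  also have "distr (\<Pi>\<^sub>M k\<in>UNIV. M) (\<Pi>\<^sub>M k\<in>J. M) (\<lambda>\<omega>. restrict \<omega> J) = (\<Pi>\<^sub>M k\<in>J. M)"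
    using distr_PiM_restrict_finite[OF J] by simp
  also have "(\<integral>\<^sup>+ \<omega>. (\<Prod>i\<in>J. f i (\<omega> i)) \<partial>(\<Pi>\<^sub>M k\<in>J. M)) = (\<Prod>i\<in>J. \<integral>\<^sup>+ x. f i x \<partial>M)"
    by (rule product_nn_integral_prod[OF J]) measurable
  finally show ?thesis .
qed

definition zip_seq :: "driver \<Rightarrow> nat \<Rightarrow> real \<times> int" where
  "zip_seq \<omega> k = (fst \<omega> k, snd \<omega> k)"

lemma jump_law_eq: "jump_law = exp_law \<Otimes>\<^sub>M coin_law"
  by (simp add: jump_law_def exp_law_def coin_law_def)

lemma measurable_zip_seq [measurable]: "zip_seq \<in> measurable driver_law walk_law"
proof -
  have "(\<lambda>\<omega> k. (fst \<omega> k, snd \<omega> k)) \<in> measurable driver_law walk_law"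
    unfolding walk_law_def jump_law_eq driver_law_def waits_law_def steps_law_def
    by (rule measurable_PiM_single') (auto simp: space_pair_measure)
  then show ?thesis by (simp add: zip_seq_def[abs_def])
qed

text \<open>
  The i.i.d. sequence of pairs is a pair of independent i.i.d. sequences. Since the generating cylinders need not be
  products of a condition on waits and one on steps, both laws are compared by integrating
  the product of the indicator functions, first over the steps and then over the waits.
\<close>

lemma walk_law_eq: "walk_law = distr driver_law walk_law zip_seq"
proof -
  interpret jump: prob_space jump_law by (rule prob_space_jump_law)
  interpret product_prob_space "\<lambda>_::nat. jump_law" UNIV by unfold_locales
  interpret exp_law: prob_space exp_law by (rule prob_space_exp_law)
  interpret coin_law: prob_space coin_law by (rule prob_space_coin_law)
  interpret ec: pair_prob_space exp_law coin_law ..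
  have "distr driver_law walk_law zip_seq = (\<Pi>\<^sub>M k\<in>(UNIV :: nat set). jump_law)"
  proof (rule PiM_eq)
    show "sets (distr driver_law walk_law zip_seq) = sets (\<Pi>\<^sub>M k\<in>(UNIV :: nat set). jump_law)"
      by (simp add: walk_law_def)
    fix J :: "nat set" and F :: "nat \<Rightarrow> (real \<times> int) set"
    assume J: "finite J" and F: "\<And>j. j \<in> J \<Longrightarrow> F j \<in> sets jump_law"
    define G where "G j = (if j \<in> J then F j else space jump_law)" for j
    have G [measurable]: "G j \<in> sets (exp_law \<Otimes>\<^sub>M coin_law)" for j
      using F by (auto simp: G_def jump_law_eq)
    let ?X = "prod_emb UNIV (\<lambda>_. jump_law) J (Pi\<^sub>E J F)"
    have spJ: "space jump_law = UNIV" by (simp add: jump_law_eq space_pair_measure)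
    have X: "?X \<in> sets walk_law" unfolding walk_law_def using J F by (intro sets_PiM_I) auto
    have pre: "zip_seq -` ?X \<inter> space driver_law = {\<omega>. \<forall>j\<in>J. (fst \<omega> j, snd \<omega> j) \<in> G j}"
      using F by (auto simp: prod_emb_def PiE_iff zip_seq_def G_def spJ extensional_def)
    have preI: "{\<omega>. \<forall>j\<in>J. (fst \<omega> j, snd \<omega> j) \<in> G j} \<in> sets (waits_law \<Otimes>\<^sub>M steps_law)"
      using measurable_sets[OF measurable_zip_seq X] unfolding pre by (simp add: driver_law_def)
    have "emeasure (distr driver_law walk_law zip_seq) ?X
        = emeasure (waits_law \<Otimes>\<^sub>M steps_law) {\<omega>. \<forall>j\<in>J. (fst \<omega> j, snd \<omega> j) \<in> G j}"
      by (subst emeasure_distr[OF measurable_zip_seq X], subst pre) (simp add: driver_law_def)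
    also have "\<dots> = (\<integral>\<^sup>+ a. \<integral>\<^sup>+ s. indicator {\<omega>. \<forall>j\<in>J. (fst \<omega> j, snd \<omega> j) \<in> G j} (a, s) \<partial>steps_law \<partial>waits_law)"
      by (rule steps.emeasure_pair_measure[OF preI])
    also have "\<dots> = (\<integral>\<^sup>+ a. \<integral>\<^sup>+ s. (\<Prod>j\<in>J. indicator (G j) (a j, s j)) \<partial>steps_law \<partial>waits_law)"
      by (intro nn_integral_cong) (auto simp: indicator_def prod_eq_1_iff J split: if_splits)
    also have "\<dots> = (\<integral>\<^sup>+ a. (\<Prod>j\<in>J. \<integral>\<^sup>+ y. indicator (G j) (a j, y) \<partial>coin_law) \<partial>waits_law)"
      unfolding steps_law_def
      by (intro nn_integral_cong PiM_nn_integral_prod[OF prob_space_coin_law J]) (auto simp: coin_law_def)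
    also have "\<dots> = (\<Prod>j\<in>J. \<integral>\<^sup>+ x. \<integral>\<^sup>+ y. indicator (G j) (x, y) \<partial>coin_law \<partial>exp_law)"
      unfolding waits_law_def
      by (intro PiM_nn_integral_prod[OF prob_space_exp_law J]) measurable
    also have "\<dots> = (\<Prod>j\<in>J. emeasure jump_law (F j))"
    proof (rule prod.cong[OF refl])
      fix j assume "j \<in> J"
      then show "(\<integral>\<^sup>+ x. \<integral>\<^sup>+ y. indicator (G j) (x, y) \<partial>coin_law \<partial>exp_law) = emeasure jump_law (F j)"
        using coin_law.emeasure_pair_measure[OF G[of j]] by (simp add: G_def jump_law_eq)
    qed
    finally show "emeasure (distr driver_law walk_law zip_seq) ?X = (\<Prod>j\<in>J. emeasure jump_law (F j))" .
  qed
  then show ?thesis by (simp add: walk_law_def)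
qed

lemma two_walks_law_eq:
  "two_walks_law = distr (pair_law) two_walks_law (\<lambda>(p, q). (zip_seq p, zip_seq q))"
proof -
  interpret walk: prob_space walk_law by (rule prob_space_walk_law)
  have "two_walks_law = distr driver_law walk_law zip_seq \<Otimes>\<^sub>M distr driver_law walk_law zip_seq"
    using walk_law_eq by (simp add: two_walks_law_def)
  also have "\<dots> = distr (pair_law) (walk_law \<Otimes>\<^sub>M walk_law) (\<lambda>(p, q). (zip_seq p, zip_seq q))"
    by (rule pair_measure_distr) (auto simp: walk_law_eq[symmetric] walk.sigma_finite_measure_axioms)
  finally show ?thesis by (simp add: two_walks_law_def)
qed

section \<open>Displacements and arrival times\<close>

lemma AE_steps: "AE s in steps_law. \<forall>k. s k = 1 \<or> s k = - 1"
  unfolding AE_all_countable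
proof
  fix k
  have "AE x in coin_law. x = 1 \<or> x = - 1"
    unfolding coin_law_def by (rule AE_pmfI) auto
  then show "AE s in steps_law. s k = 1 \<or> s k = - 1"
    unfolding steps_law_def by (intro AE_PiM_component prob_space_coin_law) auto
qed

lemma prob_step: "e = 1 \<or> e = - 1 \<Longrightarrow> \<P>(s in steps_law. s 0 = e) = 1 / 2"
proof -
  assume e: "e = 1 \<or> e = - 1"
  interpret coin: prob_space coin_law by (rule prob_space_coin_law)
  interpret product_prob_space "\<lambda>_::nat. coin_law" UNIV by unfold_locales
  have "\<P>(s in steps_law. s 0 = e) = measure (distr steps_law coin_law (\<lambda>s. s 0)) {e}"
    by (subst measure_distr) (auto simp: vimage_def coin_law_def)
  also have "distr steps_law coin_law (\<lambda>s. s 0) = coin_law"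
    unfolding steps_law_def by (rule PiM_component) simp
  also have "measure coin_law {e} = 1 / 2"
    using e by (auto simp: coin_law_def measure_pmf_single)
  finally show ?thesis .
qed

lemma steps_shift_measurable: "(\<lambda>s k. s (n + k)) \<in> measurable steps_law steps_law"
  unfolding steps_law_def
  by (rule measurable_PiM_single') (auto intro: measurable_component_singleton)

text \<open>
  First-step analysis, in the form used for all events that concern the range of a walk.
\<close>

lemma prob_first_step:
  assumes [measurable]: "Measurable.pred steps_law Q" "Measurable.pred steps_law Qa" "Measurable.pred steps_law Qb"
    and a: "\<And>s. s 0 = 1 \<Longrightarrow> Q s \<longleftrightarrow> Qa (\<lambda>k. s (1 + k))"
    and b: "\<And>s. s 0 = - 1 \<Longrightarrow> Q s \<longleftrightarrow> Qb (\<lambda>k. s (1 + k))"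
  shows "\<P>(s in steps_law. Q s) = (\<P>(s in steps_law. Qa s) + \<P>(s in steps_law. Qb s)) / 2"
proof -
  have shift: "Measurable.pred steps_law (\<lambda>s. R (\<lambda>k. s (1 + k)))" if "Measurable.pred steps_law R" for R
    by (rule measurable_compose[OF steps_shift_measurable that])
  have [measurable]: "Measurable.pred steps_law (\<lambda>s. Qa (\<lambda>k. s (1 + k)))"
    "Measurable.pred steps_law (\<lambda>s. Qb (\<lambda>k. s (1 + k)))"
    by (rule shift, fact)+
  have split: "\<P>(s in steps_law. s 0 = e \<and> R (\<lambda>k. s (1 + k))) = \<P>(s in steps_law. R s) / 2"
    if "e = 1 \<or> e = - 1" and [measurable]: "Measurable.pred steps_law R" for e R
    using steps_split[of "\<lambda>s. s 0 = e" R 1] prob_step[OF that(1)] by simp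
  have "\<P>(s in steps_law. Q s)
      = \<P>(s in steps_law. (s 0 = 1 \<and> Qa (\<lambda>k. s (1 + k))) \<or> (s 0 = - 1 \<and> Qb (\<lambda>k. s (1 + k))))"
  proof (rule steps.prob_eq_AE)
    show "AE s in steps_law. Q s \<longleftrightarrow>
        (s 0 = 1 \<and> Qa (\<lambda>k. s (1 + k))) \<or> (s 0 = - 1 \<and> Qb (\<lambda>k. s (1 + k)))"
      using AE_steps
    proof eventually_elim
      case (elim s)
      then have "s 0 = 1 \<or> s 0 = - 1" by blast
      then show ?case using a[of s] b[of s] by auto
    qed
  qed measurable
  also have "\<dots> = \<P>(s in steps_law. s 0 = 1 \<and> Qa (\<lambda>k. s (1 + k))) + \<P>(s in steps_law. s 0 = - 1 \<and> Qb (\<lambda>k. s (1 + k)))"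
  proof (subst steps.finite_measure_Union[symmetric])
    show "{s \<in> space steps_law. s 0 = 1 \<and> Qa (\<lambda>k. s (1 + k))} \<in> sets steps_law"
      "{s \<in> space steps_law. s 0 = - 1 \<and> Qb (\<lambda>k. s (1 + k))} \<in> sets steps_law"
      by measurable
  qed (auto intro!: arg_cong[where f="measure steps_law"])
  also have "\<dots> = (\<P>(s in steps_law. Qa s) + \<P>(s in steps_law. Qb s)) / 2"
    using split[of 1 Qa] split[of "-1" Qb] by simp
  finally show ?thesis .
qed

lemma all_le_Suc: "(\<forall>j\<le>Suc n. P j) \<longleftrightarrow> P 0 \<and> (\<forall>j\<le>n. P (Suc j))"
  using All_less_Suc2[of "Suc n" P] by (simp add: less_Suc_eq_le)

lemma disp_Suc_shift: "disp s (Suc j) = s 0 + disp (\<lambda>k. s (1 + k)) j"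
  using disp_add[of s 1 j] by (simp add: disp_def)

lemma pred_disp: "Measurable.pred steps_law (\<lambda>s. R (disp s j))"
  by (rule measurable_compose[OF measurable_disp]) simp

lemma pred_all_disp: "Measurable.pred steps_law (\<lambda>s. \<forall>j\<le>n. R j (disp s j))"
proof -
  have [measurable]: "Measurable.pred steps_law (\<lambda>s. R j (disp s j))" for j by (rule pred_disp)
  show ?thesis by measurable
qed

text \<open>
  The sign \<open>e\<close> makes the same statement available for the maximum and for minus the minimum.
\<close>

lemma prob_max_le:
  assumes e: "e = 1 \<or> e = - 1"
  shows "\<P>(s in steps_law. \<forall>j\<le>n. e * disp s j \<le> k) = maxcdf n k"
proof (induction n arbitrary: k)
  case 0
  then show ?case using steps.prob_space by auto
next
  case (Suc n)
  show ?case
  proof (cases "k < 0")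
    case True
    then have E: "{s \<in> space steps_law. \<forall>j\<le>Suc n. e * disp s j \<le> k} = {}"
      by (auto intro!: exI[of _ 0])
    show ?thesis unfolding E using True by simp
  next
    case False
    have "\<P>(s in steps_law. \<forall>j\<le>Suc n. e * disp s j \<le> k)
        = (\<P>(s in steps_law. \<forall>j\<le>n. e * disp s j \<le> k - e) + \<P>(s in steps_law. \<forall>j\<le>n. e * disp s j \<le> k + e)) / 2"
    proof (rule prob_first_step)
      show "(\<forall>j\<le>Suc n. e * disp s j \<le> k) \<longleftrightarrow> (\<forall>j\<le>n. e * disp (\<lambda>k. s (1 + k)) j \<le> k - e)" if "s 0 = 1" for s
        unfolding all_le_Suc disp_Suc_shift that using False by (simp add: distrib_left le_diff_eq add.commute)
      show "(\<forall>j\<le>Suc n. e * disp s j \<le> k) \<longleftrightarrow> (\<forall>j\<le>n. e * disp (\<lambda>k. s (1 + k)) j \<le> k + e)" if "s 0 = - 1" for s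
        unfolding all_le_Suc disp_Suc_shift that using False by (simp add: right_diff_distrib diff_le_eq)
    qed (rule pred_all_disp)+
    then show ?thesis unfolding Suc.IH using e False by auto
  qed
qed

lemma prob_max_eq:
  assumes e: "e = 1 \<or> e = - 1"
  shows "\<P>(s in steps_law. (\<forall>j\<le>n. e * disp s j \<le> int k) \<and> (\<exists>j\<le>n. e * disp s j = int k)) = maxpmf n k"
proof -
  have "\<P>(s in steps_law. (\<forall>j\<le>n. e * disp s j \<le> int k) \<and> (\<exists>j\<le>n. e * disp s j = int k))
      = measure steps_law ({s. \<forall>j\<le>n. e * disp s j \<le> int k} - {s. \<forall>j\<le>n. e * disp s j \<le> int k - 1})"
  proof (rule arg_cong[where f="measure steps_law"], rule set_eqI)
    fix s
    have "e * disp s j = int k \<longleftrightarrow> \<not> e * disp s j \<le> int k - 1" if "e * disp s j \<le> int k" for j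
      using that by linarith
    then have "(\<exists>j\<le>n. e * disp s j = int k) \<longleftrightarrow> \<not> (\<forall>j\<le>n. e * disp s j \<le> int k - 1)"
      if "\<forall>j\<le>n. e * disp s j \<le> int k"
      using that by blast
    then show "s \<in> {s \<in> space steps_law. (\<forall>j\<le>n. e * disp s j \<le> int k) \<and> (\<exists>j\<le>n. e * disp s j = int k)} \<longleftrightarrow>
        s \<in> {s. \<forall>j\<le>n. e * disp s j \<le> int k} - {s. \<forall>j\<le>n. e * disp s j \<le> int k - 1}"
      by auto
  qed
  also have "\<dots> = measure steps_law {s. \<forall>j\<le>n. e * disp s j \<le> int k} - measure steps_law {s. \<forall>j\<le>n. e * disp s j \<le> int k - 1}"
  proof (rule steps.finite_measure_Diff)
    have "Measurable.pred steps_law (\<lambda>s. \<forall>j\<le>n. e * disp s j \<le> c)" for c by (rule pred_all_disp)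
    then have ev: "{s. \<forall>j\<le>n. e * disp s j \<le> c} \<in> sets steps_law" for c
      unfolding pred_def space_steps_law by simp
    show "{s. \<forall>j\<le>n. e * disp s j \<le> int k} \<in> sets steps_law"
        "{s. \<forall>j\<le>n. e * disp s j \<le> int k - 1} \<in> sets steps_law" by (rule ev)+
    have "e * disp s j \<le> int k - 1 \<Longrightarrow> e * disp s j \<le> int k" for s j by linarith
    then show "{s. \<forall>j\<le>n. e * disp s j \<le> int k - 1} \<subseteq> {s. \<forall>j\<le>n. e * disp s j \<le> int k}" by blast
  qed
  also have "\<dots> = maxpmf n k"
    using prob_max_le[OF e, of n "int k"] prob_max_le[OF e, of n "int k - 1"] by (simp add: maxpmf_def)
  finally show ?thesis .
qed

text \<open>
  Killing the walk outside of \<open>{0<..<L}\<close> turns \<open>\<lambda>p. sin (pi * p / L)\<close> into an eigenfunction of the one-step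
  operator, with eigenvalue \<open>cos (pi / L)\<close>. It is dominated by the indicator of survival at time \<open>0\<close>, and the
  domination propagates through the first-step recursion.
\<close>

lemma prob_stay_between:
  assumes "2 \<le> L" "0 \<le> p" "p \<le> int L"
  shows "cos (pi / L) ^ n * sin (pi * of_int p / L)
    \<le> \<P>(s in steps_law. \<forall>j\<le>n. 0 < p + disp s j \<and> p + disp s j < int L)"
  using assms(2,3)
proof (induction n arbitrary: p)
  case 0
  then show ?case
    using steps.prob_space by (cases "p = 0 \<or> p = int L") auto
next
  case (Suc n)
  show ?case
  proof (cases "p = 0 \<or> p = int L")
    case True
    then have "sin (pi * of_int p / L) = 0" using assms by auto
    then show ?thesis by simp
  next
    case False
    let ?P = "\<lambda>p. \<P>(s in steps_law. \<forall>j\<le>n. 0 < p + disp s j \<and> p + disp s j < int L)"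
    let ?x = "pi * of_int p / L" and ?y = "pi / L"
    have "cos ?y ^ Suc n * sin ?x = cos ?y ^ n * ((sin (?x + ?y) + sin (?x - ?y)) / 2)"
      by (simp add: sin_add sin_diff)
    also have "?x + ?y = pi * of_int (p + 1) / L" by (simp add: field_simps add_divide_distrib)
    also have "?x - ?y = pi * of_int (p - 1) / L" by (simp add: field_simps diff_divide_distrib)
    also have "cos ?y ^ n * ((sin (pi * of_int (p + 1) / L) + sin (pi * of_int (p - 1) / L)) / 2)
        \<le> (?P (p + 1) + ?P (p - 1)) / 2"
    proof -
      have "cos ?y ^ n * sin (pi * of_int (p + 1) / L) \<le> ?P (p + 1)"
        "cos ?y ^ n * sin (pi * of_int (p - 1) / L) \<le> ?P (p - 1)"
        using Suc.IH[of "p + 1"] Suc.IH[of "p - 1"] Suc.prems False by auto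
      then show ?thesis by (simp only: distrib_left times_divide_eq_right, intro divide_right_mono add_mono) simp_all
    qed
    also have "\<dots> = \<P>(s in steps_law. \<forall>j\<le>Suc n. 0 < p + disp s j \<and> p + disp s j < int L)"
    proof (rule prob_first_step[symmetric])
      show "(\<forall>j\<le>Suc n. 0 < p + disp s j \<and> p + disp s j < int L) \<longleftrightarrow>
          (\<forall>j\<le>n. 0 < p + 1 + disp (\<lambda>k. s (1 + k)) j \<and> p + 1 + disp (\<lambda>k. s (1 + k)) j < int L)"
        if "s 0 = 1" for s
        unfolding all_le_Suc disp_Suc_shift that using False Suc.prems by (simp add: add.assoc)
      show "(\<forall>j\<le>Suc n. 0 < p + disp s j \<and> p + disp s j < int L) \<longleftrightarrow>
          (\<forall>j\<le>n. 0 < p - 1 + disp (\<lambda>k. s (1 + k)) j \<and> p - 1 + disp (\<lambda>k. s (1 + k)) j < int L)"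
        if "s 0 = - 1" for s
        unfolding all_le_Suc disp_Suc_shift that using False Suc.prems by (simp add: diff_add_eq add_diff_eq)
    qed (rule pred_all_disp)+
    finally show ?thesis .
  qed
qed

lemma distr_wait: "distr waits_law exp_law (\<lambda>a. a k) = exp_law"
proof -
  interpret e: prob_space exp_law by (rule prob_space_exp_law)
  interpret product_prob_space "\<lambda>_::nat. exp_law" UNIV by unfold_locales
  show ?thesis unfolding waits_law_def by (rule PiM_component) simp
qed

lemma distributed_wait: "distributed waits_law lborel (\<lambda>a. a k) (exponential_density 1)"
proof -
  have "distr waits_law lborel (\<lambda>a. a k) = distr waits_law exp_law (\<lambda>a. a k)"
    by (rule distr_cong) (simp_all add: sets_exp_law)
  then show ?thesis
    unfolding distributed_def distr_wait by (simp add: exp_law_def)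
qed

lemma indep_waits: "waits.indep_vars (\<lambda>_. borel) (\<lambda>k a. a k) UNIV"
proof -
  have "waits.indep_vars (\<lambda>_. exp_law) (\<lambda>k a. a k) UNIV"
  proof (subst waits.indep_vars_iff_distr_eq_PiM')
    show "distr waits_law (\<Pi>\<^sub>M i\<in>UNIV. exp_law) (\<lambda>x. \<lambda>i\<in>UNIV. x i) = (\<Pi>\<^sub>M i\<in>UNIV. distr waits_law exp_law (\<lambda>a. a i))"
    proof -
      have "(\<lambda>x. \<lambda>i\<in>UNIV. x i) = (\<lambda>x. x :: nat \<Rightarrow> real)" by (auto simp: restrict_def)
      then show ?thesis unfolding distr_wait unfolding waits_law_def by (simp add: distr_id2)
    qed
  qed auto
  then show ?thesis
    by (rule waits.indep_vars_compose2[where Y="\<lambda>_ x. x"])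
      (auto intro!: measurable_ident_sets simp: sets_exp_law)
qed

lemma distributed_arrival:
  "distributed waits_law lborel (\<lambda>a. arrival a (Suc n)) (erlang_density n 1)"
  using waits.exponential_distributed_sum[of "{..<Suc n}" 1 "\<lambda>k a. a k"]
    distributed_wait waits.indep_vars_subset[OF indep_waits, of "{..<Suc n}"]
  unfolding arrival_def by (auto simp: lessThan_empty_iff)

lemma AE_waits_pos: "AE a in waits_law. \<forall>k. 0 < a k"
  unfolding AE_all_countable
proof
  fix k
  have "AE x in lborel. 0 < exponential_density 1 x \<longrightarrow> 0 < x"
    using AE_lborel_singleton[of 0] by eventually_elim (auto simp: exponential_density_def)
  then show "AE a in waits_law. 0 < a k"
    by (subst waits.distributed_AE2[OF distributed_wait]) (auto simp: ennreal_less_zero_iff)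
qed

lemma prob_arrival_eq_0: "\<P>(a in waits_law. arrival a (Suc n) = t) = 0"
proof -
  have "AE x in lborel. 0 < erlang_density n 1 x \<longrightarrow> x \<noteq> t"
    using AE_lborel_singleton[of t] by eventually_elim auto
  then have "AE a in waits_law. arrival a (Suc n) \<noteq> t"
    by (subst waits.distributed_AE2[OF distributed_arrival]) (auto simp: ennreal_less_zero_iff)
  moreover have "{a \<in> space waits_law. arrival a (Suc n) = t} \<in> sets waits_law" by measurable
  ultimately show ?thesis by (subst waits.prob_eq_0) auto
qed

text \<open>
  Chebyshev's inequality; the \<open>n\<close>-th arrival time has mean and variance \<open>n\<close>.
\<close>

lemma prob_arrival_deviation:
  assumes "0 < n" "0 < c"
  shows "\<P>(a in waits_law. c \<le> \<bar>arrival a n - real n\<bar>) \<le> real n / c\<^sup>2"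
proof -
  obtain m where n: "n = Suc m" using assms by (cases n) auto
  note D = distributed_arrival[of m, folded n]
  have mean: "waits.expectation (\<lambda>a. arrival a n) = real n"
    using waits.erlang_ith_moment[OF _ D, of 1] by (simp add: n)
  have var: "waits.variance (\<lambda>a. arrival a n) = real n"
    using waits.erlang_distributed_variance[OF _ D] by (simp add: n add.commute)
  have int: "integrable waits_law (\<lambda>a. (arrival a n)\<^sup>2)"
    using waits.erlang_ith_moment_integrable[OF _ D, of 2] by simp
  show ?thesis
    using waits.Chebyshev_inequality[OF measurable_arrival int \<open>0 < c\<close>] unfolding var unfolding mean .
qed

lemma prob_arrival_le_half:
  assumes "0 < n"
  shows "\<P>(a in waits_law. arrival a n \<le> real n / 2) \<le> 4 / real n"
proof -
  have "\<P>(a in waits_law. arrival a n \<le> real n / 2) \<le> \<P>(a in waits_law. real n / 2 \<le> \<bar>arrival a n - real n\<bar>)"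
  proof (rule waits.finite_measure_mono)
    show "{a \<in> space waits_law. real n / 2 \<le> \<bar>arrival a n - real n\<bar>} \<in> sets waits_law" by measurable
  qed (auto simp: abs_if)
  also have "\<dots> \<le> real n / (real n / 2)\<^sup>2" using assms by (intro prob_arrival_deviation) auto
  also have "\<dots> = 4 / real n" using assms by (simp add: field_simps power2_eq_square)
  finally show ?thesis .
qed

lemma prob_arrival_ge_double:
  assumes "0 < n"
  shows "\<P>(a in waits_law. 2 * real n \<le> arrival a n) \<le> 1 / real n"
proof -
  have "\<P>(a in waits_law. 2 * real n \<le> arrival a n) \<le> \<P>(a in waits_law. real n \<le> \<bar>arrival a n - real n\<bar>)"
  proof (rule waits.finite_measure_mono)
    show "{a \<in> space waits_law. real n \<le> \<bar>arrival a n - real n\<bar>} \<in> sets waits_law" by measurable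
  qed (auto simp: abs_if)
  also have "\<dots> \<le> real n / (real n)\<^sup>2" using assms by (intro prob_arrival_deviation) auto
  also have "\<dots> = 1 / real n" using assms by (simp add: field_simps power2_eq_square)
  finally show ?thesis .
qed

lemma AE_arrival_unbounded: "AE a in waits_law. \<forall>t. \<exists>n. t < arrival a n"
proof -
  have "AE a in waits_law. \<exists>n. real m < arrival a n" for m :: nat
  proof -
    have "\<P>(a in waits_law. \<forall>n. arrival a n \<le> real m) \<le> 0"
    proof (rule field_le_epsilon)
      fix e :: real assume e: "0 < e"
      obtain n :: nat where n: "real n > max (4 / e) (2 * real m)" using reals_Archimedean2 by blast
      then have n0: "0 < n" using e by (cases n) (auto simp: max_def split: if_splits)
      have "\<P>(a in waits_law. \<forall>n. arrival a n \<le> real m) \<le> \<P>(a in waits_law. arrival a n \<le> real n / 2)"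
      proof (rule waits.finite_measure_mono)
        have "real m \<le> real n / 2" using n by simp
        then show "{a \<in> space waits_law. \<forall>n. arrival a n \<le> real m} \<subseteq> {a \<in> space waits_law. arrival a n \<le> real n / 2}"
          by (blast intro: order_trans)
        show "{a \<in> space waits_law. arrival a n \<le> real n / 2} \<in> sets waits_law" by measurable
      qed
      also have "\<dots> \<le> 4 / real n" by (rule prob_arrival_le_half[OF n0])
      also have "\<dots> \<le> e" using n e n0 by (simp add: field_simps)
      finally show "\<P>(a in waits_law. \<forall>n. arrival a n \<le> real m) \<le> 0 + e" by simp
    qed
    then have "\<P>(a in waits_law. \<forall>n. arrival a n \<le> real m) = 0" by (intro antisym measure_nonneg)
    moreover have "{a \<in> space waits_law. \<forall>n. arrival a n \<le> real m} \<in> sets waits_law" by measurable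
    ultimately show ?thesis by (subst (asm) waits.prob_eq_0) (auto simp: not_le)
  qed
  then have "AE a in waits_law. \<forall>m::nat. \<exists>n. real m < arrival a n" by (simp add: AE_all_countable)
  then show ?thesis
  proof eventually_elim
    case (elim a)
    show ?case
    proof
      fix t
      obtain m :: nat where "t < real m" using reals_Archimedean2 by blast
      moreover obtain n where "real m < arrival a n" using elim by blast
      ultimately show "\<exists>n. t < arrival a n" by (auto intro: less_trans)
    qed
  qed
qed

section \<open>The first visit of a walk to an edge\<close>

text \<open>
  The position of a walk relative to a distinguished edge: its two endpoints are the residues \<open>0\<close> and \<open>N - 1\<close>,
  and a walk whose starting vertex has the relative position \<open>p\<close> moves on the path \<open>0, ..., N - 1\<close> until it crosses
  the edge for the first time.
\<close>

definition site :: "nat \<Rightarrow> int \<Rightarrow> (nat \<Rightarrow> int) \<Rightarrow> nat \<Rightarrow> int" where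
  "site N p s n = (p + disp s n) mod int N"

definition at_edge :: "nat \<Rightarrow> int \<Rightarrow> (nat \<Rightarrow> int) \<Rightarrow> nat \<Rightarrow> bool" where
  "at_edge N p s n \<longleftrightarrow> site N p s n = 0 \<or> site N p s n = int N - 1"

definition first_hit :: "nat \<Rightarrow> int \<Rightarrow> (nat \<Rightarrow> int) \<Rightarrow> nat \<Rightarrow> bool" where
  "first_hit N p s n \<longleftrightarrow> at_edge N p s n \<and> (\<forall>j<n. \<not> at_edge N p s j)"

definition half_visited :: "nat \<Rightarrow> int \<Rightarrow> (nat \<Rightarrow> int) \<Rightarrow> (nat \<Rightarrow> bool) \<Rightarrow> bool" where
  "half_visited N p s J \<longleftrightarrow> (\<exists>j. J j \<and> site N p s j = 0) \<noteq> (\<exists>j. J j \<and> site N p s j = int N - 1)"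

definition edge_dist :: "nat \<Rightarrow> int \<Rightarrow> nat" where
  "edge_dist N p = nat (min p (int N - 1 - p))"

definition unit_steps :: "(nat \<Rightarrow> int) \<Rightarrow> bool" where
  "unit_steps s \<longleftrightarrow> (\<forall>k. s k = 1 \<or> s k = - 1)"

lemma AE_unit_steps: "AE s in steps_law. unit_steps s"
  using AE_steps by (simp add: unit_steps_def)

lemma measurable_site: "Measurable.pred steps_law (\<lambda>s. site N p s n = z)"
  unfolding site_def by (rule pred_disp)

lemma measurable_at_edge [measurable]: "Measurable.pred steps_law (\<lambda>s. at_edge N p s n)"
  unfolding at_edge_def site_def by (rule pred_disp)

lemma measurable_first_hit [measurable]: "Measurable.pred steps_law (\<lambda>s. first_hit N p s n)"
  unfolding first_hit_def by measurable

text \<open>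
  A walk with unit steps does not jump over integers.
\<close>

lemma disp_reaches:
  assumes "unit_steps s" "e = 1 \<or> e = - 1" "0 \<le> c" "c \<le> e * disp s n"
  shows "\<exists>j\<le>n. e * disp s j = c"
proof (rule nat0_intermed_int_val)
  show "\<forall>i<n. \<bar>e * disp s (i + 1) - e * disp s i\<bar> \<le> 1"
  proof safe
    fix i
    have "s i = 1 \<or> s i = - 1" using assms by (simp add: unit_steps_def)
    then show "\<bar>e * disp s (i + 1) - e * disp s i\<bar> \<le> 1"
      using assms(2) by (auto simp: disp_Suc)
  qed
qed (use assms in auto)

lemma at_edge_iff:
  assumes s: "unit_steps s" and p: "0 \<le> p" "p < int N"
  shows "(\<exists>j\<le>n. at_edge N p s j) \<longleftrightarrow>
    (\<exists>j\<le>n. 1 * disp s j = int N - 1 - p) \<or> (\<exists>j\<le>n. - 1 * disp s j = p)"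
proof
  assume "\<exists>j\<le>n. at_edge N p s j"
  then obtain j where j: "j \<le> n" "at_edge N p s j" by blast
  show "(\<exists>j\<le>n. 1 * disp s j = int N - 1 - p) \<or> (\<exists>j\<le>n. - 1 * disp s j = p)"
  proof (cases "int N - 1 - p \<le> disp s j \<or> p \<le> - disp s j")
    case True
    then show ?thesis
      using disp_reaches[OF s, of 1 "int N - 1 - p" j] disp_reaches[OF s, of "-1" p j] p j(1)
      by (auto intro: order_trans)
  next
    case False
    then have "site N p s j = p + disp s j" unfolding site_def by (intro mod_pos_pos_trivial) auto
    then show ?thesis using False j(2) by (auto simp: at_edge_def)
  qed
next
  assume "(\<exists>j\<le>n. 1 * disp s j = int N - 1 - p) \<or> (\<exists>j\<le>n. - 1 * disp s j = p)"
  then obtain j where "j \<le> n" "p + disp s j = int N - 1 \<or> p + disp s j = 0" by (auto simp: algebra_simps)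
  then show "\<exists>j\<le>n. at_edge N p s j" using p by (auto simp: at_edge_def site_def zmod_minus1 intro!: exI[of _ j])
qed

text \<open>
  As long as the walk is on the path \<open>0, ..., N - 1\<close>, it visits an endpoint by reaching displacement \<open>N - 1 - p\<close>
  or \<open>- p\<close>. One step further in the same direction is the other endpoint, so if only one endpoint is visited,
  the extreme displacement is attained and not exceeded.
\<close>

lemma half_visited_extreme:
  assumes s: "unit_steps s" and p: "0 \<le> p" "p < int N"
    and half: "half_visited N p s (\<lambda>j. j \<le> n)"
  shows "((\<forall>j\<le>n. 1 * disp s j \<le> int N - 1 - p) \<and> (\<exists>j\<le>n. 1 * disp s j = int N - 1 - p)) \<or>
    ((\<forall>j\<le>n. - 1 * disp s j \<le> p) \<and> (\<exists>j\<le>n. - 1 * disp s j = p))"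
proof -
  have "\<exists>j\<le>n. at_edge N p s j" using half by (auto simp: half_visited_def at_edge_def)
  then consider j where "j \<le> n" "1 * disp s j = int N - 1 - p" | j where "j \<le> n" "- 1 * disp s j = p"
    unfolding at_edge_iff[OF s p] by blast
  then show ?thesis
  proof cases
    case 1
    then have a: "site N p s j = int N - 1" using p by (simp add: site_def zmod_minus1)
    have "1 * disp s i \<le> int N - 1 - p" if i: "i \<le> n" for i
    proof (rule ccontr)
      assume "\<not> 1 * disp s i \<le> int N - 1 - p"
      then obtain i' where "i' \<le> i" "1 * disp s i' = int N - p"
        using disp_reaches[OF s, of 1 "int N - p" i] p by auto
      then have "i' \<le> n" "site N p s i' = 0" using i by (auto simp: site_def)
      then show False using half a 1 by (auto simp: half_visited_def)
    qed
    then show ?thesis using 1 by blast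
  next
    case 2
    then have a: "site N p s j = 0" using p by (auto simp: site_def)
    have "- 1 * disp s i \<le> p" if i: "i \<le> n" for i
    proof (rule ccontr)
      assume "\<not> - 1 * disp s i \<le> p"
      then obtain i' where "i' \<le> i" "- 1 * disp s i' = p + 1"
        using disp_reaches[OF s, of "-1" "p + 1" i] p by auto
      then have "i' \<le> n" "p + disp s i' = - 1" using i by auto
      moreover have "(- 1) mod int N = int N - 1" using p by (simp add: zmod_minus1)
      ultimately have "i' \<le> n" "site N p s i' = int N - 1" by (simp_all add: site_def)
      then show False using half a 2 by (auto simp: half_visited_def)
    qed
    then show ?thesis using 2 by blast
  qed
qed

lemma measurable_half_visited [measurable]:
  "Measurable.pred steps_law (\<lambda>s. half_visited N p s J)"
proof -
  note measurable_site[measurable]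
  show ?thesis unfolding half_visited_def by measurable
qed

lemma prob_half_visited_le_maxpmf:
  assumes p: "0 \<le> p" "p < int N"
  shows "\<P>(s in steps_law. half_visited N p s (\<lambda>j. j \<le> n)) \<le> maxpmf n (nat (int N - 1 - p)) + maxpmf n (nat p)"
proof -
  define A where "A e c = {s \<in> space steps_law. (\<forall>j\<le>n. e * disp s j \<le> c) \<and> (\<exists>j\<le>n. e * disp s j = c)}" for e c :: int
  have A [measurable]: "A e c \<in> sets steps_law" for e c
  proof -
    have [measurable]: "Measurable.pred steps_law (\<lambda>s. e * disp s j \<le> c)"
      "Measurable.pred steps_law (\<lambda>s. e * disp s j = c)" for j by (rule pred_disp)+
    show ?thesis unfolding A_def by measurable
  qed
  have "\<P>(s in steps_law. half_visited N p s (\<lambda>j. j \<le> n)) \<le> measure steps_law (A 1 (int N - 1 - p) \<union> A (- 1) p)"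
  proof (rule steps.finite_measure_mono_AE)
    show "AE s in steps_law. s \<in> {s \<in> space steps_law. half_visited N p s (\<lambda>j. j \<le> n)} \<longrightarrow>
        s \<in> A 1 (int N - 1 - p) \<union> A (- 1) p"
      using AE_unit_steps
    proof eventually_elim
      case (elim s)
      show ?case using half_visited_extreme[OF elim p, of n] unfolding A_def by auto
    qed
  qed measurable
  also have "\<dots> \<le> measure steps_law (A 1 (int N - 1 - p)) + measure steps_law (A (- 1) p)"
    by (rule measure_Un_le) measurable
  also have "measure steps_law (A 1 (int N - 1 - p)) = maxpmf n (nat (int N - 1 - p))"
    using prob_max_eq[of 1 n "nat (int N - 1 - p)"] p by (simp add: A_def)
  also have "measure steps_law (A (- 1) p) = maxpmf n (nat p)"
    using prob_max_eq[of "-1" n "nat p"] p by (simp add: A_def)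
  finally show ?thesis .
qed

lemma prob_half_visited_le:
  assumes p: "0 \<le> p" "p < int N"
  shows "\<P>(s in steps_law. half_visited N p s (\<lambda>j. j \<le> n)) \<le> 2 / (real (edge_dist N p) + 1)"
    and "\<P>(s in steps_law. half_visited N p s (\<lambda>j. j \<le> n)) \<le> 2 / sqrt (real n + 1)"
proof -
  have "maxpmf n (nat (int N - 1 - p)) \<le> maxpmf n (edge_dist N p)" "maxpmf n (nat p) \<le> maxpmf n (edge_dist N p)"
    using p by (auto intro!: maxpmf_antimono simp: edge_dist_def)
  then have "\<P>(s in steps_law. half_visited N p s (\<lambda>j. j \<le> n)) \<le> 2 * maxpmf n (edge_dist N p)"
    using prob_half_visited_le_maxpmf[OF p, of n] by linarith
  then show "\<P>(s in steps_law. half_visited N p s (\<lambda>j. j \<le> n)) \<le> 2 / (real (edge_dist N p) + 1)"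
      "\<P>(s in steps_law. half_visited N p s (\<lambda>j. j \<le> n)) \<le> 2 / sqrt (real n + 1)"
    using maxpmf_le_inverse[of n "edge_dist N p"] maxpmf_le[of n "edge_dist N p"] by linarith+
qed

lemma prob_hit_le:
  assumes p: "0 \<le> p" "p < int N" and k: "0 < edge_dist N p"
  shows "\<P>(s in steps_law. \<exists>j\<le>n. at_edge N p s j) \<le> 2 * real n / (real (edge_dist N p))\<^sup>2"
proof -
  let ?k = "edge_dist N p"
  define A where "A e = {s \<in> space steps_law. \<forall>j\<le>n. e * disp s j \<le> int ?k - 1}" for e :: int
  have A: "A e \<in> sets steps_law" for e
    using pred_all_disp[of n "\<lambda>_ d. e * d \<le> int ?k - 1"] unfolding A_def pred_def .
  have PA: "measure steps_law (space steps_law - A e) \<le> real n / (real ?k)\<^sup>2" if "e = 1 \<or> e = - 1" for e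
  proof -
    have "measure steps_law (space steps_law - A e) = 1 - maxcdf n (int ?k - 1)"
      using steps.prob_compl[OF A[of e]] prob_max_le[OF that, of n "int ?k - 1"] by (simp add: A_def)
    then show ?thesis using one_minus_maxcdf_le[OF k, of n] by simp
  qed
  have "\<P>(s in steps_law. \<exists>j\<le>n. at_edge N p s j)
      \<le> measure steps_law ((space steps_law - A 1) \<union> (space steps_law - A (- 1)))"
  proof (rule steps.finite_measure_mono_AE)
    show "AE s in steps_law. s \<in> {s \<in> space steps_law. \<exists>j\<le>n. at_edge N p s j} \<longrightarrow>
        s \<in> (space steps_law - A 1) \<union> (space steps_law - A (- 1))"
      using AE_unit_steps
    proof eventually_elim
      case (elim s)
      have "int ?k \<le> int N - 1 - p" "int ?k \<le> p" using p by (auto simp: edge_dist_def)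
      then show ?case using at_edge_iff[OF elim p, of n] unfolding A_def by force
    qed
    show "(space steps_law - A 1) \<union> (space steps_law - A (- 1)) \<in> sets steps_law"
      by (intro sets.Un sets.compl_sets A)
  qed
  also have "\<dots> \<le> measure steps_law (space steps_law - A 1) + measure steps_law (space steps_law - A (- 1))"
    by (intro measure_Un_le sets.compl_sets A)
  also have "\<dots> \<le> real n / (real ?k)\<^sup>2 + real n / (real ?k)\<^sup>2"
    by (intro add_mono PA) auto
  finally show ?thesis by simp
qed

text \<open>
  The walk reaches the edge unless its maximal displacement in the direction of the nearer endpoint is smaller than
  the distance; this event is a union of \<open>edge_dist N p\<close> values of the maximum.
\<close>

lemma prob_hit_ge:
  assumes p: "0 \<le> p" "p < int N"
  shows "1 - real (edge_dist N p) / sqrt (real n + 1) \<le> \<P>(s in steps_law. \<exists>j\<le>n. at_edge N p s j)"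
proof -
  let ?k = "edge_dist N p"
  have "\<exists>e :: int. (e = 1 \<or> e = - 1) \<and> ((e = 1 \<and> int ?k = int N - 1 - p) \<or> (e = - 1 \<and> int ?k = p))"
    using p by (cases "p \<le> int N - 1 - p") (auto simp: edge_dist_def)
  then obtain e :: int where e: "e = 1 \<or> e = - 1"
    and ek: "(e = 1 \<and> int ?k = int N - 1 - p) \<or> (e = - 1 \<and> int ?k = p)" by blast
  define A where "A = {s \<in> space steps_law. \<forall>j\<le>n. e * disp s j \<le> int ?k - 1}"
  have A: "A \<in> sets steps_law"
    using pred_all_disp[of n "\<lambda>_ d. e * d \<le> int ?k - 1"] unfolding A_def pred_def .
  have "maxcdf n (int ?k - 1) \<le> real ?k / sqrt (real n + 1)"
  proof (cases ?k)
    case (Suc j)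
    then show ?thesis using maxcdf_le[of n j] by (simp add: add.commute)
  qed simp
  then have "1 - real ?k / sqrt (real n + 1) \<le> measure steps_law (space steps_law - A)"
    using steps.prob_compl[OF A] prob_max_le[OF e, of n "int ?k - 1"] by (simp add: A_def)
  also have "\<dots> \<le> \<P>(s in steps_law. \<exists>j\<le>n. at_edge N p s j)"
  proof (rule steps.finite_measure_mono_AE)
    show "AE s in steps_law. s \<in> space steps_law - A \<longrightarrow> s \<in> {s \<in> space steps_law. \<exists>j\<le>n. at_edge N p s j}"
      using AE_unit_steps
    proof eventually_elim
      case (elim s)
      show ?case
      proof
        assume "s \<in> space steps_law - A"
        then obtain i where i: "i \<le> n" "int ?k \<le> e * disp s i" by (auto simp: A_def not_le)
        then obtain j where "j \<le> i" "e * disp s j = int ?k"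
          using disp_reaches[OF elim e, of "int ?k" i] by auto
        then show "s \<in> {s \<in> space steps_law. \<exists>j\<le>n. at_edge N p s j}"
          using at_edge_iff[OF elim p, of n] ek i(1) by (auto intro: order_trans)
      qed
    qed
  qed measurable
  finally show ?thesis .
qed

lemma first_hit_unique: "first_hit N p s m \<Longrightarrow> first_hit N p s n \<Longrightarrow> m = n"
  unfolding first_hit_def by (metis linorder_neqE_nat)

lemma ex_first_hit_iff: "(\<exists>j<n. first_hit N p s j) \<longleftrightarrow> (\<exists>j<n. at_edge N p s j)"
proof
  assume "\<exists>j<n. at_edge N p s j"
  then obtain j where j: "j < n" "at_edge N p s j" by blast
  let ?i = "LEAST i. at_edge N p s i"
  have "first_hit N p s ?i" using j by (auto simp: first_hit_def intro: LeastI dest: not_less_Least)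
  moreover have "?i \<le> j" using j(2) by (rule Least_le)
  ultimately show "\<exists>j<n. first_hit N p s j" using j by (auto intro!: exI[of _ ?i])
qed (auto simp: first_hit_def)

lemma sum_prob_first_hit:
  "(\<Sum>j<m. \<P>(s in steps_law. first_hit N p s j)) = \<P>(s in steps_law. \<exists>j<m. at_edge N p s j)"
proof -
  have "(\<Sum>j<m. \<P>(s in steps_law. first_hit N p s j))
      = measure steps_law (\<Union>j\<in>{..<m}. {s \<in> space steps_law. first_hit N p s j})"
  proof (rule steps.finite_measure_finite_Union[symmetric])
    have "{s \<in> space steps_law. first_hit N p s j} \<in> sets steps_law" for j by measurable
    then show "(\<lambda>j. {s \<in> space steps_law. first_hit N p s j}) ` {..<m} \<subseteq> sets steps_law" by blast
  qed (auto simp: disjoint_family_on_def dest: first_hit_unique)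
  also have "(\<Union>j\<in>{..<m}. {s \<in> space steps_law. first_hit N p s j}) = {s \<in> space steps_law. \<exists>j<m. at_edge N p s j}"
    using ex_first_hit_iff[of m N p] by auto
  finally show ?thesis .
qed

text \<open>
  Let \<open>\<nu>\<close> be the index of the first visit and \<open>k\<close> the distance to the edge. The part \<open>\<nu> \<ge> k\<^sup>2\<close> of the expectation of
  \<open>1 / sqrt (\<nu> + 1)\<close> is at most \<open>1 / k\<close>. On \<open>\<nu> < k\<^sup>2\<close>, the probability of \<open>\<nu> \<le> n\<close> is at most of order \<open>n / k\<^sup>2\<close>, so the
  law of \<open>\<nu>\<close> may be replaced by constant weights of order \<open>1 / k\<^sup>2\<close>.
\<close>

lemma sum_first_hit_inverse_sqrt_le:
  assumes p: "0 \<le> p" "p < int N"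
  shows "(\<Sum>j<m. \<P>(s in steps_law. first_hit N p s j) * (1 / sqrt (real j + 1))) \<le> 10 / (real (edge_dist N p) + 1)"
proof -
  define q where "q j = \<P>(s in steps_law. first_hit N p s j)" for j
  define c where "c j = 1 / sqrt (real j + 1)" for j :: nat
  let ?k = "edge_dist N p"
  have q0: "0 \<le> q j" for j by (simp add: q_def)
  have c: "c (Suc j) \<le> c j" "0 \<le> c j" for j by (auto simp: c_def intro!: divide_left_mono mult_pos_pos)
  have q1: "(\<Sum>j\<in>J. q j) \<le> 1" if J: "finite J" for J
  proof -
    obtain m where "J \<subseteq> {..<m}" using J finite_nat_iff_bounded by blast
    then have "(\<Sum>j\<in>J. q j) \<le> (\<Sum>j<m. q j)" by (intro sum_mono2) (auto simp: q0)
    also have "\<dots> \<le> 1" unfolding q_def sum_prob_first_hit by simp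
    finally show ?thesis .
  qed
  show ?thesis
  proof (cases "?k = 0")
    case True
    have "(\<Sum>j<m. q j * c j) \<le> (\<Sum>j<m. q j * 1)"
      by (intro sum_mono mult_left_mono) (auto simp: c_def q0)
    also have "\<dots> \<le> 1" using q1[of "{..<m}"] by simp
    finally show ?thesis using True by (simp add: q_def c_def)
  next
    case False
    \<comment> \<open>The index \<open>k\<^sup>2\<close> separates the two regimes.\<close>
    let ?K = "?k * ?k"
    have partial: "(\<Sum>j<n. q j) \<le> (2 / real ?K) * real n" for n
    proof (cases n)
      case (Suc n')
      have "(\<Sum>j<n. q j) \<le> 2 * real n' / (real ?k)\<^sup>2"
        unfolding q_def sum_prob_first_hit Suc using prob_hit_le[OF p, of n'] False by (simp add: less_Suc_eq_le)
      also have "\<dots> \<le> 2 * real n / (real ?k)\<^sup>2" using Suc by (intro divide_right_mono) auto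
      finally show ?thesis by (simp add: power2_eq_square)
    qed simp
    have "(\<Sum>j<?K. q j * c j) \<le> (2 / real ?K) * (\<Sum>j<?K. c j)"
      using partial c by (rule sum_mult_antimono_le)
    also have "\<dots> \<le> (2 / real ?K) * (2 * sqrt (real ?K))"
      unfolding c_def by (intro mult_left_mono sum_inverse_sqrt_le) simp
    finally have near: "(\<Sum>j<?K. q j * c j) \<le> (2 / real ?K) * (2 * sqrt (real ?K))" .
    have "(\<Sum>j\<in>{?K..<max m ?K}. q j * c j) \<le> (\<Sum>j\<in>{?K..<max m ?K}. q j * (1 / real ?k))"
    proof (intro sum_mono mult_left_mono q0)
      fix j assume "j \<in> {?K..<max m ?K}"
      then have "(real ?k)\<^sup>2 \<le> real j + 1" by (simp add: power2_eq_square flip: of_nat_mult)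
      then have "real ?k \<le> sqrt (real j + 1)" by (rule real_le_rsqrt)
      then show "c j \<le> 1 / real ?k" unfolding c_def using False by (intro divide_left_mono) auto
    qed
    also have "\<dots> \<le> 1 / real ?k"
      unfolding sum_distrib_right[symmetric] using q1[of "{?K..<max m ?K}"] False
      by (simp add: divide_right_mono)
    finally have far: "(\<Sum>j\<in>{?K..<max m ?K}. q j * c j) \<le> 1 / real ?k" .
    have "(\<Sum>j<m. q j * c j) \<le> (\<Sum>j\<in>{..<?K} \<union> {?K..<max m ?K}. q j * c j)"
      using q0 c(2) by (intro sum_mono2) (auto simp: not_less)
    also have "\<dots> = (\<Sum>j<?K. q j * c j) + (\<Sum>j\<in>{?K..<max m ?K}. q j * c j)"
      by (intro sum.union_disjoint) auto
    also have "\<dots> \<le> (2 / real ?K) * (2 * sqrt (real ?K)) + 1 / real ?k"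
      using near far by linarith
    also have "\<dots> = 5 / real ?k" using False by (simp add: real_sqrt_mult field_simps)
    also have "\<dots> \<le> 10 / (real ?k + 1)" using False by (simp add: field_simps)
    finally show ?thesis by (simp add: q_def c_def)
  qed
qed

section \<open>Being caught after the visit of one endpoint\<close>

lemma measurable_fst_driver [measurable]: "fst \<in> measurable driver_law waits_law"
  unfolding driver_law_def by measurable

lemma measurable_snd_driver [measurable]: "snd \<in> measurable driver_law steps_law"
  unfolding driver_law_def by measurable

text \<open>
  The null set where the description by jump indices could fail is removed once and for all. Unboundedness of the
  arrival times is stated for natural bounds in order to be visibly measurable.
\<close>

definition regular :: "driver \<Rightarrow> bool" where
  "regular \<omega> \<longleftrightarrow> (\<forall>k. 0 < fst \<omega> k) \<and> (\<forall>m::nat. \<exists>n. real m < arrival (fst \<omega>) n) \<and> unit_steps (snd \<omega>)"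

lemma measurable_regular [measurable]: "Measurable.pred driver_law regular"
  unfolding regular_def[abs_def] unit_steps_def by measurable

lemma AE_regular: "AE \<omega> in driver_law. regular \<omega>"
  unfolding driver_law_def
proof (rule waits_steps.AE_pair_measure)
  show "{\<omega> \<in> space (waits_law \<Otimes>\<^sub>M steps_law). regular \<omega>} \<in> sets (waits_law \<Otimes>\<^sub>M steps_law)"
    using measurable_regular unfolding pred_def driver_law_def .
  show "AE a in waits_law. AE s in steps_law. regular (a, s)"
    using AE_waits_pos AE_arrival_unbounded
  proof eventually_elim
    case (elim a)
    show ?case
      by (rule AE_mp[OF AE_unit_steps]) (use elim in \<open>auto simp: regular_def\<close>)
  qed
qed

lemma strict_mono_arrival: "(\<And>k. 0 < a k) \<Longrightarrow> strict_mono (arrival a)"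
  by (rule strict_monoI_Suc) (simp add: arrival_Suc)

lemma jump_index:
  assumes a: "\<And>k. 0 < a k" and m: "\<And>m::nat. \<exists>n. real m < arrival a n" and t: "0 \<le> t"
  obtains n where "\<And>j. arrival a j \<le> t \<longleftrightarrow> j \<le> n"
proof -
  have mono: "arrival a i \<le> arrival a j \<longleftrightarrow> i \<le> j" for i j
    using strict_mono_less_eq[OF strict_mono_arrival] a by blast
  obtain m :: nat where "t < real m" using reals_Archimedean2 by blast
  moreover obtain n0 where "real m < arrival a n0" using m by blast
  ultimately have n0: "t < arrival a n0" by linarith
  let ?n = "LEAST n. t < arrival a n"
  have less: "t < arrival a ?n" using n0 by (rule LeastI)
  moreover have "arrival a 0 \<le> t" using t by simp
  ultimately have "0 < ?n" by (cases ?n) auto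
  have "arrival a j \<le> t \<longleftrightarrow> j \<le> ?n - 1" for j
  proof
    assume "arrival a j \<le> t"
    then have "\<not> ?n \<le> j" using less mono[of ?n j] by auto
    then show "j \<le> ?n - 1" by simp
  next
    assume "j \<le> ?n - 1"
    then have "j < ?n" using \<open>0 < ?n\<close> by simp
    then show "arrival a j \<le> t" using not_less_Least[of j "\<lambda>n. t < arrival a n"] by (simp add: not_less)
  qed
  then show ?thesis by (rule that)
qed

lemma driver_nn_integral_mult:
  assumes [measurable]: "f \<in> borel_measurable waits_law" "g \<in> borel_measurable steps_law"
  shows "(\<integral>\<^sup>+ \<omega>. f (fst \<omega>) * g (snd \<omega>) \<partial>driver_law) = (\<integral>\<^sup>+ a. f a \<partial>waits_law) * (\<integral>\<^sup>+ s. g s \<partial>steps_law)"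
proof -
  have "(\<integral>\<^sup>+ \<omega>. f (fst \<omega>) * g (snd \<omega>) \<partial>driver_law) = (\<integral>\<^sup>+ a. \<integral>\<^sup>+ s. f a * g s \<partial>steps_law \<partial>waits_law)"
    unfolding driver_law_def by (subst steps.nn_integral_fst[symmetric]) auto
  also have "\<dots> = (\<integral>\<^sup>+ a. f a * (\<integral>\<^sup>+ s. g s \<partial>steps_law) \<partial>waits_law)"
    by (intro nn_integral_cong nn_integral_cmult) measurable
  also have "\<dots> = (\<integral>\<^sup>+ a. f a \<partial>waits_law) * (\<integral>\<^sup>+ s. g s \<partial>steps_law)"
    by (rule nn_integral_multc) measurable
  finally show ?thesis .
qed

abbreviation half_visited_at :: "nat \<Rightarrow> int \<Rightarrow> driver \<Rightarrow> real \<Rightarrow> bool" where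
  "half_visited_at N p \<omega> t \<equiv> half_visited N p (snd \<omega>) (\<lambda>j. arrival (fst \<omega>) j \<le> t)"

lemma measurable_half_visited_at:
  assumes [measurable]: "f \<in> measurable M driver_law" "t \<in> borel_measurable M"
  shows "Measurable.pred M (\<lambda>x. half_visited_at N p (f x) (t x))"
proof -
  note measurable_site [measurable]
  show ?thesis unfolding half_visited_def by measurable
qed

text \<open>
  For fixed waiting times, the number of jumps up to time \<open>t\<close> is a fixed number, and the bounds for the discrete
  walk apply. In the second bound this number is at least \<open>m\<close> unless the \<open>m\<close>-th arrival comes after \<open>t\<close>.
\<close>

lemma prob_half_visited_at_le:
  assumes p: "0 \<le> p" "p < int N" and t: "0 \<le> t"
  shows "\<P>(\<omega> in driver_law. half_visited_at N p \<omega> t) \<le> 2 / (real (edge_dist N p) + 1)" (is "?P \<le> ?A")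
    and "\<P>(\<omega> in driver_law. half_visited_at N p \<omega> t)
      \<le> 2 / sqrt (real m + 1) + \<P>(a in waits_law. t < arrival a m)" (is "?P \<le> ?B + ?C")
proof -
  let ?E = "{\<omega> \<in> space driver_law. half_visited_at N p \<omega> t}"
  have E: "?E \<in> sets (waits_law \<Otimes>\<^sub>M steps_law)"
    unfolding sets_driver_law[symmetric]
    by (rule measurable_half_visited_at[unfolded pred_def]) measurable
  have fubini: "emeasure driver_law ?E
      = (\<integral>\<^sup>+ a. emeasure steps_law {s. half_visited N p s (\<lambda>j. arrival a j \<le> t)} \<partial>waits_law)"
    using steps.emeasure_pair_measure_alt[OF E] by (simp add: driver_law_def[symmetric] vimage_def)
  have slice: "AE a in waits_law. \<exists>n. (\<forall>j. arrival a j \<le> t \<longleftrightarrow> j \<le> n)"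
    using AE_waits_pos AE_arrival_unbounded
  proof eventually_elim
    case (elim a)
    then show ?case using jump_index[of a t] t by metis
  qed
  have fixed: "emeasure steps_law {s. half_visited N p s (\<lambda>j. j \<le> n)} \<le> ennreal (2 / (real (edge_dist N p) + 1))"
      "emeasure steps_law {s. half_visited N p s (\<lambda>j. j \<le> n)} \<le> ennreal (2 / sqrt (real n + 1))" for n
    using prob_half_visited_le[OF p, of n] by (auto simp: steps.emeasure_eq_measure intro!: ennreal_leI)
  have "emeasure driver_law ?E \<le> (\<integral>\<^sup>+ a. ennreal ?A \<partial>waits_law)"
    unfolding fubini
  proof (rule nn_integral_mono_AE)
    show "AE a in waits_law. emeasure steps_law {s. half_visited N p s (\<lambda>j. arrival a j \<le> t)} \<le> ennreal ?A"
      using slice by eventually_elim (auto simp: fixed(1))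
  qed
  then show "?P \<le> ?A"
    using waits.emeasure_space_1 by (simp add: driver.emeasure_eq_measure)
  have "emeasure driver_law ?E
      \<le> (\<integral>\<^sup>+ a. ennreal ?B + indicator {a \<in> space waits_law. t < arrival a m} a \<partial>waits_law)"
    unfolding fubini
  proof (rule nn_integral_mono_AE)
    show "AE a in waits_law. emeasure steps_law {s. half_visited N p s (\<lambda>j. arrival a j \<le> t)}
        \<le> ennreal ?B + indicator {a \<in> space waits_law. t < arrival a m} a"
      using slice
    proof eventually_elim
      case (elim a)
      then obtain n where n: "\<And>j. arrival a j \<le> t \<longleftrightarrow> j \<le> n" by blast
      show ?case
      proof (cases "t < arrival a m")
        case True
        then show ?thesis
          using steps.prob_le_1 by (simp add: steps.emeasure_eq_measure add_increasing)
      next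
        case False
        then have "m \<le> n" using n[of m] by simp
        then have "2 / sqrt (real n + 1) \<le> ?B" by (intro divide_left_mono) auto
        then have "emeasure steps_law {s. half_visited N p s (\<lambda>j. j \<le> n)} \<le> ennreal ?B"
          using fixed(2)[of n] by (meson ennreal_leI order_trans)
        then show ?thesis using False by (simp add: n)
      qed
    qed
  qed
  also have "\<dots> = ennreal ?B + emeasure waits_law {a \<in> space waits_law. t < arrival a m}"
  proof -
    have "{a \<in> space waits_law. t < arrival a m} \<in> sets waits_law" by measurable
    then show ?thesis using waits.emeasure_space_1 by (simp add: nn_integral_add)
  qed
  also have "\<dots> = ennreal (?B + ?C)"
    by (simp add: waits.emeasure_eq_measure ennreal_plus)
  finally show "?P \<le> ?B + ?C"
    unfolding driver.emeasure_eq_measure by (subst (asm) ennreal_le_iff) auto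
qed

lemma prob_half_visited_at_le_inverse_sqrt:
  assumes p: "0 \<le> p" "p < int N" and t: "2 \<le> t"
  shows "\<P>(\<omega> in driver_law. half_visited_at N p \<omega> t) \<le> 8 / sqrt t"
proof -
  \<comment> \<open>About half of the expected number of jumps, so that fewer jumps are unlikely.\<close>
  define m where "m = nat \<lfloor>t / 2\<rfloor>"
  have m: "real m \<le> t / 2" "t / 2 < real m + 1" "1 \<le> real m"
  proof -
    have "1 \<le> \<lfloor>t / 2\<rfloor>" using t by (simp add: le_floor_iff)
    then show "real m \<le> t / 2" "t / 2 < real m + 1" "1 \<le> real m"
      unfolding m_def by linarith+
  qed
  have "\<P>(a in waits_law. t < arrival a m) \<le> \<P>(a in waits_law. 2 * real m \<le> arrival a m)"
  proof (rule waits.finite_measure_mono)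
    show "{a \<in> space waits_law. 2 * real m \<le> arrival a m} \<in> sets waits_law" by measurable
  qed (use m in auto)
  also have "\<dots> \<le> 1 / real m" using m by (intro prob_arrival_ge_double) auto
  also have "\<dots> \<le> 4 / t"
  proof -
    have "t \<le> 4 * real m" using m by linarith
    then have "4 / (4 * real m) \<le> 4 / t" using t by (intro divide_left_mono) auto
    then show ?thesis by simp
  qed
  also have "\<dots> \<le> 4 / sqrt t"
    using t real_le_lsqrt[of t t] by (intro divide_left_mono) (auto simp: power2_eq_square)
  finally have 1: "\<P>(a in waits_law. t < arrival a m) \<le> 4 / sqrt t" .
  have "sqrt t \<le> 2 * sqrt (real m + 1)"
    using m by (intro real_le_lsqrt) (auto simp: power_mult_distrib)
  then have 2: "2 / sqrt (real m + 1) \<le> 4 / sqrt t" using t m by (simp add: field_simps)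
  show ?thesis using prob_half_visited_at_le(2)[OF p, of t m] t 1 2 by simp
qed

text \<open>
  The bound \<open>8 / sqrt t\<close> is useless where it exceeds \<open>1\<close>, which is the case for \<open>t < 64\<close>.
\<close>

definition capped :: "real \<Rightarrow> real" where
  "capped t = (if t \<le> 64 then 1 else 8 / sqrt t)"

lemma measurable_capped [measurable]: "capped \<in> borel_measurable borel"
  unfolding capped_def[abs_def] by measurable

lemma capped_le: "0 < t \<Longrightarrow> capped t \<le> 8 / sqrt t" and capped_le_1: "capped t \<le> 1"
proof -
  show "capped t \<le> 8 / sqrt t" if "0 < t"
    using that real_sqrt_le_mono[of t 64] by (auto simp: capped_def field_simps)
  show "capped t \<le> 1"
    using real_sqrt_le_mono[of 64 t] by (auto simp: capped_def)
qed

lemma prob_half_visited_at_le_capped: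
  assumes p: "0 \<le> p" "p < int N"
  shows "\<P>(\<omega> in driver_law. half_visited_at N p \<omega> t) \<le> capped t"
  using prob_half_visited_at_le_inverse_sqrt[OF p, of t] by (auto simp: capped_def)

text \<open>
  The \<open>n\<close>-th arrival time exceeds \<open>n / 2\<close> up to probability \<open>4 / n\<close>, so it may be replaced by \<open>n\<close> at the cost of
  a constant factor.
\<close>

lemma nn_integral_capped_arrival:
  "(\<integral>\<^sup>+ a. ennreal (capped (arrival a n)) \<partial>waits_law) \<le> ennreal (22 / sqrt (real n + 1))"
proof (cases "n = 0")
  case True
  then show ?thesis using waits.emeasure_space_1 by (simp add: capped_def)
next
  case False
  then have n: "1 \<le> real n" by simp
  let ?c = "8 / sqrt (real n / 2)"
  have "(\<integral>\<^sup>+ a. ennreal (capped (arrival a n)) \<partial>waits_law)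
      \<le> (\<integral>\<^sup>+ a. ennreal ?c + indicator {a \<in> space waits_law. arrival a n \<le> real n / 2} a \<partial>waits_law)"
  proof (rule nn_integral_mono)
    fix a
    show "ennreal (capped (arrival a n)) \<le> ennreal ?c + indicator {a \<in> space waits_law. arrival a n \<le> real n / 2} a"
    proof (cases "arrival a n \<le> real n / 2")
      case True
      then show ?thesis using capped_le_1[of "arrival a n"] by (simp add: add_increasing)
    next
      case False
      have "capped (arrival a n) \<le> 8 / sqrt (arrival a n)" using False n by (intro capped_le) linarith
      also have "\<dots> \<le> ?c" using False n by (intro divide_left_mono mult_pos_pos) auto
      finally show ?thesis using False by (simp add: ennreal_leI)
    qed
  qed
  also have "\<dots> = ennreal ?c + emeasure waits_law {a \<in> space waits_law. arrival a n \<le> real n / 2}"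
  proof -
    have "{a \<in> space waits_law. arrival a n \<le> real n / 2} \<in> sets waits_law" by measurable
    then show ?thesis using waits.emeasure_space_1 by (simp add: nn_integral_add)
  qed
  also have "\<dots> = ennreal (?c + \<P>(a in waits_law. arrival a n \<le> real n / 2))"
    by (simp add: waits.emeasure_eq_measure ennreal_plus)
  also have "\<dots> \<le> ennreal (22 / sqrt (real n + 1))"
  proof (rule ennreal_leI)
    have "\<P>(a in waits_law. arrival a n \<le> real n / 2) \<le> 4 / real n"
      using False by (intro prob_arrival_le_half) auto
    also have "\<dots> \<le> 4 / sqrt (real n)"
      using n real_le_lsqrt[of "real n" "real n"] by (intro divide_left_mono) (auto simp: power2_eq_square)
    finally have "?c + \<P>(a in waits_law. arrival a n \<le> real n / 2) \<le> (8 * sqrt 2 + 4) / sqrt (real n)"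
      by (simp add: real_sqrt_divide add_divide_distrib)
    also have "\<dots> \<le> 22 / sqrt (real n + 1)"
    proof -
      have "sqrt (real n + 1) \<le> sqrt (2 * real n)" using n by simp
      also have "\<dots> = sqrt 2 * sqrt (real n)" by (rule real_sqrt_mult)
      finally have "(8 * sqrt 2 + 4) * sqrt (real n + 1) \<le> (8 * sqrt 2 + 4) * (sqrt 2 * sqrt (real n))"
        by (intro mult_left_mono) auto
      also have "\<dots> = (16 + 4 * sqrt 2) * sqrt (real n)" by (simp add: algebra_simps)
      also have "\<dots> \<le> 22 * sqrt (real n)"
        using real_le_lsqrt[of "3 / 2" 2] by (intro mult_right_mono) (auto simp: power2_eq_square)
      finally show ?thesis using n by (simp add: field_simps)
    qed
    finally show "?c + \<P>(a in waits_law. arrival a n \<le> real n / 2) \<le> 22 / sqrt (real n + 1)" .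
  qed
  finally show ?thesis .
qed

text \<open>
  If the edge is split, this event or the one with exchanged walks occurs (\<open>splits_imp_caught\<close>). For fixed \<open>\<eta>\<close> it
  concerns the other walk at a single deterministic time.
\<close>

definition caught :: "nat \<Rightarrow> int \<Rightarrow> int \<Rightarrow> driver \<Rightarrow> driver \<Rightarrow> bool" where
  "caught N p q \<omega> \<eta> \<longleftrightarrow> (\<exists>n. first_hit N q (snd \<eta>) n \<and> half_visited_at N p \<omega> (arrival (fst \<eta>) n))"

lemma measurable_caught:
  assumes [measurable]: "f \<in> measurable M driver_law" "g \<in> measurable M driver_law"
  shows "Measurable.pred M (\<lambda>x. caught N p q (f x) (g x))"
proof -
  have [measurable]: "Measurable.pred M (\<lambda>x. half_visited_at N p (f x) (arrival (fst (g x)) n))" for n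
    by (rule measurable_half_visited_at) measurable
  show ?thesis unfolding caught_def by measurable
qed

text \<open>
  For fixed \<open>\<eta>\<close> the time of the first visit is a constant, at which the bounds for \<open>half_visited_at\<close> hold. The first
  bound is uniform in time. The second one averages the bound by \<open>capped\<close> over \<open>\<eta>\<close>, first over the waiting
  times and then over the index of the first visit.
\<close>

lemma prob_caught_le:
  assumes p: "0 \<le> p" "p < int N" and q: "0 \<le> q" "q < int N"
  shows "pair_prob (caught N p q) \<le> 2 / (real (edge_dist N p) + 1)"
      (is "?P \<le> ?A")
    and "pair_prob (caught N p q) \<le> 220 / (real (edge_dist N q) + 1)"
      (is "?P \<le> ?B")
proof -
  let ?E = "{x \<in> space (pair_law). caught N p q (fst x) (snd x)}"
  have "?E \<in> sets (pair_law)"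
    by (rule measurable_caught[unfolded pred_def]) measurable
  then have fubini: "emeasure (pair_law) ?E
      = (\<integral>\<^sup>+ \<eta>. emeasure driver_law {\<omega>. caught N p q \<omega> \<eta>} \<partial>driver_law)"
    by (subst two_drivers.emeasure_pair_measure_alt2) (auto simp: vimage_def space_pair_measure)
  have fixed: "emeasure driver_law {\<omega>. caught N p q \<omega> \<eta>}
        = ennreal (\<P>(\<omega> in driver_law. half_visited_at N p \<omega> (arrival (fst \<eta>) n)))"
    if "first_hit N q (snd \<eta>) n" for \<eta> n
  proof -
    have "{\<omega>. caught N p q \<omega> \<eta>} = {\<omega> \<in> space driver_law. half_visited_at N p \<omega> (arrival (fst \<eta>) n)}"
      using that by (auto simp: caught_def dest: first_hit_unique[OF that])
    then show ?thesis by (simp add: driver.emeasure_eq_measure)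
  qed
  have none: "emeasure driver_law {\<omega>. caught N p q \<omega> \<eta>} = 0" if "\<not> (\<exists>n. first_hit N q (snd \<eta>) n)" for \<eta>
    using that by (simp add: caught_def)
  have "emeasure (pair_law) ?E \<le> (\<integral>\<^sup>+ \<eta>. ennreal ?A \<partial>driver_law)"
    unfolding fubini
  proof (rule nn_integral_mono_AE)
    show "AE \<eta> in driver_law. emeasure driver_law {\<omega>. caught N p q \<omega> \<eta>} \<le> ennreal ?A"
      using AE_regular
    proof eventually_elim
      case (elim \<eta>)
      have "0 \<le> arrival (fst \<eta>) n" for n
        using elim by (auto simp: regular_def arrival_def intro!: sum_nonneg intro: less_imp_le)
      then show ?case
        using fixed[of \<eta>] none[of \<eta>] prob_half_visited_at_le(1)[OF p]
        by (cases "\<exists>n. first_hit N q (snd \<eta>) n") (auto intro!: ennreal_leI)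
    qed
  qed
  then show "?P \<le> ?A"
    using driver.emeasure_space_1 by (simp add: two_drivers.P.emeasure_eq_measure)
  let ?f = "\<lambda>n \<eta>. ennreal (capped (arrival (fst \<eta>) n)) * indicator {s \<in> space steps_law. first_hit N q s n} (snd \<eta>)"
  have fh: "{s \<in> space steps_law. first_hit N q s n} \<in> sets steps_law" for n by measurable
  have "emeasure (pair_law) ?E \<le> (\<integral>\<^sup>+ \<eta>. (\<Sum>n. ?f n \<eta>) \<partial>driver_law)"
    unfolding fubini
  proof (rule nn_integral_mono)
    fix \<eta>
    show "emeasure driver_law {\<omega>. caught N p q \<omega> \<eta>} \<le> (\<Sum>n. ?f n \<eta>)"
    proof (cases "\<exists>n. first_hit N q (snd \<eta>) n")
      case True
      then obtain n where n: "first_hit N q (snd \<eta>) n" by blast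
      have "emeasure driver_law {\<omega>. caught N p q \<omega> \<eta>} \<le> ennreal (capped (arrival (fst \<eta>) n))"
        unfolding fixed[OF n] by (intro ennreal_leI prob_half_visited_at_le_capped p)
      also have "\<dots> = ?f n \<eta>" using n by simp
      also have "?f n \<eta> \<le> (\<Sum>n. ?f n \<eta>)"
      proof -
        have "(\<Sum>i\<in>{n}. ?f i \<eta>) \<le> (\<Sum>n. ?f n \<eta>)" by (rule sum_le_suminf) auto
        then show ?thesis
          by (simp only: sum.insert finite.emptyI sum.empty empty_iff not_False_eq_True add_0_right)
      qed
      finally show ?thesis .
    qed (simp add: none)
  qed
  also have "\<dots> = (\<Sum>n. \<integral>\<^sup>+ \<eta>. ?f n \<eta> \<partial>driver_law)"
    using fh by (intro nn_integral_suminf) measurable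
  also have "\<dots> = (\<Sum>n. (\<integral>\<^sup>+ a. ennreal (capped (arrival a n)) \<partial>waits_law) * ennreal (\<P>(s in steps_law. first_hit N q s n)))"
    using fh by (subst driver_nn_integral_mult) (auto simp: steps.emeasure_eq_measure)
  also have "\<dots> \<le> ennreal ?B"
  proof (rule suminf_le_const[OF summableI])
    fix m
    have "(\<Sum>n<m. (\<integral>\<^sup>+ a. ennreal (capped (arrival a n)) \<partial>waits_law) * ennreal (\<P>(s in steps_law. first_hit N q s n)))
        \<le> (\<Sum>n<m. ennreal (22 / sqrt (real n + 1)) * ennreal (\<P>(s in steps_law. first_hit N q s n)))"
      by (intro sum_mono mult_right_mono nn_integral_capped_arrival) auto
    also have "\<dots> = ennreal (22 * (\<Sum>n<m. \<P>(s in steps_law. first_hit N q s n) * (1 / sqrt (real n + 1))))"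
      by (simp add: sum_distrib_left ennreal_mult[symmetric] mult.commute)
    also have "\<dots> \<le> ennreal ?B"
      using sum_first_hit_inverse_sqrt_le[OF q, of m] by (intro ennreal_leI) simp
    finally show "(\<Sum>n<m. (\<integral>\<^sup>+ a. ennreal (capped (arrival a n)) \<partial>waits_law) * ennreal (\<P>(s in steps_law. first_hit N q s n)))
        \<le> ennreal ?B" .
  qed
  finally show "?P \<le> ?B"
    by (simp add: two_drivers.P.emeasure_eq_measure)
qed

section \<open>Measurability of the interface\<close>

lemma measurable_jump_time [measurable]: "(\<lambda>w. jump_time w n) \<in> borel_measurable walk_law"
proof -
  have [measurable]: "(\<lambda>w. fst (w k)) \<in> borel_measurable walk_law" for k
  proof -
    have "(\<lambda>w. w k) \<in> measurable walk_law (exp_law \<Otimes>\<^sub>M coin_law)"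
      unfolding walk_law_def jump_law_eq by (rule measurable_component_singleton) simp
    moreover have "fst \<in> borel_measurable (exp_law \<Otimes>\<^sub>M coin_law)" by measurable
    ultimately show ?thesis by (rule measurable_compose)
  qed
  show ?thesis unfolding jump_time_def by measurable
qed

lemma measurable_num_jumps [measurable]: "(\<lambda>w. num_jumps w t) \<in> measurable walk_law (count_space UNIV)"
  unfolding num_jumps_def by measurable

lemma measurable_walk [measurable]: "(\<lambda>w. walk N x w t) \<in> measurable walk_law (count_space UNIV)"
proof -
  have step: "(\<lambda>w. snd (w k)) \<in> measurable walk_law (count_space UNIV)" for k
  proof -
    have "(\<lambda>w. w k) \<in> measurable walk_law (exp_law \<Otimes>\<^sub>M coin_law)"
      unfolding walk_law_def jump_law_eq by (rule measurable_component_singleton) simp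
    moreover have "snd \<in> measurable (exp_law \<Otimes>\<^sub>M coin_law) (count_space UNIV)" by measurable
    ultimately show ?thesis by (rule measurable_compose)
  qed
  have sum: "(\<lambda>w. \<Sum>k<n. snd (w k)) \<in> measurable walk_law (count_space UNIV)" for n
  proof (induction n)
    case (Suc n)
    have "(\<lambda>w. (\<lambda>i w. i + snd (w n)) (\<Sum>k<n. snd (w k)) w) \<in> measurable walk_law (count_space UNIV)"
      by (rule measurable_compose_countable[OF _ Suc]) (rule measurable_compose[OF step], simp)
    then show ?case by simp
  qed simp
  have "(\<lambda>w. (\<lambda>n w. (x + (\<Sum>k<n. snd (w k))) mod int N) (num_jumps w t) w) \<in> measurable walk_law (count_space UNIV)"
    by (rule measurable_compose_countable[OF _ measurable_num_jumps]) (rule measurable_compose[OF sum], simp)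
  then show ?thesis by (simp add: walk_def)
qed

text \<open>
  Every trajectory has this property, also those on the null set where the jump times fail to increase or are bounded.
  So the quantifiers over real times in \<open>claims\<close> can be restricted to rational times for every outcome, which
  gives measurability without completing the measure.
\<close>

definition right_constant :: "(real \<Rightarrow> 'v) \<Rightarrow> bool" where
  "right_constant X \<longleftrightarrow> (\<forall>t. \<exists>u>t. \<forall>s\<in>{t..<u}. X s = X t)"

text \<open>
  If no jump time exceeds \<open>t\<close>, then \<open>num_jumps\<close> takes its default value at \<open>t\<close> and at all later times.
\<close>

lemma right_constant_num_jumps: "right_constant (num_jumps w)"
  unfolding right_constant_def
proof
  fix t
  show "\<exists>u>t. \<forall>s\<in>{t..<u}. num_jumps w s = num_jumps w t"
  proof (cases "\<exists>n. t < jump_time w (Suc n)")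
    case True
    let ?n = "num_jumps w t"
    have n: "t < jump_time w (Suc ?n)" unfolding num_jumps_def using True by (rule LeastI_ex)
    have "num_jumps w s = ?n" if s: "s \<in> {t..<jump_time w (Suc ?n)}" for s
      unfolding num_jumps_def[of w s]
    proof (rule Least_equality)
      fix m assume "s < jump_time w (Suc m)"
      then have "t < jump_time w (Suc m)" using s by auto
      then show "?n \<le> m" unfolding num_jumps_def by (rule Least_le)
    qed (use s in auto)
    then show ?thesis using n by blast
  next
    case False
    then have "num_jumps w s = num_jumps w t" if "t \<le> s" for s
      unfolding num_jumps_def using that by (metis less_le_trans not_le order_trans)
    then have "\<forall>s\<in>{t..<t + 1}. num_jumps w s = num_jumps w t" by (meson atLeastLessThan_iff)
    moreover have "t < t + 1" by simp
    ultimately show ?thesis by blast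
  qed
qed

lemma right_constant_walk: "right_constant (walk N x w)"
  unfolding right_constant_def
proof
  fix t
  obtain u where u: "t < u" "\<forall>s\<in>{t..<u}. num_jumps w s = num_jumps w t"
    using right_constant_num_jumps[of w] unfolding right_constant_def by blast
  have "walk N x w s = walk N x w t" if "s \<in> {t..<u}" for s
    unfolding walk_def bspec[OF u(2) that] ..
  then show "\<exists>u>t. \<forall>s\<in>{t..<u}. walk N x w s = walk N x w t" using u(1) by blast
qed

lemma claims_iff_rational:
  assumes X: "right_constant X" and Y: "right_constant Y"
  shows "claims X Y v \<longleftrightarrow> (\<exists>q::rat. 0 \<le> real_of_rat q \<and> X (real_of_rat q) = v \<and>
    (\<forall>r::rat. 0 \<le> real_of_rat r \<and> real_of_rat r \<le> real_of_rat q \<longrightarrow> Y (real_of_rat r) \<noteq> v))"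
proof
  assume "claims X Y v"
  then obtain t where t: "0 \<le> t" "X t = v" "\<And>s. s \<in> {0..t} \<Longrightarrow> Y s \<noteq> v"
    unfolding claims_def by blast
  obtain u where u: "t < u" "\<And>s. s \<in> {t..<u} \<Longrightarrow> X s = X t"
    using X unfolding right_constant_def by blast
  obtain u' where u': "t < u'" "\<And>s. s \<in> {t..<u'} \<Longrightarrow> Y s = Y t"
    using Y unfolding right_constant_def by blast
  have "t < min u u'" using u(1) u'(1) by simp
  then obtain q where q: "t < real_of_rat q" "real_of_rat q < min u u'"
    using of_rat_dense by blast
  have "Y (real_of_rat r) \<noteq> v" if r: "0 \<le> real_of_rat r" "real_of_rat r \<le> real_of_rat q" for r
  proof (cases "real_of_rat r \<le> t")
    case True
    then show ?thesis using t(3) r by simp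
  next
    case False
    then have "Y (real_of_rat r) = Y t" using r q by (intro u'(2)) auto
    then show ?thesis using t(3)[of t] t(1) by simp
  qed
  moreover have "X (real_of_rat q) = v" using u(2)[of "real_of_rat q"] q t(2) by auto
  moreover have "0 \<le> real_of_rat q" using q t(1) by linarith
  ultimately show "\<exists>q::rat. 0 \<le> real_of_rat q \<and> X (real_of_rat q) = v \<and>
    (\<forall>r::rat. 0 \<le> real_of_rat r \<and> real_of_rat r \<le> real_of_rat q \<longrightarrow> Y (real_of_rat r) \<noteq> v)"
    by blast
next
  assume "\<exists>q::rat. 0 \<le> real_of_rat q \<and> X (real_of_rat q) = v \<and>
    (\<forall>r::rat. 0 \<le> real_of_rat r \<and> real_of_rat r \<le> real_of_rat q \<longrightarrow> Y (real_of_rat r) \<noteq> v)"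
  then obtain q where q: "0 \<le> real_of_rat q" "X (real_of_rat q) = v"
    "\<And>r. 0 \<le> real_of_rat r \<Longrightarrow> real_of_rat r \<le> real_of_rat q \<Longrightarrow> Y (real_of_rat r) \<noteq> v"
    by blast
  have "Y s \<noteq> v" if s: "s \<in> {0..real_of_rat q}" for s
  proof (cases "s = real_of_rat q")
    case False
    obtain u where u: "s < u" "\<And>s'. s' \<in> {s..<u} \<Longrightarrow> Y s' = Y s"
      using Y unfolding right_constant_def by blast
    have "s < min u (real_of_rat q)" using u(1) s False by auto
    then obtain r where r: "s < real_of_rat r" "real_of_rat r < min u (real_of_rat q)"
      using of_rat_dense by blast
    then have "Y (real_of_rat r) = Y s" by (intro u(2)) auto
    moreover have "0 \<le> s" using s by simp
    then have "Y (real_of_rat r) \<noteq> v" by (intro q(3)) (use r in linarith)+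
    ultimately show ?thesis by simp
  qed (use q in auto)
  then show "claims X Y v" unfolding claims_def using q by blast
qed

lemma measurable_claims:
  assumes [measurable]: "f \<in> measurable M walk_law" "g \<in> measurable M walk_law"
  shows "Measurable.pred M (\<lambda>\<omega>. claims (walk N x (f \<omega>)) (walk N y (g \<omega>)) v)"
  unfolding claims_iff_rational[OF right_constant_walk right_constant_walk]
proof -
  have [measurable]: "Measurable.pred M (\<lambda>\<omega>. walk N x (f \<omega>) t = v)" "Measurable.pred M (\<lambda>\<omega>. walk N y (g \<omega>) t \<noteq> v)" for t
    by (rule measurable_compose[OF measurable_compose[OF assms(1) measurable_walk]], simp)
       (rule measurable_compose[OF measurable_compose[OF assms(2) measurable_walk]], simp)
  show "Measurable.pred M (\<lambda>\<omega>. \<exists>q. 0 \<le> real_of_rat q \<and> walk N x (f \<omega>) (real_of_rat q) = v \<and>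
      (\<forall>r. 0 \<le> real_of_rat r \<and> real_of_rat r \<le> real_of_rat q \<longrightarrow> walk N y (g \<omega>) (real_of_rat r) \<noteq> v))"
    by measurable
qed

definition cycle_edge :: "nat \<Rightarrow> int \<Rightarrow> int set" where
  "cycle_edge N i = {(i - 1) mod int N, i}"

lemma cycle_edges_eq: "cycle_edges N = cycle_edge N ` cycle_verts N"
  by (auto simp: cycle_edges_def cycle_edge_def)

lemma finite_cycle_verts: "finite (cycle_verts N)"
  by (simp add: cycle_verts_def)

lemma mem_interface_edges_iff:
  assumes "i \<in> cycle_verts N"
  shows "cycle_edge N i \<in> interface_edges N X Y \<longleftrightarrow>
    (claims X Y i \<and> claims Y X ((i - 1) mod int N)) \<or> (claims X Y ((i - 1) mod int N) \<and> claims Y X i)"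
proof -
  have "cycle_edge N i \<in> cycle_edges N" using assms by (simp add: cycle_edges_eq)
  moreover have "(\<exists>u v. {a, b} = {u, v} \<and> P u v) \<longleftrightarrow> P a b \<or> P b a" for a b :: int and P
    by (auto simp: doubleton_eq_iff)
  ultimately show ?thesis
    unfolding interface_edges_def cycle_edge_def by simp (simp only: disj_commute)
qed

lemma measurable_mem_interface_edges:
  assumes i: "i \<in> cycle_verts N"
  shows "Measurable.pred two_walks_law
    (\<lambda>\<omega>. cycle_edge N i \<in> interface_edges N (walk N x (fst \<omega>)) (walk N y (snd \<omega>)))"
proof -
  have fst: "fst \<in> measurable two_walks_law walk_law" and snd: "snd \<in> measurable two_walks_law walk_law"
    unfolding two_walks_law_def by measurable
  have [measurable]: "Measurable.pred two_walks_law (\<lambda>\<omega>. claims (walk N x (fst \<omega>)) (walk N y (snd \<omega>)) v)"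
    "Measurable.pred two_walks_law (\<lambda>\<omega>. claims (walk N y (snd \<omega>)) (walk N x (fst \<omega>)) v)" for v
    by (rule measurable_claims[OF fst snd], rule measurable_claims[OF snd fst])
  show ?thesis unfolding mem_interface_edges_iff[OF i] by measurable
qed

section \<open>The interface in terms of jump indices\<close>

lemma jump_time_zip_seq: "jump_time (zip_seq \<omega>) n = arrival (fst \<omega>) n"
  by (simp add: jump_time_def arrival_def zip_seq_def)

lemma walk_zip_seq:
  assumes "\<And>j. arrival (fst \<omega>) j \<le> t \<longleftrightarrow> j \<le> n"
  shows "walk N x (zip_seq \<omega>) t = (x + disp (snd \<omega>) n) mod int N"
proof -
  have "num_jumps (zip_seq \<omega>) t = n"
    unfolding num_jumps_def jump_time_zip_seq
  proof (rule Least_equality)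
    show "t < arrival (fst \<omega>) (Suc n)" using assms[of "Suc n"] by simp
    fix m assume "t < arrival (fst \<omega>) (Suc m)"
    then show "n \<le> m" using assms[of "Suc m"] by simp
  qed
  then show ?thesis by (simp add: walk_def disp_def zip_seq_def)
qed

lemma regular_jump_index:
  assumes "regular \<omega>" "0 \<le> t"
  obtains n where "\<And>j. arrival (fst \<omega>) j \<le> t \<longleftrightarrow> j \<le> n"
  using jump_index[of "fst \<omega>" t] assms unfolding regular_def by blast

lemma arrival_le_iff: "regular \<omega> \<Longrightarrow> arrival (fst \<omega>) m \<le> arrival (fst \<omega>) n \<longleftrightarrow> m \<le> n"
  using strict_mono_less_eq[OF strict_mono_arrival[of "fst \<omega>"]] by (auto simp: regular_def)

lemma arrival_nonneg: "regular \<omega> \<Longrightarrow> 0 \<le> arrival (fst \<omega>) n"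
  using arrival_le_iff[of \<omega> 0 n] by simp

text \<open>
  It suffices to compare the walks at the jump times of the claiming walk, because nothing changes between jumps.
\<close>

lemma claims_zip_seq:
  assumes \<omega>: "regular \<omega>" and \<eta>: "regular \<eta>"
  shows "claims (walk N x (zip_seq \<omega>)) (walk N y (zip_seq \<eta>)) v \<longleftrightarrow>
    (\<exists>n. (x + disp (snd \<omega>) n) mod int N = v \<and>
      (\<forall>m. arrival (fst \<eta>) m \<le> arrival (fst \<omega>) n \<longrightarrow> (y + disp (snd \<eta>) m) mod int N \<noteq> v))"
proof
  assume "claims (walk N x (zip_seq \<omega>)) (walk N y (zip_seq \<eta>)) v"
  then obtain t where t: "0 \<le> t" "walk N x (zip_seq \<omega>) t = v" "\<And>s. s \<in> {0..t} \<Longrightarrow> walk N y (zip_seq \<eta>) s \<noteq> v"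
    unfolding claims_def by blast
  obtain n where n: "\<And>j. arrival (fst \<omega>) j \<le> t \<longleftrightarrow> j \<le> n" using regular_jump_index[OF \<omega> t(1)] by blast
  have "(y + disp (snd \<eta>) m) mod int N \<noteq> v" if m: "arrival (fst \<eta>) m \<le> arrival (fst \<omega>) n" for m
  proof -
    have "arrival (fst \<eta>) m \<in> {0..t}" using m n[of n] arrival_nonneg[OF \<eta>, of m] by auto
    then have "walk N y (zip_seq \<eta>) (arrival (fst \<eta>) m) \<noteq> v" by (rule t(3))
    then show ?thesis unfolding walk_zip_seq[OF arrival_le_iff[OF \<eta>]] .
  qed
  moreover have "(x + disp (snd \<omega>) n) mod int N = v"
    using t(2) walk_zip_seq[OF n, where N = N and x = x] by simp
  ultimately show "\<exists>n. (x + disp (snd \<omega>) n) mod int N = v \<and>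
      (\<forall>m. arrival (fst \<eta>) m \<le> arrival (fst \<omega>) n \<longrightarrow> (y + disp (snd \<eta>) m) mod int N \<noteq> v)"
    by blast
next
  assume "\<exists>n. (x + disp (snd \<omega>) n) mod int N = v \<and>
      (\<forall>m. arrival (fst \<eta>) m \<le> arrival (fst \<omega>) n \<longrightarrow> (y + disp (snd \<eta>) m) mod int N \<noteq> v)"
  then obtain n where n: "(x + disp (snd \<omega>) n) mod int N = v"
    "\<And>m. arrival (fst \<eta>) m \<le> arrival (fst \<omega>) n \<Longrightarrow> (y + disp (snd \<eta>) m) mod int N \<noteq> v" by blast
  let ?t = "arrival (fst \<omega>) n"
  have "walk N y (zip_seq \<eta>) s \<noteq> v" if s: "s \<in> {0..?t}" for s
  proof -
    obtain m where m: "\<And>j. arrival (fst \<eta>) j \<le> s \<longleftrightarrow> j \<le> m"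
      using regular_jump_index[OF \<eta>, of s] s by auto
    have "arrival (fst \<eta>) m \<le> ?t" using m[of m] s by auto
    then show ?thesis using n(2) walk_zip_seq[OF m, where N = N and x = y] by simp
  qed
  moreover have "walk N x (zip_seq \<omega>) ?t = v"
    using walk_zip_seq[OF arrival_le_iff[OF \<omega>], where N = N and x = x] n(1) by simp
  ultimately show "claims (walk N x (zip_seq \<omega>)) (walk N y (zip_seq \<eta>)) v"
    unfolding claims_def using arrival_nonneg[OF \<omega>, of n] by blast
qed

text \<open>
  \<open>claims\<close> for the endpoint \<open>z\<close>, in relative positions and in terms of jump indices.
\<close>

definition wins :: "nat \<Rightarrow> int \<Rightarrow> int \<Rightarrow> driver \<Rightarrow> driver \<Rightarrow> int \<Rightarrow> bool" where
  "wins N p q \<omega> \<eta> z \<longleftrightarrow> (\<exists>n. site N p (snd \<omega>) n = z \<and>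
    (\<forall>m. arrival (fst \<eta>) m \<le> arrival (fst \<omega>) n \<longrightarrow> site N q (snd \<eta>) m \<noteq> z))"

text \<open>
  The walks with relative starting positions \<open>p\<close> and \<open>q\<close> put the distinguished edge into the interface.
\<close>

definition splits :: "nat \<Rightarrow> int \<Rightarrow> int \<Rightarrow> driver \<Rightarrow> driver \<Rightarrow> bool" where
  "splits N p q \<omega> \<eta> \<longleftrightarrow> (wins N p q \<omega> \<eta> 0 \<and> wins N q p \<eta> \<omega> (int N - 1)) \<or>
    (wins N p q \<omega> \<eta> (int N - 1) \<and> wins N q p \<eta> \<omega> 0)"

lemma site_relative_iff:
  assumes "0 < N" "0 \<le> v" "v < int N"
  shows "(x + d) mod int N = v \<longleftrightarrow> ((x - i) mod int N + d) mod int N = (v - i) mod int N"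
proof -
  have "((x - i) mod int N + d) mod int N = (v - i) mod int N \<longleftrightarrow> int N dvd (x - i + d) - (v - i)"
    by (simp add: mod_eq_dvd_iff mod_simps)
  also have "\<dots> \<longleftrightarrow> (x + d) mod int N = v mod int N"
    by (simp add: mod_eq_dvd_iff algebra_simps)
  finally show ?thesis using assms by simp
qed

lemma interface_zip_seq_iff:
  assumes \<omega>: "regular \<omega>" and \<eta>: "regular \<eta>" and i: "i \<in> cycle_verts N"
  shows "cycle_edge N i \<in> interface_edges N (walk N x (zip_seq \<omega>)) (walk N y (zip_seq \<eta>)) \<longleftrightarrow>
    splits N ((x - i) mod int N) ((y - i) mod int N) \<omega> \<eta>"
proof -
  have N: "0 < N" "0 \<le> i" "i < int N" using i by (auto simp: cycle_verts_def)
  have at_i: "(x + d) mod int N = i \<longleftrightarrow> ((x - i) mod int N + d) mod int N = 0" for x d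
    using site_relative_iff[of N i x d i] N by simp
  have "(((i - 1) mod int N) - i) mod int N = int N - 1"
    using N by (simp add: mod_simps zmod_minus1)
  then have at_pred: "(x + d) mod int N = (i - 1) mod int N \<longleftrightarrow>
      ((x - i) mod int N + d) mod int N = int N - 1" for x d
    using site_relative_iff[of N "(i - 1) mod int N" x d i] N by simp
  show ?thesis
    unfolding mem_interface_edges_iff[OF i] claims_zip_seq[OF \<omega> \<eta>] claims_zip_seq[OF \<eta> \<omega>]
      splits_def wins_def site_def at_i at_pred by blast
qed

lemma splits_commute: "splits N p q \<omega> \<eta> \<longleftrightarrow> splits N q p \<eta> \<omega>"
  by (auto simp: splits_def)

text \<open>
  The walk driven by \<open>\<omega>\<close> is at the edge first. If it had seen both endpoints when the other walk arrives, the other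
  walk could not claim any of them.
\<close>

lemma wins_imp_caught:
  assumes \<omega>: "regular \<omega>" and \<eta>: "regular \<eta>"
    and first: "first_hit N p (snd \<omega>) n" "first_hit N q (snd \<eta>) m"
      "arrival (fst \<omega>) n \<le> arrival (fst \<eta>) m"
    and z: "wins N q p \<eta> \<omega> z" "z = 0 \<or> z = int N - 1"
  shows "caught N p q \<omega> \<eta>"
proof -
  obtain k where k: "site N q (snd \<eta>) k = z"
    "\<And>j. arrival (fst \<omega>) j \<le> arrival (fst \<eta>) k \<Longrightarrow> site N p (snd \<omega>) j \<noteq> z"
    using z(1) unfolding wins_def by blast
  have "at_edge N q (snd \<eta>) k" using k(1) z(2) by (auto simp: at_edge_def)
  then have "m \<le> k" using first(2) by (auto simp: first_hit_def not_less[symmetric])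
  then have "arrival (fst \<eta>) m \<le> arrival (fst \<eta>) k" using arrival_le_iff[OF \<eta>] by simp
  then have no: "site N p (snd \<omega>) j \<noteq> z" if "arrival (fst \<omega>) j \<le> arrival (fst \<eta>) m" for j
    using k(2)[of j] that by linarith
  have "at_edge N p (snd \<omega>) n" using first(1) by (simp add: first_hit_def)
  then have "half_visited_at N p \<omega> (arrival (fst \<eta>) m)"
    unfolding half_visited_def using no first(3) z(2) by (auto simp: at_edge_def)
  then show ?thesis using first(2) unfolding caught_def by blast
qed

lemma splits_imp_caught:
  assumes \<omega>: "regular \<omega>" and \<eta>: "regular \<eta>" and s: "splits N p q \<omega> \<eta>"
  shows "caught N p q \<omega> \<eta> \<or> caught N q p \<eta> \<omega>"
proof -
  obtain z z' where z: "wins N p q \<omega> \<eta> z" "z = 0 \<or> z = int N - 1"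
    and z': "wins N q p \<eta> \<omega> z'" "z' = 0 \<or> z' = int N - 1"
    using s unfolding splits_def by blast
  obtain n where "at_edge N p (snd \<omega>) n" using z by (auto simp: wins_def at_edge_def)
  then obtain n where n: "first_hit N p (snd \<omega>) n" using ex_first_hit_iff[of "Suc n" N p "snd \<omega>"] by blast
  obtain m where "at_edge N q (snd \<eta>) m" using z' by (auto simp: wins_def at_edge_def)
  then obtain m where m: "first_hit N q (snd \<eta>) m" using ex_first_hit_iff[of "Suc m" N q "snd \<eta>"] by blast
  show ?thesis
  proof (cases "arrival (fst \<omega>) n \<le> arrival (fst \<eta>) m")
    case True
    then show ?thesis using wins_imp_caught[OF \<omega> \<eta> n m _ z'] by blast
  next
    case False
    then show ?thesis using wins_imp_caught[OF \<eta> \<omega> m n _ z] by simp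
  qed
qed

section \<open>Lingering at an edge and hurrying across it\<close>

lemma site_add: "site N p s (n + j) = (site N p s n + disp (\<lambda>k. s (n + k)) j) mod int N"
  by (simp add: site_def disp_add mod_simps add.assoc)

lemma site_cong: "(\<And>k. k < n \<Longrightarrow> s k = s' k) \<Longrightarrow> j \<le> n \<Longrightarrow> site N p s j = site N p s' j"
  unfolding site_def by (subst disp_cong[of j s s']) auto

lemma first_hit_cong:
  assumes "\<And>k. k < n \<Longrightarrow> s k = s' k" "first_hit N p s n"
  shows "first_hit N p s' n"
proof -
  have "site N p s j = site N p s' j" if "j \<le> n" for j by (rule site_cong[OF assms(1) that])
  then show ?thesis using assms(2) unfolding first_hit_def at_edge_def by (metis less_imp_le order_refl)
qed

text \<open>
  The condition \<open>R\<close> on the steps after the first visit may depend on the endpoint \<open>z\<close> that is visited. Splitting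
  the sequence of steps at the index \<open>n\<close> makes it independent of the past once \<open>z\<close> is fixed.
\<close>

lemma prob_after_first_hit_ge:
  assumes N: "2 \<le> N"
    and R [measurable]: "\<And>z. Measurable.pred steps_law (R z)"
    and Q [measurable]: "Measurable.pred steps_law Q"
    and c: "c \<le> \<P>(s in steps_law. R 0 s)" "c \<le> \<P>(s in steps_law. R (int N - 1) s)"
    and RQ: "\<And>s. first_hit N p s n \<Longrightarrow> R (site N p s n) (\<lambda>k. s (n + k)) \<Longrightarrow> Q s"
  shows "c * \<P>(s in steps_law. first_hit N p s n) \<le> \<P>(s in steps_law. first_hit N p s n \<and> Q s)"
proof -
  let ?H = "\<lambda>z. {s \<in> space steps_law. first_hit N p s n \<and> site N p s n = z}"
  let ?G = "\<lambda>z. {s \<in> space steps_law. (first_hit N p s n \<and> site N p s n = z) \<and> R z (\<lambda>k. s (n + k))}"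
  note measurable_site [measurable]
  have [measurable]: "Measurable.pred steps_law (\<lambda>s. R z (\<lambda>k. s (n + k)))" for z
    by (rule measurable_compose[OF steps_shift_measurable R])
  have H: "?H z \<in> sets steps_law" for z by measurable
  have G: "?G z \<in> sets steps_law" for z by measurable
  have split: "measure steps_law (?G z) = measure steps_law (?H z) * \<P>(s in steps_law. R z s)" for z
  proof (rule steps_split)
    fix s s' :: "nat \<Rightarrow> int"
    assume *: "\<And>k. k < n \<Longrightarrow> s k = s' k" and "first_hit N p s n \<and> site N p s n = z"
    then show "first_hit N p s' n \<and> site N p s' n = z"
      using first_hit_cong[OF *] site_cong[OF *, where j = n and N = N and p = p] by simp
  qed measurable
  have ne: "(0::int) \<noteq> int N - 1" using N by simp
  have "c * \<P>(s in steps_law. first_hit N p s n) = c * (measure steps_law (?H 0) + measure steps_law (?H (int N - 1)))"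
  proof -
    have "{s \<in> space steps_law. first_hit N p s n} = ?H 0 \<union> ?H (int N - 1)"
      by (auto simp: first_hit_def at_edge_def)
    moreover have "?H 0 \<inter> ?H (int N - 1) = {}" using ne by auto
    ultimately show ?thesis by (simp only: steps.finite_measure_Union[OF H H])
  qed
  also have "\<dots> \<le> measure steps_law (?G 0) + measure steps_law (?G (int N - 1))"
    unfolding split distrib_left
    using c by (intro add_mono) (auto simp: mult.commute[of c] intro!: mult_left_mono)
  also have "\<dots> = measure steps_law (?G 0 \<union> ?G (int N - 1))"
    using ne by (intro steps.finite_measure_Union[symmetric] G) auto
  also have "\<dots> \<le> \<P>(s in steps_law. first_hit N p s n \<and> Q s)"
  proof (rule steps.finite_measure_mono)
    show "?G 0 \<union> ?G (int N - 1) \<subseteq> {s \<in> space steps_law. first_hit N p s n \<and> Q s}"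
      using RQ by auto
    show "{s \<in> space steps_law. first_hit N p s n \<and> Q s} \<in> sets steps_law" by measurable
  qed
  finally show ?thesis .
qed

text \<open>
  \<open>int N - 1 - z\<close> is the endpoint opposite to \<open>z\<close>.
\<close>

definition stays_away :: "nat \<Rightarrow> int \<Rightarrow> nat \<Rightarrow> (nat \<Rightarrow> int) \<Rightarrow> nat \<Rightarrow> bool" where
  "stays_away N p m s n \<longleftrightarrow> (\<forall>j\<le>m. site N p s (n + j) \<noteq> int N - 1 - site N p s n)"

definition crosses :: "nat \<Rightarrow> int \<Rightarrow> (nat \<Rightarrow> int) \<Rightarrow> nat \<Rightarrow> bool" where
  "crosses N p s n \<longleftrightarrow> site N p s (Suc n) = int N - 1 - site N p s n"

lemma measurable_site_count_space [measurable]: "(\<lambda>s. site N p s n) \<in> measurable steps_law (count_space UNIV)"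
  unfolding site_def by (rule measurable_compose[OF measurable_disp]) simp

lemma measurable_site_rel: "Measurable.pred steps_law (\<lambda>s. site N p s m = int N - 1 - site N p s n)"
proof -
  have "Measurable.pred steps_law (\<lambda>s. (\<lambda>z s. site N p s m = int N - 1 - z) (site N p s n) s)"
    by (rule measurable_compose_countable[OF _ measurable_site_count_space]) (rule measurable_site)
  then show ?thesis by simp
qed

lemma measurable_stays_away [measurable]: "Measurable.pred steps_law (\<lambda>s. stays_away N p m s n)"
proof -
  note measurable_site_rel [measurable]
  show ?thesis unfolding stays_away_def by measurable
qed

lemma measurable_crosses [measurable]: "Measurable.pred steps_law (\<lambda>s. crosses N p s n)"
  unfolding crosses_def by (rule measurable_site_rel)

text \<open>
  Seen from endpoint \<open>0\<close> the opposite endpoint is one step to the left and \<open>N - 1\<close> steps to the right, and vice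
  versa for endpoint \<open>N - 1\<close>. It is avoided by a walk that stays within an interval of length \<open>L \<le> N\<close>
  which starts next to the opposite endpoint. Choosing \<open>L\<close> smaller than \<open>N\<close> increases the bound as long as \<open>m\<close> is of
  order at most \<open>L\<^sup>2\<close>.
\<close>

lemma prob_first_hit_stays_away:
  fixes L N :: nat
  assumes L: "2 \<le> L" "L \<le> N"
  shows "cos (pi / L) ^ m * sin (pi / L) * \<P>(s in steps_law. first_hit N p s n)
    \<le> \<P>(s in steps_law. first_hit N p s n \<and> stays_away N p m s n)"
proof -
  \<comment> \<open>The starting point within the interval \<open>{0<..<L}\<close>; the boundary point next to it is the opposite endpoint.\<close>
  define b where "b z = (if z = 0 then 1 else int L - 1)" for z :: int
  let ?R = "\<lambda>z s. \<forall>j\<le>m. 0 < b z + disp s j \<and> b z + disp s j < int L"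
  show ?thesis
  proof (rule prob_after_first_hit_ge[where R = ?R])
    show "2 \<le> N" using L by simp
    show "Measurable.pred steps_law (?R z)" for z by (rule pred_all_disp)
    show "Measurable.pred steps_law (\<lambda>s. stays_away N p m s n)" by measurable
    show "cos (pi / L) ^ m * sin (pi / L) \<le> \<P>(s in steps_law. ?R 0 s)"
      using prob_stay_between[of L 1 m] L by (simp add: b_def)
    have "sin (pi * of_int (int L - 1) / L) = sin (pi / L)"
    proof -
      have "pi * of_int (int L - 1) / L = pi - pi / L" using L by (simp add: field_simps)
      then show ?thesis by simp
    qed
    then show "cos (pi / L) ^ m * sin (pi / L) \<le> \<P>(s in steps_law. ?R (int N - 1) s)"
      using prob_stay_between[of L "int L - 1" m] L by (simp add: b_def)
    fix s assume hit: "first_hit N p s n" and R: "?R (site N p s n) (\<lambda>k. s (n + k))"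
    show "stays_away N p m s n"
      unfolding stays_away_def
    proof (intro allI impI)
      fix j assume "j \<le> m"
      then have d: "0 < b (site N p s n) + disp (\<lambda>k. s (n + k)) j" "b (site N p s n) + disp (\<lambda>k. s (n + k)) j < int L"
        using R by auto
      have "site N p s n = 0 \<or> site N p s n = int N - 1" using hit by (auto simp: first_hit_def at_edge_def)
      then show "site N p s (n + j) \<noteq> int N - 1 - site N p s n"
      proof
        assume z: "site N p s n = 0"
        then have "site N p s (n + j) = disp (\<lambda>k. s (n + k)) j"
          using d L unfolding site_add by (simp add: b_def)
        then show ?thesis using d L z by (simp add: b_def)
      next
        assume z: "site N p s n = int N - 1"
        then have "site N p s (n + j) = int N - 1 + disp (\<lambda>k. s (n + k)) j"
          using d L unfolding site_add z by (intro mod_pos_pos_trivial) (simp_all add: b_def)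
        then show ?thesis using d L z by (simp add: b_def)
      qed
    qed
  qed
qed

lemma prob_first_hit_crosses:
  assumes N: "2 \<le> N"
  shows "1 / 2 * \<P>(s in steps_law. first_hit N p s n) \<le> \<P>(s in steps_law. first_hit N p s n \<and> crosses N p s n)"
proof (rule prob_after_first_hit_ge[OF N, where R = "\<lambda>z s. s 0 = (if z = 0 then - 1 else 1)"])
  show "Measurable.pred steps_law (\<lambda>s. s 0 = (if z = 0 then - 1 else 1))" for z :: int by measurable
  show "Measurable.pred steps_law (\<lambda>s. crosses N p s n)" by measurable
  show "1 / 2 \<le> \<P>(s in steps_law. s 0 = (if (0::int) = 0 then - 1 else 1))"
    "1 / 2 \<le> \<P>(s in steps_law. s 0 = (if int N - 1 = 0 then - 1 else 1))"
    using prob_step[of "-1"] prob_step[of 1] N by simp_all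
  fix s assume hit: "first_hit N p s n" and R: "s (n + 0) = (if site N p s n = 0 then - 1 else 1)"
  have "site N p s (Suc n) = (site N p s n + s n) mod int N"
    using site_add[of N p s n 1] by (simp add: disp_def)
  moreover have "site N p s n = 0 \<or> site N p s n = int N - 1" using hit by (auto simp: first_hit_def at_edge_def)
  ultimately show "crosses N p s n" unfolding crosses_def using R N by (auto simp: zmod_minus1)
qed

lemma prob_arrival_gap:
  assumes [measurable]: "A \<in> sets borel"
  shows "\<P>(a in waits_law. arrival a n \<in> A \<and> \<tau> < arrival a (n + m) - arrival a n)
    = \<P>(a in waits_law. arrival a n \<in> A) * \<P>(a in waits_law. \<tau> < arrival a m)"
proof -
  have "\<P>(a in waits_law. arrival a n \<in> A \<and> \<tau> < arrival (\<lambda>k. a (n + k)) m)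
    = \<P>(a in waits_law. arrival a n \<in> A) * \<P>(a in waits_law. \<tau> < arrival a m)"
  proof (rule waits_split[of "\<lambda>a. arrival a n \<in> A" "\<lambda>a. \<tau> < arrival a m" n])
    fix a b :: "nat \<Rightarrow> real" assume "\<And>k. k < n \<Longrightarrow> a k = b k" "arrival a n \<in> A"
    then show "arrival b n \<in> A" using arrival_cong[of n a b] by simp
  qed measurable
  then show ?thesis by (simp add: arrival_add)
qed

lemma prob_arrival_wait_le_1:
  assumes [measurable]: "A \<in> sets borel"
  shows "1 / 2 * \<P>(a in waits_law. arrival a n \<in> A) \<le> \<P>(a in waits_law. arrival a n \<in> A \<and> a n \<le> 1)"
proof -
  have "\<P>(a in waits_law. arrival a n \<in> A \<and> a (n + 0) \<le> 1)
    = \<P>(a in waits_law. arrival a n \<in> A) * \<P>(a in waits_law. a 0 \<le> 1)"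
  proof (rule waits_split[of "\<lambda>a. arrival a n \<in> A" "\<lambda>a. a 0 \<le> 1" n])
    fix a b :: "nat \<Rightarrow> real" assume "\<And>k. k < n \<Longrightarrow> a k = b k" "arrival a n \<in> A"
    then show "arrival b n \<in> A" using arrival_cong[of n a b] by simp
  qed measurable
  moreover have "1 / 2 \<le> \<P>(a in waits_law. a 0 \<le> 1)"
  proof -
    have "\<P>(a in waits_law. a 0 \<le> 1) = 1 - exp (- 1)"
      using waits.exponential_distributedD_le[OF distributed_wait[of 0], of 1] by simp
    moreover have "exp (- 1) \<le> (1 / 2 :: real)"
      using exp_ge_add_one_self[of 1] by (simp add: exp_minus field_simps)
    ultimately show ?thesis by simp
  qed
  ultimately show ?thesis
    using mult_right_mono[of "1 / 2" "\<P>(a in waits_law. a 0 \<le> 1)" "\<P>(a in waits_law. arrival a n \<in> A)"]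
    by (simp add: mult.commute)
qed

text \<open>
  Decomposition with respect to an index that is determined by the steps; for each index the conditions on waits and
  on steps are independent.
\<close>

lemma emeasure_driver_disjoint:
  assumes F [measurable]: "\<And>n. Measurable.pred waits_law (F n)"
    and G [measurable]: "\<And>n. Measurable.pred steps_law (G n)"
    and disj: "\<And>m n s. G m s \<Longrightarrow> G n s \<Longrightarrow> m = n"
  shows "emeasure driver_law {\<omega> \<in> space driver_law. \<exists>n. F n (fst \<omega>) \<and> G n (snd \<omega>)}
    = (\<Sum>n. ennreal (\<P>(a in waits_law. F n a) * \<P>(s in steps_law. G n s)))"
proof -
  let ?A = "\<lambda>n. {\<omega> \<in> space driver_law. F n (fst \<omega>) \<and> G n (snd \<omega>)}"
  have A: "?A n \<in> sets driver_law" for n by measurable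
  have "{\<omega> \<in> space driver_law. \<exists>n. F n (fst \<omega>) \<and> G n (snd \<omega>)} = (\<Union>n. ?A n)" by auto
  moreover have "emeasure driver_law (\<Union>n. ?A n) = (\<Sum>n. emeasure driver_law (?A n))"
    using A by (intro suminf_emeasure[symmetric]) (auto simp: disjoint_family_on_def dest: disj)
  moreover have "emeasure driver_law (?A n) = ennreal (\<P>(a in waits_law. F n a) * \<P>(s in steps_law. G n s))" for n
  proof -
    have "?A n = {a \<in> space waits_law. F n a} \<times> {s \<in> space steps_law. G n s}" by auto
    moreover have "{a \<in> space waits_law. F n a} \<in> sets waits_law" "{s \<in> space steps_law. G n s} \<in> sets steps_law"
      by measurable
    ultimately show ?thesis
      by (simp only: driver_law_def steps.emeasure_pair_measure_Times waits.emeasure_eq_measure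
          steps.emeasure_eq_measure ennreal_mult[OF measure_nonneg measure_nonneg])
  qed
  ultimately show ?thesis by simp
qed

text \<open>
  The set \<open>A\<close> is arbitrary in order that \<open>lingers\<close> and \<open>hurries\<close>, which keep a fixed proportion of the probability
  of \<open>hits_in\<close> for every \<open>A\<close>, can be combined with any condition on the time of the first visit of the other walk.
\<close>

definition hits_in :: "nat \<Rightarrow> int \<Rightarrow> real set \<Rightarrow> driver \<Rightarrow> bool" where
  "hits_in N p A \<omega> \<longleftrightarrow> (\<exists>n. arrival (fst \<omega>) n \<in> A \<and> first_hit N p (snd \<omega>) n)"

definition lingers :: "nat \<Rightarrow> int \<Rightarrow> nat \<Rightarrow> real \<Rightarrow> real set \<Rightarrow> driver \<Rightarrow> bool" where
  "lingers N p m \<tau> A \<omega> \<longleftrightarrow> (\<exists>n. (arrival (fst \<omega>) n \<in> A \<and> \<tau> < arrival (fst \<omega>) (n + m) - arrival (fst \<omega>) n) \<and>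
    (first_hit N p (snd \<omega>) n \<and> stays_away N p m (snd \<omega>) n))"

definition hurries :: "nat \<Rightarrow> int \<Rightarrow> real set \<Rightarrow> driver \<Rightarrow> bool" where
  "hurries N p A \<omega> \<longleftrightarrow> (\<exists>n. (arrival (fst \<omega>) n \<in> A \<and> fst \<omega> n \<le> 1) \<and>
    (first_hit N p (snd \<omega>) n \<and> crosses N p (snd \<omega>) n))"

lemma emeasure_hits_in:
  assumes [measurable]: "A \<in> sets borel"
  shows "emeasure driver_law {\<omega> \<in> space driver_law. hits_in N p A \<omega>}
    = (\<Sum>n. ennreal (\<P>(a in waits_law. arrival a n \<in> A) * \<P>(s in steps_law. first_hit N p s n)))"
  unfolding hits_in_def
proof (rule emeasure_driver_disjoint)
  show "Measurable.pred waits_law (\<lambda>a. arrival a n \<in> A)" for n by measurable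
  show "Measurable.pred steps_law (\<lambda>s. first_hit N p s n)" for n by measurable
qed (rule first_hit_unique)

lemma emeasure_lingers_ge:
  fixes L N :: nat
  assumes [measurable]: "A \<in> sets borel" and L: "2 \<le> L" "L \<le> N"
  shows "ennreal (cos (pi / L) ^ m * sin (pi / L) * \<P>(a in waits_law. \<tau> < arrival a m)) *
      emeasure driver_law {\<omega> \<in> space driver_law. hits_in N p A \<omega>}
    \<le> emeasure driver_law {\<omega> \<in> space driver_law. lingers N p m \<tau> A \<omega>}"
proof -
  let ?d = "\<P>(a in waits_law. \<tau> < arrival a m)"
  let ?c = "cos (pi / L) ^ m * sin (pi / L)"
  have c: "0 \<le> ?c" using cos_power_sin_nonneg[OF L(1)] by simp
  have "emeasure driver_law {\<omega> \<in> space driver_law. lingers N p m \<tau> A \<omega>}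
    = (\<Sum>n. ennreal (\<P>(a in waits_law. arrival a n \<in> A \<and> \<tau> < arrival a (n + m) - arrival a n) *
        \<P>(s in steps_law. first_hit N p s n \<and> stays_away N p m s n)))"
    unfolding lingers_def
  proof (rule emeasure_driver_disjoint)
    show "Measurable.pred waits_law (\<lambda>a. arrival a n \<in> A \<and> \<tau> < arrival a (n + m) - arrival a n)" for n
      by measurable
    show "Measurable.pred steps_law (\<lambda>s. first_hit N p s n \<and> stays_away N p m s n)" for n by measurable
  qed (blast intro: first_hit_unique)
  also have "\<dots> \<ge> (\<Sum>n. ennreal (?c * ?d) *
      ennreal (\<P>(a in waits_law. arrival a n \<in> A) * \<P>(s in steps_law. first_hit N p s n)))"
  proof (rule suminf_le)
    fix n
    let ?A = "\<P>(a in waits_law. arrival a n \<in> A)" and ?H = "\<P>(s in steps_law. first_hit N p s n)"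
    have "ennreal (?c * ?d) * ennreal (?A * ?H) = ennreal ((?A * ?d) * (?c * ?H))"
    proof -
      have "ennreal (?c * ?d) * ennreal (?A * ?H) = ennreal ((?c * ?d) * (?A * ?H))"
        by (intro ennreal_mult[symmetric] mult_nonneg_nonneg[OF c] mult_nonneg_nonneg measure_nonneg)
      then show ?thesis by (simp only: mult_ac)
    qed
    also have "\<dots> \<le> ennreal ((?A * ?d) * \<P>(s in steps_law. first_hit N p s n \<and> stays_away N p m s n))"
      by (intro ennreal_leI mult_left_mono prob_first_hit_stays_away L) simp
    finally show "ennreal (?c * ?d) * ennreal (?A * ?H)
      \<le> ennreal (\<P>(a in waits_law. arrival a n \<in> A \<and> \<tau> < arrival a (n + m) - arrival a n) *
        \<P>(s in steps_law. first_hit N p s n \<and> stays_away N p m s n))"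
      by (simp only: prob_arrival_gap[OF assms(1)])
  qed auto
  finally show ?thesis unfolding emeasure_hits_in[OF assms(1)] by simp
qed

lemma emeasure_hurries_ge:
  assumes [measurable]: "A \<in> sets borel" and N: "2 \<le> N"
  shows "ennreal (1 / 4) * emeasure driver_law {\<omega> \<in> space driver_law. hits_in N p A \<omega>}
    \<le> emeasure driver_law {\<omega> \<in> space driver_law. hurries N p A \<omega>}"
proof -
  have "emeasure driver_law {\<omega> \<in> space driver_law. hurries N p A \<omega>}
    = (\<Sum>n. ennreal (\<P>(a in waits_law. arrival a n \<in> A \<and> a n \<le> 1) *
        \<P>(s in steps_law. first_hit N p s n \<and> crosses N p s n)))"
    unfolding hurries_def
  proof (rule emeasure_driver_disjoint)
    show "Measurable.pred waits_law (\<lambda>a. arrival a n \<in> A \<and> a n \<le> 1)" for n by measurable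
    show "Measurable.pred steps_law (\<lambda>s. first_hit N p s n \<and> crosses N p s n)" for n by measurable
  qed (blast intro: first_hit_unique)
  also have "\<dots> \<ge> (\<Sum>n. ennreal (1 / 4) *
      ennreal (\<P>(a in waits_law. arrival a n \<in> A) * \<P>(s in steps_law. first_hit N p s n)))"
  proof (rule suminf_le)
    fix n
    let ?A = "\<P>(a in waits_law. arrival a n \<in> A)" and ?H = "\<P>(s in steps_law. first_hit N p s n)"
    have "ennreal (1 / 4) * ennreal (?A * ?H) = ennreal ((1 / 2 * ?A) * (1 / 2 * ?H))"
      by (subst ennreal_mult[symmetric]) auto
    also have "\<dots> \<le> ennreal (\<P>(a in waits_law. arrival a n \<in> A \<and> a n \<le> 1) *
        \<P>(s in steps_law. first_hit N p s n \<and> crosses N p s n))"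
      by (intro ennreal_leI mult_mono prob_first_hit_crosses prob_arrival_wait_le_1 N) auto
    finally show "ennreal (1 / 4) * ennreal (?A * ?H)
      \<le> ennreal (\<P>(a in waits_law. arrival a n \<in> A \<and> a n \<le> 1) *
        \<P>(s in steps_law. first_hit N p s n \<and> crosses N p s n))" .
  qed auto
  finally show ?thesis unfolding emeasure_hits_in[OF assms(1)] by simp
qed

section \<open>One walk lingers while the other one hurries\<close>

lemma pair_law_swap:
  assumes [measurable]: "Measurable.pred pair_law (\<lambda>x. Q (fst x) (snd x))"
  shows "\<P>(x in pair_law. Q (snd x) (fst x)) = pair_prob Q"
proof -
  let ?E = "{x \<in> space pair_law. Q (fst x) (snd x)}"
  have E: "?E \<in> sets pair_law" by measurable
  have "measure pair_law ?E = measure (distr pair_law pair_law (\<lambda>(x, y). (y, x))) ?E"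
    using two_drivers.distr_pair_swap by simp
  also have "\<dots> = measure pair_law ((\<lambda>(x, y). (y, x)) -` ?E \<inter> space pair_law)"
    by (rule measure_distr[OF _ E]) measurable
  also have "(\<lambda>(x, y). (y, x)) -` ?E \<inter> space pair_law = {x \<in> space pair_law. Q (snd x) (fst x)}"
    by auto
  finally show ?thesis ..
qed

lemma pair_law_le_slices_fst:
  assumes [measurable]: "Measurable.pred pair_law (\<lambda>x. P (fst x) (snd x))"
      "Measurable.pred pair_law (\<lambda>x. Q (fst x) (snd x))"
    and le: "\<And>\<eta>. ennreal c * emeasure driver_law {\<omega> \<in> space driver_law. P \<omega> \<eta>}
      \<le> emeasure driver_law {\<omega> \<in> space driver_law. Q \<omega> \<eta>}"
    and c: "0 \<le> c"
  shows "c * pair_prob P \<le> pair_prob Q"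
proof -
  have fubini: "emeasure pair_law {x \<in> space pair_law. R (fst x) (snd x)}
      = (\<integral>\<^sup>+ \<eta>. emeasure driver_law {\<omega> \<in> space driver_law. R \<omega> \<eta>} \<partial>driver_law)"
      "(\<lambda>\<eta>. emeasure driver_law {\<omega> \<in> space driver_law. R \<omega> \<eta>}) \<in> borel_measurable driver_law"
    if "Measurable.pred pair_law (\<lambda>x. R (fst x) (snd x))" for R
  proof -
    have E: "{x \<in> space pair_law. R (fst x) (snd x)} \<in> sets pair_law"
      using that unfolding pred_def .
    show "emeasure pair_law {x \<in> space pair_law. R (fst x) (snd x)}
      = (\<integral>\<^sup>+ \<eta>. emeasure driver_law {\<omega> \<in> space driver_law. R \<omega> \<eta>} \<partial>driver_law)"
      using two_drivers.emeasure_pair_measure_alt2[OF E] by (simp add: vimage_def)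
    show "(\<lambda>\<eta>. emeasure driver_law {\<omega> \<in> space driver_law. R \<omega> \<eta>}) \<in> borel_measurable driver_law"
      using two_drivers.measurable_emeasure_Pair2[OF E] by (simp add: vimage_def)
  qed
  have "ennreal c * emeasure pair_law {x \<in> space pair_law. P (fst x) (snd x)}
      = (\<integral>\<^sup>+ \<eta>. ennreal c * emeasure driver_law {\<omega> \<in> space driver_law. P \<omega> \<eta>} \<partial>driver_law)"
    unfolding fubini(1)[OF assms(1)] by (rule nn_integral_cmult[symmetric, OF fubini(2)[OF assms(1)]])
  also have "\<dots> \<le> emeasure pair_law {x \<in> space pair_law. Q (fst x) (snd x)}"
    unfolding fubini(1)[OF assms(2)] by (rule nn_integral_mono) (rule le)
  finally have "ennreal (c * pair_prob P) \<le> ennreal (pair_prob Q)"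
    unfolding two_drivers.P.emeasure_eq_measure using c by (simp add: ennreal_mult)
  then show ?thesis by simp
qed

lemma pair_law_le_slices_snd:
  assumes P: "Measurable.pred pair_law (\<lambda>x. P (fst x) (snd x))"
    and Q: "Measurable.pred pair_law (\<lambda>x. Q (fst x) (snd x))"
    and le: "\<And>\<omega>. ennreal c * emeasure driver_law {\<eta> \<in> space driver_law. P \<omega> \<eta>}
      \<le> emeasure driver_law {\<eta> \<in> space driver_law. Q \<omega> \<eta>}"
    and c: "0 \<le> c"
  shows "c * pair_prob P \<le> pair_prob Q"
proof -
  have swap: "Measurable.pred pair_law (\<lambda>x. R (snd x) (fst x))"
    if "Measurable.pred pair_law (\<lambda>x. R (fst x) (snd x))" for R
  proof -
    have "(\<lambda>x. (snd x, fst x)) \<in> measurable pair_law pair_law" by measurable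
    from measurable_compose[OF this that] show ?thesis by simp
  qed
  have "c * \<P>(x in pair_law. P (snd x) (fst x)) \<le> \<P>(x in pair_law. Q (snd x) (fst x))"
    by (rule pair_law_le_slices_fst[where P = "\<lambda>\<eta> \<omega>. P \<omega> \<eta>" and Q = "\<lambda>\<eta> \<omega>. Q \<omega> \<eta>", OF swap[OF P] swap[OF Q] le c])
  then show ?thesis unfolding pair_law_swap[OF P] pair_law_swap[OF Q] .
qed

text \<open>
  For \<open>\<tau> = T + 1\<close> this entails a split (\<open>overtake_imp_splits\<close>), and it can be decoupled by Fubini's theorem: for fixed
  \<open>\<eta>\<close> only the time of its first visit enters the condition on \<open>\<omega>\<close>.
\<close>

definition overtake :: "nat \<Rightarrow> int \<Rightarrow> int \<Rightarrow> nat \<Rightarrow> real \<Rightarrow> real \<Rightarrow>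
    driver \<Rightarrow> driver \<Rightarrow> bool" where
  "overtake N p q m \<tau> T \<omega> \<eta> \<longleftrightarrow> (\<exists>k. (arrival (fst \<eta>) k \<le> T \<and> fst \<eta> k \<le> 1) \<and>
    (first_hit N q (snd \<eta>) k \<and> crosses N q (snd \<eta>) k) \<and> lingers N p m \<tau> {..<arrival (fst \<eta>) k} \<omega>)"

text \<open>
  Intermediate between \<open>overtake\<close> and \<open>hits_before\<close>: the two conditions on the behaviour after the first visits are
  dropped one after the other, each time with the opposite walk fixed.
\<close>

definition hurried_after :: "nat \<Rightarrow> int \<Rightarrow> int \<Rightarrow> real \<Rightarrow>
    driver \<Rightarrow> driver \<Rightarrow> bool" where
  "hurried_after N p q T \<omega> \<eta> \<longleftrightarrow> (\<exists>k. (arrival (fst \<eta>) k \<le> T \<and> fst \<eta> k \<le> 1) \<and>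
    (first_hit N q (snd \<eta>) k \<and> crosses N q (snd \<eta>) k) \<and> hits_in N p {..<arrival (fst \<eta>) k} \<omega>)"

definition hits_before :: "nat \<Rightarrow> int \<Rightarrow> int \<Rightarrow> real \<Rightarrow>
    driver \<Rightarrow> driver \<Rightarrow> bool" where
  "hits_before N p q T \<omega> \<eta> \<longleftrightarrow> (\<exists>n. first_hit N p (snd \<omega>) n \<and> hits_in N q {arrival (fst \<omega>) n<..T} \<eta>)"

lemma measurable_wait_snd [measurable]: "(\<lambda>\<omega>. fst \<omega> k) \<in> borel_measurable driver_law"
  by (rule measurable_compose[OF measurable_fst_driver measurable_wait])

lemma measurable_overtake: "Measurable.pred pair_law (\<lambda>x. overtake N p q m \<tau> T (fst x) (snd x))"
  unfolding overtake_def lingers_def lessThan_iff by measurable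

lemma measurable_hurried_after: "Measurable.pred pair_law (\<lambda>x. hurried_after N p q T (fst x) (snd x))"
  unfolding hurried_after_def hits_in_def lessThan_iff by measurable

lemma measurable_hits_before: "Measurable.pred pair_law (\<lambda>x. hits_before N p q T (fst x) (snd x))"
  unfolding hits_before_def hits_in_def greaterThanAtMost_iff by measurable

lemma hurried_after_iff: "hurried_after N p q T \<omega> \<eta> \<longleftrightarrow>
  (\<exists>n. first_hit N p (snd \<omega>) n \<and> hurries N q {arrival (fst \<omega>) n<..T} \<eta>)"
  unfolding hurried_after_def hurries_def hits_in_def by auto

lemma prob_overtake_ge:
  fixes L N :: nat
  assumes L: "2 \<le> L" "L \<le> N"
  shows "cos (pi / L) ^ m * sin (pi / L) * \<P>(a in waits_law. \<tau> < arrival a m) / 4 *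
      pair_prob (hits_before N p q T)
    \<le> pair_prob (overtake N p q m \<tau> T)"
proof -
  let ?c = "cos (pi / L) ^ m * sin (pi / L) * \<P>(a in waits_law. \<tau> < arrival a m)"
  have c: "0 \<le> ?c" using cos_power_sin_nonneg[OF L(1)] by simp
  have 1: "1 / 4 * pair_prob (hits_before N p q T)
      \<le> pair_prob (hurried_after N p q T)"
  proof (rule pair_law_le_slices_snd[OF measurable_hits_before measurable_hurried_after])
    fix \<omega>
    show "ennreal (1 / 4) * emeasure driver_law {\<eta> \<in> space driver_law. hits_before N p q T \<omega> \<eta>}
        \<le> emeasure driver_law {\<eta> \<in> space driver_law. hurried_after N p q T \<omega> \<eta>}"
    proof (cases "\<exists>n. first_hit N p (snd \<omega>) n")
      case True
      then obtain n where n: "first_hit N p (snd \<omega>) n" by blast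
      then have "hits_before N p q T \<omega> \<eta> \<longleftrightarrow> hits_in N q {arrival (fst \<omega>) n<..T} \<eta>"
          "hurried_after N p q T \<omega> \<eta> \<longleftrightarrow> hurries N q {arrival (fst \<omega>) n<..T} \<eta>" for \<eta>
        unfolding hits_before_def hurried_after_iff using first_hit_unique[OF n] by blast+
      then show ?thesis using emeasure_hurries_ge[of "{arrival (fst \<omega>) n<..T}" N q] L by simp
    qed (simp add: hits_before_def)
  qed simp
  have 2: "?c * pair_prob (hurried_after N p q T)
      \<le> pair_prob (overtake N p q m \<tau> T)"
  proof (rule pair_law_le_slices_fst[OF measurable_hurried_after measurable_overtake _ c])
    fix \<eta>
    show "ennreal ?c * emeasure driver_law {\<omega> \<in> space driver_law. hurried_after N p q T \<omega> \<eta>}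
        \<le> emeasure driver_law {\<omega> \<in> space driver_law. overtake N p q m \<tau> T \<omega> \<eta>}"
    proof (cases "\<exists>k. (arrival (fst \<eta>) k \<le> T \<and> fst \<eta> k \<le> 1) \<and> (first_hit N q (snd \<eta>) k \<and> crosses N q (snd \<eta>) k)")
      case True
      then obtain k where k: "(arrival (fst \<eta>) k \<le> T \<and> fst \<eta> k \<le> 1) \<and> (first_hit N q (snd \<eta>) k \<and> crosses N q (snd \<eta>) k)"
        by blast
      then have "first_hit N q (snd \<eta>) k" by blast
      note uniq = first_hit_unique[OF this]
      have "hurried_after N p q T \<omega> \<eta> \<longleftrightarrow> hits_in N p {..<arrival (fst \<eta>) k} \<omega>"
          "overtake N p q m \<tau> T \<omega> \<eta> \<longleftrightarrow> lingers N p m \<tau> {..<arrival (fst \<eta>) k} \<omega>" for \<omega>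
        unfolding hurried_after_def overtake_def using k uniq by blast+
      then show ?thesis using emeasure_lingers_ge[of "{..<arrival (fst \<eta>) k}" L N m \<tau> p] L by simp
    next
      case False
      then have "\<not> hurried_after N p q T \<omega> \<eta>" for \<omega> by (auto simp: hurried_after_def)
      then show ?thesis by simp
    qed
  qed
  have "?c / 4 * pair_prob (hits_before N p q T)
      = ?c * (1 / 4 * pair_prob (hits_before N p q T))" by simp
  also have "\<dots> \<le> ?c * pair_prob (hurried_after N p q T)"
    by (rule mult_left_mono[OF 1 c])
  also note 2
  finally show ?thesis .
qed

text \<open>
  The first walk claims the endpoint \<open>z\<close> that it visits first, as the second one is not yet at the edge. The second
  walk is at the opposite endpoint upon its arrival or one step later, hence by the time \<open>T + 1\<close>, and up
  to then the first walk has kept away from it.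
\<close>

lemma overtake_imp_splits:
  assumes \<omega>: "regular \<omega>" and \<eta>: "regular \<eta>" and o: "overtake N p q m (T + 1) T \<omega> \<eta>"
  shows "splits N p q \<omega> \<eta>"
proof -
  obtain k where k: "arrival (fst \<eta>) k \<le> T" "fst \<eta> k \<le> 1" "first_hit N q (snd \<eta>) k" "crosses N q (snd \<eta>) k"
      and l: "lingers N p m (T + 1) {..<arrival (fst \<eta>) k} \<omega>"
    using o unfolding overtake_def by blast
  obtain n where n: "arrival (fst \<omega>) n < arrival (fst \<eta>) k" "T + 1 < arrival (fst \<omega>) (n + m) - arrival (fst \<omega>) n"
      "first_hit N p (snd \<omega>) n" "stays_away N p m (snd \<omega>) n"
    using l unfolding lingers_def by auto
  define z where "z = site N p (snd \<omega>) n"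
  have z: "z = 0 \<or> z = int N - 1" using n(3) by (auto simp: z_def first_hit_def at_edge_def)
  have "wins N p q \<omega> \<eta> z"
    unfolding wins_def
  proof (intro exI conjI allI impI)
    show "site N p (snd \<omega>) n = z" by (simp add: z_def)
    fix i assume "arrival (fst \<eta>) i \<le> arrival (fst \<omega>) n"
    then have "arrival (fst \<eta>) i < arrival (fst \<eta>) k" using n(1) by linarith
    then have "i < k" using arrival_le_iff[OF \<eta>, of k i] by linarith
    then have "\<not> at_edge N q (snd \<eta>) i" using k(3) by (simp add: first_hit_def)
    then show "site N q (snd \<eta>) i \<noteq> z" using z by (auto simp: at_edge_def)
  qed
  moreover have "wins N q p \<eta> \<omega> (int N - 1 - z)"
  proof -
    have "site N q (snd \<eta>) k = 0 \<or> site N q (snd \<eta>) k = int N - 1" using k(3) by (auto simp: first_hit_def at_edge_def)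
    then have "site N q (snd \<eta>) k = int N - 1 - z \<or> site N q (snd \<eta>) k = z" using z by auto
    then obtain i where i: "site N q (snd \<eta>) i = int N - 1 - z" "i = k \<or> i = Suc k"
      using k(4) unfolding crosses_def by auto
    have "arrival (fst \<eta>) i \<le> T + 1" using i(2) k(1,2) by (auto simp: arrival_Suc)
    moreover have "site N p (snd \<omega>) j \<noteq> int N - 1 - z" if j: "arrival (fst \<omega>) j \<le> T + 1" for j
    proof (cases "j < n")
      case True
      then have "\<not> at_edge N p (snd \<omega>) j" using n(3) by (simp add: first_hit_def)
      then show ?thesis using z by (auto simp: at_edge_def)
    next
      case False
      have "arrival (fst \<omega>) j < arrival (fst \<omega>) (n + m)"
        using j n(2) arrival_nonneg[OF \<omega>, of n] by linarith
      then have "j < n + m" using arrival_le_iff[OF \<omega>, of "n + m" j] by linarith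
      then obtain i where "j = n + i" "i \<le> m" using False by (metis add_le_cancel_left le_add_diff_inverse less_imp_le not_less)
      then show ?thesis using n(4) by (simp add: stays_away_def z_def)
    qed
    ultimately show ?thesis unfolding wins_def using i(1) by (meson order_trans)
  qed
  ultimately show ?thesis using z by (auto simp: splits_def)
qed

lemma overtake_disjoint:
  assumes "overtake N p q m \<tau> T \<omega> \<eta>" "overtake N q p m' \<tau>' T' \<eta> \<omega>"
  shows False
proof -
  obtain k n where 1: "first_hit N q (snd \<eta>) k" "first_hit N p (snd \<omega>) n" "arrival (fst \<omega>) n < arrival (fst \<eta>) k"
    using assms(1) unfolding overtake_def lingers_def by auto
  obtain k' n' where 2: "first_hit N p (snd \<omega>) k'" "first_hit N q (snd \<eta>) n'" "arrival (fst \<eta>) n' < arrival (fst \<omega>) k'"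
    using assms(2) unfolding overtake_def lingers_def by auto
  have "k = n'" "n = k'" using first_hit_unique 1 2 by blast+
  then show False using 1(3) 2(3) by simp
qed

definition tie :: "nat \<Rightarrow> int \<Rightarrow> int \<Rightarrow>
    driver \<Rightarrow> driver \<Rightarrow> bool" where
  "tie N p q \<omega> \<eta> \<longleftrightarrow> (\<exists>k. first_hit N q (snd \<eta>) k \<and> hits_in N p {arrival (fst \<eta>) k} \<omega>)"

lemma measurable_tie: "Measurable.pred pair_law (\<lambda>x. tie N p q (fst x) (snd x))"
  unfolding tie_def hits_in_def singleton_iff by measurable

text \<open>
  The first walk does not start at the edge, so its first visit happens at a jump time, and jump times have densities.
  Two walks that both start at the edge would tie at time \<open>0\<close>.
\<close>

lemma prob_tie:
  assumes p: "0 < edge_dist N p" "0 \<le> p" "p < int N"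
  shows "pair_prob (tie N p q) = 0"
proof -
  have null: "emeasure driver_law {\<omega> \<in> space driver_law. hits_in N p {t} \<omega>} = 0" for t
  proof -
    have zero: "\<P>(a in waits_law. arrival a n \<in> {t}) * \<P>(s in steps_law. first_hit N p s n) = 0" for n
    proof (cases n)
      case 0
      have "p \<noteq> 0" "p \<noteq> int N - 1" using p by (auto simp: edge_dist_def)
      then have "\<not> first_hit N p s n" for s using p 0 by (simp add: first_hit_def at_edge_def site_def)
      then show ?thesis by simp
    next
      case (Suc j)
      then show ?thesis using prob_arrival_eq_0[of j t] by simp
    qed
    have "{t} \<in> sets borel" by simp
    then show ?thesis by (simp only: emeasure_hits_in zero ennreal_0 suminf_zero)
  qed
  have "1 * pair_prob (tie N p q) \<le> \<P>(x in pair_law. False)"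
  proof (rule pair_law_le_slices_fst[where Q = "\<lambda>_ _. False", OF measurable_tie])
    fix \<eta>
    show "ennreal 1 * emeasure driver_law {\<omega> \<in> space driver_law. tie N p q \<omega> \<eta>}
        \<le> emeasure driver_law {\<omega> \<in> space driver_law. False}"
    proof (cases "\<exists>k. first_hit N q (snd \<eta>) k")
      case True
      then obtain k where k: "first_hit N q (snd \<eta>) k" by blast
      then have "tie N p q \<omega> \<eta> \<longleftrightarrow> hits_in N p {arrival (fst \<eta>) k} \<omega>" for \<omega>
        unfolding tie_def using first_hit_unique[OF k] by blast
      then show ?thesis by (simp only: null mult_zero_right zero_le)
    next
      case False
      then have "{\<omega> \<in> space driver_law. tie N p q \<omega> \<eta>} = {}" by (auto simp: tie_def)
      then show ?thesis by (simp only: emeasure_empty mult_zero_right zero_le)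
    qed
  qed simp_all
  also have "\<P>(x in pair_law. False) = 0" by simp
  finally have "pair_prob (tie N p q) \<le> 0" unfolding mult_1 .
  then show ?thesis by (intro antisym measure_nonneg)
qed

lemma prob_hits_in_ge:
  assumes p: "0 \<le> p" "p < int N" and n: "4 \<le> n" "4 * (real (edge_dist N p))\<^sup>2 \<le> real n + 1" and T: "2 * real n \<le> T"
  shows "1 / 4 \<le> \<P>(\<omega> in driver_law. hits_in N p {..T} \<omega>)"
proof -
  let ?S = "{s \<in> space steps_law. \<exists>j\<le>n. at_edge N p s j}" and ?W = "{a \<in> space waits_law. arrival a n < T}"
  have S: "?S \<in> sets steps_law" and W: "?W \<in> sets waits_law" by measurable
  have "1 / 2 \<le> measure steps_law ?S"
  proof -
    have "2 * real (edge_dist N p) \<le> sqrt (real n + 1)"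
      using n by (intro real_le_rsqrt) (simp add: power_mult_distrib)
    then have "real (edge_dist N p) / sqrt (real n + 1) \<le> 1 / 2" by (simp add: field_simps)
    then show ?thesis using prob_hit_ge[OF p, of n] by linarith
  qed
  moreover have "1 / 2 \<le> measure waits_law ?W"
  proof -
    have "{a \<in> space waits_law. 2 * real n \<le> arrival a n} \<in> sets waits_law" by measurable
    from waits.prob_compl[OF this]
    have "1 - \<P>(a in waits_law. 2 * real n \<le> arrival a n) = measure waits_law {a \<in> space waits_law. arrival a n < 2 * real n}"
      by (simp add: Diff_eq Compl_eq not_le)
    also have "\<dots> \<le> measure waits_law ?W"
      using T by (intro waits.finite_measure_mono W) auto
    finally have "1 - \<P>(a in waits_law. 2 * real n \<le> arrival a n) \<le> measure waits_law ?W" .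
    moreover have "\<P>(a in waits_law. 2 * real n \<le> arrival a n) \<le> 1 / real n"
      using n by (intro prob_arrival_ge_double) auto
    moreover have "1 / real n \<le> 1 / 2" using n by (intro divide_left_mono) auto
    ultimately show ?thesis by linarith
  qed
  ultimately have "1 / 2 * (1 / 2) \<le> measure waits_law ?W * measure steps_law ?S"
    by (intro mult_mono) auto
  also have "\<dots> = measure driver_law (?W \<times> ?S)"
    unfolding driver_law_def measure_def steps.emeasure_pair_measure_Times[OF W S] by (simp add: enn2real_mult)
  also have "\<dots> \<le> \<P>(\<omega> in driver_law. hits_in N p {..T} \<omega>)"
  proof (rule driver.finite_measure_mono_AE)
    show "AE \<omega> in driver_law. \<omega> \<in> ?W \<times> ?S \<longrightarrow> \<omega> \<in> {\<omega> \<in> space driver_law. hits_in N p {..T} \<omega>}"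
      using AE_regular
    proof eventually_elim
      case (elim \<omega>)
      show ?case
      proof
        assume "\<omega> \<in> ?W \<times> ?S"
        then have a: "arrival (fst \<omega>) n < T" "\<exists>j<Suc n. at_edge N p (snd \<omega>) j"
          by (auto simp: less_Suc_eq_le)
        from a(2) obtain j where j: "j < Suc n" "first_hit N p (snd \<omega>) j"
          unfolding ex_first_hit_iff[symmetric] by blast
        then have "arrival (fst \<omega>) j \<le> arrival (fst \<omega>) n" using arrival_le_iff[OF elim] by simp
        then show "\<omega> \<in> {\<omega> \<in> space driver_law. hits_in N p {..T} \<omega>}"
          using a(1) j(2) by (auto simp: hits_in_def intro!: exI[of _ j])
      qed
    qed
    show "{\<omega> \<in> space driver_law. hits_in N p {..T} \<omega>} \<in> sets driver_law"
      unfolding hits_in_def atMost_iff by measurable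
  qed
  finally show ?thesis by simp
qed

section \<open>The probability that an edge is split\<close>

lemma measurable_wins:
  assumes [measurable]: "f \<in> measurable M driver_law" "g \<in> measurable M driver_law"
  shows "Measurable.pred M (\<lambda>x. wins N p q (f x) (g x) z)"
proof -
  note measurable_site [measurable]
  show ?thesis unfolding wins_def by measurable
qed

lemma measurable_splits: "Measurable.pred pair_law (\<lambda>x. splits N p q (fst x) (snd x))"
proof -
  have [measurable]: "Measurable.pred pair_law (\<lambda>x. wins N p q (fst x) (snd x) z)"
      "Measurable.pred pair_law (\<lambda>x. wins N q p (snd x) (fst x) z)" for z
    by (rule measurable_wins[OF measurable_fst measurable_snd], rule measurable_wins[OF measurable_snd measurable_fst])
  show ?thesis unfolding splits_def by measurable
qed

lemma prob_splits_commute: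
  "pair_prob (splits N p q) = pair_prob (splits N q p)"
  using pair_law_swap[OF measurable_splits, of N q p] by (simp only: splits_commute[of N p q])

lemma AE_pair_regular: "AE x in pair_law. regular (fst x) \<and> regular (snd x)"
proof (rule two_drivers.AE_pair_measure)
  have "Measurable.pred pair_law (\<lambda>x. regular (fst x) \<and> regular (snd x))" by measurable
  then show "{x \<in> space pair_law. regular (fst x) \<and> regular (snd x)} \<in> sets pair_law" unfolding pred_def .
  show "AE \<omega> in driver_law. AE \<eta> in driver_law. regular (fst (\<omega>, \<eta>)) \<and> regular (snd (\<omega>, \<eta>))"
    using AE_regular
  proof eventually_elim
    case (elim \<omega>)
    show ?case by (rule AE_mp[OF AE_regular]) (use elim in auto)
  qed
qed

lemma prob_splits_le:
  assumes p: "0 \<le> p" "p < int N" and q: "0 \<le> q" "q < int N"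
  shows "pair_prob (splits N p q)
    \<le> 440 / (real (max (edge_dist N p) (edge_dist N q)) + 1)"
proof -
  let ?r = "real (max (edge_dist N p) (edge_dist N q))"
  let ?A = "{x \<in> space pair_law. caught N p q (fst x) (snd x)}" and ?B = "{x \<in> space pair_law. caught N q p (snd x) (fst x)}"
  have A: "?A \<in> sets pair_law" by (rule measurable_caught[unfolded pred_def]) measurable
  have B: "?B \<in> sets pair_law" by (rule measurable_caught[unfolded pred_def]) measurable
  have one: "pair_prob (caught N a b) \<le> 220 / (real (max (edge_dist N a) (edge_dist N b)) + 1)"
    if "0 \<le> a" "a < int N" "0 \<le> b" "b < int N" for a b
    using prob_caught_le[OF that] by (auto simp: max_def field_simps)
  have "measure pair_law ?A \<le> 220 / (?r + 1)" using one[OF p q] .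
  moreover have "measure pair_law ?B \<le> 220 / (?r + 1)"
    using one[OF q p] pair_law_swap[OF measurable_caught[OF measurable_fst measurable_snd], of N q p]
    by (simp add: max.commute)
  moreover have "pair_prob (splits N p q) \<le> measure pair_law (?A \<union> ?B)"
  proof (rule two_drivers.P.finite_measure_mono_AE)
    show "AE x in pair_law. x \<in> {x \<in> space pair_law. splits N p q (fst x) (snd x)} \<longrightarrow> x \<in> ?A \<union> ?B"
      using AE_pair_regular by eventually_elim (use splits_imp_caught in auto)
  qed (use A B in \<open>rule sets.Un\<close>)
  moreover have "measure pair_law (?A \<union> ?B) \<le> measure pair_law ?A + measure pair_law ?B"
    by (rule measure_Un_le[OF A B])
  ultimately show ?thesis by simp
qed

text \<open>
  The product of the factors in \<open>prob_splits_ge_aux\<close>: \<open>exp (- 360) / 3\<close> from the survival probability,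
  \<open>1 / 2\<close> from the duration of the surviving jumps, \<open>1 / 4\<close> for hurrying, and \<open>(1 / 4)\<^sup>2\<close> for both walks to arrive
  in time.
\<close>

definition split_const :: real where
  "split_const = exp (- 360) / 384"

text \<open>
  \<open>L\<close> is comparable to \<open>r + 1\<close>, so over a number of steps of order \<open>L\<^sup>2\<close> the eigenvalue \<open>cos (pi / L)\<close> loses only a
  constant factor, and \<open>sin (pi / L)\<close> is of order \<open>1 / L\<close>.
\<close>

lemma stay_const_ge:
  fixes L r :: nat
  assumes L: "3 \<le> L" "r + 1 \<le> L" "L \<le> r + 3"
  shows "exp (- 360) / (3 * (real r + 1)) \<le> cos (pi / L) ^ (18 * (r + 1)\<^sup>2) * sin (pi / L)"
proof -
  let ?m = "18 * (r + 1)\<^sup>2"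
  have sq: "(pi / L)\<^sup>2 \<le> 10 / (real L)\<^sup>2"
    using pi_square_le by (simp add: power_divide divide_right_mono)
  have "(3::real)\<^sup>2 \<le> (real L)\<^sup>2" using L by (intro power_mono) auto
  then have "10 / (real L)\<^sup>2 \<le> 10 / 9" using L by (intro divide_left_mono) auto
  then have "exp (- 2 * (pi / L)\<^sup>2) \<le> cos (pi / L)" using sq by (intro cos_ge_exp) simp
  then have "exp (- 2 * (pi / L)\<^sup>2) ^ ?m \<le> cos (pi / L) ^ ?m" by (intro power_mono) auto
  moreover have "exp (- 360) \<le> exp (- 2 * (pi / L)\<^sup>2) ^ ?m"
  proof -
    have "real ?m * (pi / L)\<^sup>2 \<le> real ?m * (10 / (real L)\<^sup>2)" using sq by (intro mult_left_mono) auto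
    also have "\<dots> = 180 * ((real r + 1)\<^sup>2 / (real L)\<^sup>2)" by (simp add: add.commute)
    also have "(real r + 1)\<^sup>2 / (real L)\<^sup>2 \<le> 1"
      using L by (simp add: divide_le_eq_1 power_mono)
    finally have "real ?m * (- 2 * (pi / L)\<^sup>2) \<ge> - 360" by simp
    then have "exp (- 360) \<le> exp (real ?m * (- 2 * (pi / L)\<^sup>2))" by (simp only: exp_le_cancel_iff)
    then show ?thesis by (simp only: exp_of_nat_mult)
  qed
  ultimately have cos: "exp (- 360) \<le> cos (pi / L) ^ ?m" by linarith
  have sin: "1 / (3 * (real r + 1)) \<le> sin (pi / L)"
  proof -
    have "1 / (3 * (real r + 1)) \<le> 1 / real L" using L by (intro divide_left_mono) auto
    also have "\<dots> \<le> (pi / L) / 2" using pi_gt3 L by (simp add: field_simps)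
    also have "\<dots> \<le> sin (pi / L)" using L by (intro sin_ge_half divide_left_mono) auto
    finally show ?thesis .
  qed
  have "exp (- 360) * (1 / (3 * (real r + 1))) \<le> cos (pi / L) ^ ?m * sin (pi / L)"
    by (intro mult_mono cos sin order_trans[OF exp_ge_zero cos]) simp
  then show ?thesis by simp
qed

lemma prob_hits_before_add_ge:
  assumes p: "0 \<le> p" "p < int N" and dist: "0 < edge_dist N p"
  shows "\<P>(\<omega> in driver_law. hits_in N p {..T} \<omega>) * \<P>(\<eta> in driver_law. hits_in N q {..T} \<eta>)
    \<le> pair_prob (hits_before N p q T) + pair_prob (hits_before N q p T)"
proof -
  let ?H = "\<lambda>p. {\<omega> \<in> space driver_law. hits_in N p {..T} \<omega>}"
  let ?A = "{x \<in> space pair_law. hits_before N p q T (fst x) (snd x)}"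
  let ?B = "{x \<in> space pair_law. hits_before N q p T (snd x) (fst x)}"
  let ?C = "{x \<in> space pair_law. tie N p q (fst x) (snd x)}"
  have H: "?H p \<in> sets driver_law" for p unfolding hits_in_def atMost_iff by measurable
  have A: "?A \<in> sets pair_law" using measurable_hits_before unfolding pred_def .
  have B: "?B \<in> sets pair_law" unfolding hits_before_def hits_in_def greaterThanAtMost_iff by measurable
  have C: "?C \<in> sets pair_law" using measurable_tie unfolding pred_def .
  have "measure driver_law (?H p) * measure driver_law (?H q) = measure pair_law (?H p \<times> ?H q)"
    unfolding measure_def by (simp only: driver.emeasure_pair_measure_Times[OF H H] enn2real_mult)
  also have "\<dots> \<le> measure pair_law ((?A \<union> ?B) \<union> ?C)"
  proof (rule two_drivers.P.finite_measure_mono)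
    show "?H p \<times> ?H q \<subseteq> (?A \<union> ?B) \<union> ?C"
    proof
      fix x assume "x \<in> ?H p \<times> ?H q"
      then have 1: "hits_in N p {..T} (fst x)" and 2: "hits_in N q {..T} (snd x)" by auto
      obtain n where n: "arrival (fst (fst x)) n \<le> T" "first_hit N p (snd (fst x)) n"
        using 1 by (auto simp: hits_in_def)
      obtain k where k: "arrival (fst (snd x)) k \<le> T" "first_hit N q (snd (snd x)) k"
        using 2 by (auto simp: hits_in_def)
      consider "arrival (fst (fst x)) n < arrival (fst (snd x)) k" | "arrival (fst (snd x)) k < arrival (fst (fst x)) n"
        | "arrival (fst (fst x)) n = arrival (fst (snd x)) k" by linarith
      then have "hits_before N p q T (fst x) (snd x) \<or> hits_before N q p T (snd x) (fst x) \<or> tie N p q (fst x) (snd x)"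
      proof cases
        case 1
        then show ?thesis using n k by (auto simp: hits_before_def hits_in_def)
      next
        case 2
        then show ?thesis using n k by (auto simp: hits_before_def hits_in_def)
      next
        case 3
        then show ?thesis using n(2) k(2) unfolding tie_def hits_in_def by blast
      qed
      then show "x \<in> (?A \<union> ?B) \<union> ?C" by auto
    qed
  qed (intro sets.Un A B C)
  also have "\<dots> \<le> measure pair_law (?A \<union> ?B) + measure pair_law ?C"
    by (intro measure_Un_le sets.Un A B C)
  also have "measure pair_law ?C = 0" by (rule prob_tie[OF dist p])
  also have "measure pair_law (?A \<union> ?B) \<le> measure pair_law ?A + measure pair_law ?B"
    by (rule measure_Un_le[OF A B])
  also have "measure pair_law ?B = pair_prob (hits_before N q p T)"
    by (rule pair_law_swap[OF measurable_hits_before])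
  finally show ?thesis by simp
qed

lemma prob_splits_ge_overtakes:
  "pair_prob (overtake N p q m (T + 1) T) + pair_prob (overtake N q p m (T + 1) T)
    \<le> pair_prob (splits N p q)"
proof -
  let ?A = "{x \<in> space pair_law. overtake N p q m (T + 1) T (fst x) (snd x)}"
  let ?B = "{x \<in> space pair_law. overtake N q p m (T + 1) T (snd x) (fst x)}"
  have A: "?A \<in> sets pair_law" using measurable_overtake unfolding pred_def .
  have B: "?B \<in> sets pair_law" unfolding overtake_def lingers_def lessThan_iff by measurable
  have "measure pair_law ?B = pair_prob (overtake N q p m (T + 1) T)"
    by (rule pair_law_swap[OF measurable_overtake])
  moreover have "measure pair_law ?A + measure pair_law ?B = measure pair_law (?A \<union> ?B)"
    using overtake_disjoint by (intro two_drivers.P.finite_measure_Union[symmetric] A B) auto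
  moreover have "measure pair_law (?A \<union> ?B) \<le> pair_prob (splits N p q)"
  proof (rule two_drivers.P.finite_measure_mono_AE)
    show "AE x in pair_law. x \<in> ?A \<union> ?B \<longrightarrow> x \<in> {x \<in> space pair_law. splits N p q (fst x) (snd x)}"
      using AE_pair_regular
    proof eventually_elim
      case (elim x)
      then show ?case
        using overtake_imp_splits[of "fst x" "snd x" N p q m T] overtake_imp_splits[of "snd x" "fst x" N q p m T]
          splits_commute[of N p q "fst x" "snd x"] by auto
    qed
    show "{x \<in> space pair_law. splits N p q (fst x) (snd x)} \<in> sets pair_law"
      using measurable_splits unfolding pred_def .
  qed
  ultimately show ?thesis by simp
qed

text \<open>
  Each walk reaches the edge within \<open>n\<close> jumps with probability at least \<open>1 / 2\<close>, and \<open>n\<close> jumps rarely take longer than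
  \<open>T = 2 n\<close>. The \<open>m\<close> jumps of the lingering walk rarely take less than \<open>m / 2 = 9 (r + 1)\<^sup>2\<close>, which is at least
  \<open>T + 1 = 8 (r + 1)\<^sup>2 + 1\<close>.
\<close>

lemma prob_splits_ge_aux:
  assumes N: "3 \<le> N" and p: "0 \<le> p" "p < int N" and q: "0 \<le> q" "q < int N" and dist: "0 < edge_dist N p"
  shows "split_const / (real (max (edge_dist N p) (edge_dist N q)) + 1)
    \<le> pair_prob (splits N p q)"
proof -
  define r where "r = max (edge_dist N p) (edge_dist N q)"
  define n where "n = 4 * (r + 1)\<^sup>2"
  define m where "m = 18 * (r + 1)\<^sup>2"
  define T where "T = 2 * real n"
  define L where "L = min N (r + 3)"
  define \<delta> where "\<delta> = \<P>(a in waits_law. T + 1 < arrival a m)"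
  \<comment> \<open>Hence \<open>L\<close> is at least \<open>r + 1\<close> although it is capped at \<open>N\<close>.\<close>
  have r2: "2 * r \<le> N" using p q unfolding r_def edge_dist_def by auto
  have L: "3 \<le> L" "r + 1 \<le> L" "L \<le> r + 3" "2 \<le> L" "L \<le> N" using N r2 unfolding L_def by auto
  have r1: "1 \<le> (real r + 1)\<^sup>2" by (simp add: one_le_power)
  have n4: "4 \<le> n" unfolding n_def by simp
  have near: "(real (edge_dist N a))\<^sup>2 \<le> (real r + 1)\<^sup>2" if "a = p \<or> a = q" for a
    using that unfolding r_def by (intro power_mono) auto
  have "real n = 4 * (real r + 1)\<^sup>2" unfolding n_def by (simp add: add.commute)
  then have close: "4 * (real (edge_dist N a))\<^sup>2 \<le> real n + 1" if "a = p \<or> a = q" for a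
    using near[OF that] by linarith
  have both: "1 / 16 \<le> pair_prob (hits_before N p q T) + pair_prob (hits_before N q p T)"
  proof -
    have "1 / 4 \<le> \<P>(\<omega> in driver_law. hits_in N p {..T} \<omega>)"
      by (rule prob_hits_in_ge[OF p n4 close]) (auto simp: T_def)
    moreover have "1 / 4 \<le> \<P>(\<omega> in driver_law. hits_in N q {..T} \<omega>)"
      by (rule prob_hits_in_ge[OF q n4 close]) (auto simp: T_def)
    ultimately have "1 / 4 * (1 / 4) \<le> \<P>(\<omega> in driver_law. hits_in N p {..T} \<omega>) * \<P>(\<omega> in driver_law. hits_in N q {..T} \<omega>)"
      by (intro mult_mono) auto
    then show ?thesis using prob_hits_before_add_ge[OF p dist, of T q] by simp
  qed
  have delta: "1 / 2 \<le> \<delta>"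
  proof -
    have m: "real m = 18 * (real r + 1)\<^sup>2" "0 < m" unfolding m_def by (auto simp: add.commute)
    have "{a \<in> space waits_law. arrival a m \<le> real m / 2} \<in> sets waits_law" by measurable
    from waits.prob_compl[OF this]
    have "1 - \<P>(a in waits_law. arrival a m \<le> real m / 2) = \<P>(a in waits_law. real m / 2 < arrival a m)"
      by (simp add: Diff_eq Compl_eq not_le)
    also have "\<dots> \<le> \<delta>"
      unfolding \<delta>_def
    proof (rule waits.finite_measure_mono)
      have "T + 1 \<le> real m / 2" using r1 by (simp add: T_def n_def m add.commute)
      then show "{a \<in> space waits_law. real m / 2 < arrival a m} \<subseteq> {a \<in> space waits_law. T + 1 < arrival a m}" by auto
      show "{a \<in> space waits_law. T + 1 < arrival a m} \<in> sets waits_law" by measurable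
    qed
    finally have "1 - \<P>(a in waits_law. arrival a m \<le> real m / 2) \<le> \<delta>" .
    moreover have "4 / real m \<le> 4 / 18" using r1 m by (intro divide_left_mono) auto
    ultimately show ?thesis using prob_arrival_le_half[OF m(2)] by linarith
  qed
  let ?c = "cos (pi / L) ^ m * sin (pi / L)"
  have c: "exp (- 360) / (3 * (real r + 1)) \<le> ?c" unfolding m_def by (rule stay_const_ge[OF L(1-3)])
  have "split_const / (real r + 1) = exp (- 360) / (3 * (real r + 1)) * (1 / 2) / 4 * (1 / 16)"
    by (simp add: split_const_def field_simps)
  also have "\<dots> \<le> ?c * \<delta> / 4 * (1 / 16)"
    using c delta by (intro mult_right_mono divide_right_mono mult_mono) (auto intro: order_trans[rotated])
  also have "\<dots> \<le> ?c * \<delta> / 4 * (pair_prob (hits_before N p q T) + pair_prob (hits_before N q p T))"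
  proof (rule mult_left_mono[OF both])
    have "0 \<le> exp (- 360) / (3 * (real r + 1))" by simp
    then have "0 \<le> ?c" using c by linarith
    then show "0 \<le> ?c * \<delta> / 4" using delta by simp
  qed
  also have "\<dots> \<le> pair_prob (splits N p q)"
    using prob_overtake_ge[OF L(4,5), of m "T + 1" p q T] prob_overtake_ge[OF L(4,5), of m "T + 1" q p T]
      prob_splits_ge_overtakes[of N p q m T] unfolding \<delta>_def by (simp only: distrib_left)
  finally show ?thesis unfolding r_def .
qed

lemma prob_splits_ge:
  assumes N: "3 \<le> N" and p: "0 \<le> p" "p < int N" and q: "0 \<le> q" "q < int N"
    and dist: "0 < edge_dist N p \<or> 0 < edge_dist N q"
  shows "split_const / (real (max (edge_dist N p) (edge_dist N q)) + 1)
    \<le> pair_prob (splits N p q)"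
  using dist
proof
  assume "0 < edge_dist N q"
  from prob_splits_ge_aux[OF N q p this] show ?thesis
    unfolding prob_splits_commute[of N p q] by (simp only: max.commute)
qed (rule prob_splits_ge_aux[OF N p q])

section \<open>The sum over all edges\<close>

lemma prob_interface_edge:
  assumes i: "i \<in> cycle_verts N"
  shows "\<P>(\<omega> in two_walks_law. cycle_edge N i \<in> interface_edges N (walk N x (fst \<omega>)) (walk N y (snd \<omega>)))
    = pair_prob (splits N ((x - i) mod int N) ((y - i) mod int N))"
proof -
  let ?J = "\<lambda>\<omega>. cycle_edge N i \<in> interface_edges N (walk N x (fst \<omega>)) (walk N y (snd \<omega>))"
  let ?z = "\<lambda>(p, q). (zip_seq p, zip_seq q)"
  have z: "?z \<in> measurable pair_law two_walks_law"
    unfolding two_walks_law_def by measurable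
  have E: "{\<omega> \<in> space two_walks_law. ?J \<omega>} \<in> sets two_walks_law"
    using measurable_mem_interface_edges[OF i] unfolding pred_def .
  have pred: "Measurable.pred pair_law (\<lambda>\<omega>. ?J (?z \<omega>))"
    by (rule measurable_compose[OF z measurable_mem_interface_edges[OF i]])
  have "measure two_walks_law {\<omega> \<in> space two_walks_law. ?J \<omega>}
      = measure (distr pair_law two_walks_law ?z) {\<omega> \<in> space two_walks_law. ?J \<omega>}"
    by (subst two_walks_law_eq[symmetric]) (rule refl)
  also have "\<dots> = measure pair_law (?z -` {\<omega> \<in> space two_walks_law. ?J \<omega>} \<inter> space pair_law)"
    by (rule measure_distr[OF z E])
  also have "?z -` {\<omega> \<in> space two_walks_law. ?J \<omega>} \<inter> space pair_law = {\<omega> \<in> space pair_law. ?J (?z \<omega>)}"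
    using measurable_space[OF z] by auto
  also have "measure pair_law \<dots> = pair_prob (splits N ((x - i) mod int N) ((y - i) mod int N))"
  proof (rule two_drivers.P.prob_eq_AE)
    show "AE \<omega> in pair_law. ?J (?z \<omega>) \<longleftrightarrow> splits N ((x - i) mod int N) ((y - i) mod int N) (fst \<omega>) (snd \<omega>)"
      using AE_pair_regular
    proof eventually_elim
      case (elim \<omega>)
      then show ?case
        using interface_zip_seq_iff[OF _ _ i, of "fst \<omega>" "snd \<omega>" x y] by (simp add: case_prod_unfold)
    qed
    show "{\<omega> \<in> space pair_law. ?J (?z \<omega>)} \<in> sets pair_law" using pred unfolding pred_def .
    show "{\<omega> \<in> space pair_law. splits N ((x - i) mod int N) ((y - i) mod int N) (fst \<omega>) (snd \<omega>)} \<in> sets pair_law"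
      using measurable_splits unfolding pred_def .
  qed
  finally show ?thesis .
qed

lemma expected_interface_eq_sum:
  "expected_interface N x y = (\<Sum>e\<in>cycle_edges N.
    \<P>(\<omega> in two_walks_law. e \<in> interface_edges N (walk N x (fst \<omega>)) (walk N y (snd \<omega>))))"
proof -
  interpret two_walks: prob_space two_walks_law by (rule prob_space_two_walks_law)
  let ?I = "\<lambda>\<omega>. interface_edges N (walk N x (fst \<omega>)) (walk N y (snd \<omega>))"
  let ?E = "\<lambda>e. {\<omega> \<in> space two_walks_law. e \<in> ?I \<omega>}"
  have fin: "finite (cycle_edges N)" by (simp add: cycle_edges_eq finite_cycle_verts)
  have E: "?E e \<in> sets two_walks_law" if "e \<in> cycle_edges N" for e
    using that measurable_mem_interface_edges unfolding cycle_edges_eq pred_def by blast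
  have "real (card (?I \<omega>)) = (\<Sum>e\<in>cycle_edges N. indicator (?E e) \<omega>)" if "\<omega> \<in> space two_walks_law" for \<omega>
  proof -
    have "?I \<omega> = {e \<in> cycle_edges N. e \<in> ?I \<omega>}" by (auto simp: interface_edges_def)
    then have "real (card (?I \<omega>)) = real (card {e \<in> cycle_edges N. e \<in> ?I \<omega>})" by simp
    also have "\<dots> = (\<Sum>e\<in>cycle_edges N. if e \<in> ?I \<omega> then 1 else 0)"
      using fin by (simp add: sum.If_cases Int_def)
    finally show ?thesis using that by (simp add: indicator_def of_bool_def)
  qed
  then have "expected_interface N x y = (\<integral>\<omega>. (\<Sum>e\<in>cycle_edges N. indicator (?E e) \<omega>) \<partial>two_walks_law)"
    unfolding expected_interface_def by (intro Bochner_Integration.integral_cong) auto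
  also have "\<dots> = (\<Sum>e\<in>cycle_edges N. \<integral>\<omega>. indicator (?E e) \<omega> \<partial>two_walks_law)"
    using E by (intro Bochner_Integration.integral_sum integrable_indicator) (auto simp: two_walks.emeasure_finite less_top[symmetric])
  also have "\<dots> = (\<Sum>e\<in>cycle_edges N. measure two_walks_law (?E e))"
    by (intro sum.cong refl) (simp add: Int_def conj_commute)
  finally show ?thesis .
qed

definition split_prob :: "nat \<Rightarrow> int \<Rightarrow> int \<Rightarrow> int \<Rightarrow> real" where
  "split_prob N x y i = pair_prob (splits N ((x - i) mod int N) ((y - i) mod int N))"

lemma expected_interface_le:
  "expected_interface N x y \<le> (\<Sum>i\<in>cycle_verts N. split_prob N x y i)"
proof -
  have "expected_interface N x y \<le> (\<Sum>i\<in>cycle_verts N.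
      \<P>(\<omega> in two_walks_law. cycle_edge N i \<in> interface_edges N (walk N x (fst \<omega>)) (walk N y (snd \<omega>))))"
    unfolding expected_interface_eq_sum cycle_edges_eq
    by (rule sum_image_le[OF finite_cycle_verts, unfolded o_def]) simp
  then show ?thesis by (simp add: prob_interface_edge split_prob_def)
qed

lemma inj_on_cycle_edge:
  assumes "3 \<le> N"
  shows "inj_on (cycle_edge N) (cycle_verts N)"
proof (rule inj_onI)
  fix i j assume i: "i \<in> cycle_verts N" and j: "j \<in> cycle_verts N" and eq: "cycle_edge N i = cycle_edge N j"
  show "i = j"
  proof (rule ccontr)
    assume "i \<noteq> j"
    then have "i = (j - 1) mod int N" "j = (i - 1) mod int N"
      using eq unfolding cycle_edge_def doubleton_eq_iff by auto
    then have "j mod int N = (j - 2) mod int N"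
      by (metis (no_types, opaque_lifting) diff_diff_eq mod_diff_left_eq mod_mod_trivial one_add_one)
    then have "int N dvd 2" by (simp add: mod_eq_dvd_iff)
    then show False using assms zdvd_imp_le[of "int N" 2] by simp
  qed
qed

lemma expected_interface_eq:
  assumes "3 \<le> N"
  shows "expected_interface N x y = (\<Sum>i\<in>cycle_verts N. split_prob N x y i)"
  unfolding expected_interface_eq_sum cycle_edges_eq
  by (simp add: sum.reindex[OF inj_on_cycle_edge[OF assms]] prob_interface_edge split_prob_def)

lemma split_prob_le_expected_interface:
  assumes "i \<in> cycle_verts N"
  shows "split_prob N x y i \<le> expected_interface N x y"
proof -
  have "split_prob N x y i = \<P>(\<omega> in two_walks_law. cycle_edge N i \<in> interface_edges N (walk N x (fst \<omega>)) (walk N y (snd \<omega>)))"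
    using prob_interface_edge[OF assms] by (simp add: split_prob_def)
  also have "\<dots> \<le> expected_interface N x y"
    unfolding expected_interface_eq_sum
    using assms by (intro member_le_sum) (auto simp: cycle_edges_eq finite_cycle_verts)
  finally show ?thesis .
qed

lemma cycle_adj_mod:
  assumes "(u, v) \<in> cycle_adj N"
  shows "\<exists>e. (e = 1 \<or> e = - 1) \<and> v = (u + e) mod int N"
proof -
  obtain n where n: "n \<in> cycle_verts N" "{u, v} = {(n - 1) mod int N, n}"
    using assms unfolding cycle_adj_def cycle_edges_def by blast
  have "n = n mod int N" using n by (simp add: cycle_verts_def)
  consider "u = (n - 1) mod int N" "v = n" | "u = n" "v = (n - 1) mod int N"
    using n(2) unfolding doubleton_eq_iff by blast
  then show ?thesis
  proof cases
    case 1
    then have "v = (u + 1) mod int N" using \<open>n = n mod int N\<close> by (simp add: mod_simps)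
    then show ?thesis by blast
  next
    case 2
    then have "v = (u + - 1) mod int N" by simp
    then show ?thesis by blast
  qed
qed

lemma cycle_path_mod:
  "(u, v) \<in> cycle_adj N ^^ k \<Longrightarrow> \<exists>s. \<bar>s\<bar> \<le> int k \<and> v mod int N = (u + s) mod int N"
proof (induction k arbitrary: v)
  case 0
  then show ?case by (intro exI[of _ 0]) simp
next
  case (Suc k)
  then obtain w where w: "(u, w) \<in> cycle_adj N ^^ k" "(w, v) \<in> cycle_adj N" by auto
  obtain s where s: "\<bar>s\<bar> \<le> int k" "w mod int N = (u + s) mod int N" using Suc.IH[OF w(1)] by blast
  obtain e where e: "e = 1 \<or> e = - 1" "v = (w + e) mod int N" using cycle_adj_mod[OF w(2)] by blast
  have "v mod int N = (w mod int N + e) mod int N" using e(2) by (simp add: mod_simps)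
  also have "\<dots> = (u + (s + e)) mod int N" unfolding s(2) by (simp add: mod_simps add.assoc)
  finally have "v mod int N = (u + (s + e)) mod int N" .
  moreover have "\<bar>s + e\<bar> \<le> int (Suc k)" using s(1) e(1) by auto
  ultimately show ?case by blast
qed

lemma cycle_path_exists:
  assumes u: "u \<in> cycle_verts N" and e: "e = 1 \<or> e = - 1"
  shows "(u, (u + e * int k) mod int N) \<in> cycle_adj N ^^ k"
proof (induction k)
  case 0
  then show ?case using u by (simp add: cycle_verts_def)
next
  case (Suc k)
  have N: "0 < N" using u by (auto simp: cycle_verts_def)
  let ?a = "(u + e * int k) mod int N" and ?b = "(u + e * int (Suc k)) mod int N"
  have verts: "?a \<in> cycle_verts N" "?b \<in> cycle_verts N" using N by (auto simp: cycle_verts_def)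
  have edge: "cycle_edge N i \<in> cycle_edges N" if "i \<in> cycle_verts N" for i
    unfolding cycle_edges_eq using that by (rule imageI)
  have "{?a, ?b} \<in> cycle_edges N"
    using e
  proof
    assume "e = 1"
    then have "u + e * int k = u + e * int (Suc k) - 1" by simp
    then have "?a = (?b - 1) mod int N" by (simp only: mod_diff_left_eq)
    then have "cycle_edge N ?b = {?a, ?b}" by (simp only: cycle_edge_def)
    then show ?thesis using edge[OF verts(2)] by (simp only:)
  next
    assume "e = - 1"
    then have "u + e * int (Suc k) = u + e * int k - 1" by simp
    then have "?b = (?a - 1) mod int N" by (simp only: mod_diff_left_eq)
    then have "cycle_edge N ?a = {?b, ?a}" by (simp only: cycle_edge_def)
    then show ?thesis using edge[OF verts(1)] by (simp only: insert_commute)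
  qed
  then show ?case using Suc by (auto simp: cycle_adj_def)
qed

text \<open>
  A path of length \<open>d\<close> displaces by some \<open>s\<close> with \<open>\<bar>s\<bar> \<le> d\<close>, and every displacement \<open>s\<close> is realised by a path
  of length \<open>\<bar>s\<bar>\<close>; so the minimal length is attained only by \<open>s = d\<close> or \<open>s = - d\<close>.
\<close>

lemma cycle_dist_eqD:
  assumes u: "u \<in> cycle_verts N" and v: "v \<in> cycle_verts N" and d: "cycle_dist N u v = d"
  shows "v = (u + int d) mod int N \<or> u = (v + int d) mod int N"
proof -
  have path: "(u, v) \<in> cycle_adj N ^^ nat \<bar>s\<bar>" if "v = (u + s) mod int N" for s
    using cycle_path_exists[OF u, of 1 "nat \<bar>s\<bar>"] cycle_path_exists[OF u, of "-1" "nat \<bar>s\<bar>"] that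
    by (cases "0 \<le> s") auto
  have vm: "v mod int N = v" and um: "u mod int N = u" using u v by (auto simp: cycle_verts_def)
  have "(u, v) \<in> cycle_adj N ^^ nat \<bar>v - u\<bar>" using vm by (intro path) simp
  then have "(u, v) \<in> cycle_adj N ^^ d" unfolding d[symmetric] cycle_dist_def by (rule LeastI)
  then obtain s where s: "\<bar>s\<bar> \<le> int d" "v = (u + s) mod int N" using cycle_path_mod vm by metis
  have "d \<le> nat \<bar>s\<bar>" unfolding d[symmetric] cycle_dist_def by (rule Least_le) (rule path[OF s(2)])
  then have "s = int d \<or> s = - int d" using s(1) by linarith
  then show ?thesis
  proof
    assume "s = - int d"
    then have "u = (v + int d) mod int N" unfolding s(2) using um by (simp add: mod_simps)
    then show ?thesis by blast
  qed (use s in blast)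
qed

lemma sum_cycle_verts_shift:
  "(\<Sum>i\<in>cycle_verts N. f ((x - i) mod int N)) = (\<Sum>j<N. f (int j))"
proof -
  have inv: "(x - (x - i) mod int N) mod int N = i" if "i \<in> cycle_verts N" for i
    using that by (simp add: mod_simps cycle_verts_def)
  have verts: "(x - i) mod int N \<in> cycle_verts N" if "i \<in> cycle_verts N" for i
    using that by (auto simp: cycle_verts_def)
  have "(\<Sum>i\<in>cycle_verts N. f ((x - i) mod int N)) = (\<Sum>j\<in>cycle_verts N. f j)"
    by (rule sum.reindex_bij_witness[of _ "\<lambda>i. (x - i) mod int N" "\<lambda>i. (x - i) mod int N"])
       (auto simp: inv verts)
  also have "\<dots> = (\<Sum>j<N. f (int j))"
    by (rule sum.reindex_bij_witness[of _ int nat]) (auto simp: cycle_verts_def)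
  finally show ?thesis .
qed

lemma mod_eq_cases:
  assumes "0 \<le> p" "p < int N" "d \<le> N" "q = (p + int d) mod int N"
  shows "q = p + int d \<or> q = p + int d - int N"
proof (cases "p + int d < int N")
  case True
  then show ?thesis using assms by simp
next
  case False
  have "(p + int d) mod int N = (p + int d - int N) mod int N" by simp
  also have "\<dots> = p + int d - int N" using False assms by (intro mod_pos_pos_trivial) auto
  finally show ?thesis using assms by simp
qed

text \<open>
  Passing through the edge gives a path between the two starting vertices of length at most the right-hand side.
\<close>

lemma edge_dists_ge:
  assumes p: "0 \<le> p" "p < int N" and q: "0 \<le> q" "q < int N"
    and d: "2 * d \<le> N" "q = (p + int d) mod int N \<or> p = (q + int d) mod int N"
  shows "d \<le> edge_dist N p + edge_dist N q + 1"
proof -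
  have "q = p + int d \<or> q = p + int d - int N \<or> p = q + int d \<or> p = q + int d - int N"
    using d mod_eq_cases[OF p, of d q] mod_eq_cases[OF q, of d p] by auto
  then show ?thesis using p q d(1) unfolding edge_dist_def min_def by (auto split: if_splits)
qed

lemma mod_shift:
  "b = (a + int d) mod int N \<Longrightarrow> (b - i) mod int N = ((a - i) mod int N + int d) mod int N"
  by (simp add: mod_simps algebra_simps)

text \<open>
  The larger one of both distances is of order at least \<open>d\<close>, and the edge distance of \<open>p\<close> is one of \<open>p\<close> and
  \<open>N - 1 - p\<close>; bounding by the sum of the two corresponding terms makes the sum over all edges explicit.
\<close>

lemma split_prob_le:
  assumes i: "i \<in> cycle_verts N" and d: "2 * d \<le> N" "y = (x + int d) mod int N \<or> x = (y + int d) mod int N"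
    and p: "p = (x - i) mod int N"
  shows "split_prob N x y i \<le> 1320 * (1 / (real_of_int p + 1 + real d) + 1 / (real N - real_of_int p + real d))"
proof -
  define q where "q = (y - i) mod int N"
  have N: "0 < N" using i by (auto simp: cycle_verts_def)
  have pq: "0 \<le> p" "p < int N" "0 \<le> q" "q < int N" unfolding p q_def using N by auto
  have "q = (p + int d) mod int N \<or> p = (q + int d) mod int N"
    using d(2) mod_shift unfolding p q_def by blast
  note far = edge_dists_ge[OF pq d(1) this]
  let ?m = "max (edge_dist N p) (edge_dist N q)" and ?k = "edge_dist N p"
  have "split_prob N x y i \<le> 440 / (real ?m + 1)"
    unfolding split_prob_def p[symmetric] q_def[symmetric] by (rule prob_splits_le[OF pq])
  also have "\<dots> = 1320 / (3 * (real ?m + 1))"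
  proof -
    have "440 / R = 1320 / (3 * R)" for R :: real by simp
    then show ?thesis .
  qed
  also have "\<dots> \<le> 1320 / (real ?k + 1 + real d)"
  proof (intro divide_left_mono mult_pos_pos)
    show "real ?k + 1 + real d \<le> 3 * (real ?m + 1)" using far by (auto simp: max_def)
  qed (simp_all add: add_nonneg_pos add_pos_nonneg)
  also have "\<dots> \<le> 1320 * (1 / (real_of_int p + 1 + real d) + 1 / (real N - real_of_int p + real d))"
  proof -
    have "real ?k = real_of_int p \<or> real ?k + 1 = real N - real_of_int p"
      using pq unfolding edge_dist_def min_def by auto
    moreover have "0 \<le> 1 / (real_of_int p + 1 + real d)" "0 \<le> 1 / (real N - real_of_int p + real d)"
      using pq by auto
    ultimately show ?thesis by auto
  qed
  finally show ?thesis .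
qed

lemma expected_interface_upper:
  assumes d: "0 < d" "2 * d \<le> N" "y = (x + int d) mod int N \<or> x = (y + int d) mod int N"
  shows "expected_interface N x y \<le> 2640 * ln (1 + real N / real d)"
proof -
  let ?f = "\<lambda>p. 1320 * (1 / (real_of_int p + 1 + real d) + 1 / (real N - real_of_int p + real d))"
  let ?g = "\<lambda>j. 1 / (real j + 1 + real d)"
  have "expected_interface N x y \<le> (\<Sum>i\<in>cycle_verts N. split_prob N x y i)"
    by (rule expected_interface_le)
  also have "\<dots> \<le> (\<Sum>i\<in>cycle_verts N. ?f ((x - i) mod int N))"
    by (intro sum_mono split_prob_le d(2,3) refl)
  also have "\<dots> = (\<Sum>j<N. ?f (int j))" by (rule sum_cycle_verts_shift)
  also have "\<dots> = 1320 * ((\<Sum>j<N. ?g j) + (\<Sum>j<N. ?g (N - Suc j)))"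
  proof -
    have "?f (int j) = 1320 * (?g j + ?g (N - Suc j))" if "j < N" for j
      using that by (simp add: of_nat_diff algebra_simps)
    then have "(\<Sum>j<N. ?f (int j)) = (\<Sum>j<N. 1320 * (?g j + ?g (N - Suc j)))" by (intro sum.cong) auto
    then show ?thesis by (simp add: sum_distrib_left sum.distrib)
  qed
  also have "(\<Sum>j<N. ?g (N - Suc j)) = (\<Sum>j<N. ?g j)" by (rule sum.nat_diff_reindex)
  also have "1320 * ((\<Sum>j<N. ?g j) + (\<Sum>j<N. ?g j)) \<le> 2640 * ln (1 + real N / real d)"
    using sum_inverse_le_ln[OF d(1), of N] by simp
  finally show ?thesis .
qed

text \<open>
  It suffices to sum over the longer one of the two arcs between the starting vertices (over either of them if both have
  equal length). Along this arc, the relative positions are \<open>j\<close> and \<open>j + d\<close> for \<open>j < N - d\<close>. The walkers are named such that the one at \<open>S\<close> is nearer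
  to the beginning of this arc. For \<open>N \<ge> 3\<close> no edge of the arc has both walkers on its endpoints.
\<close>

lemma sum_split_prob_lower:
  assumes N: "3 \<le> N" and d: "0 < d" "2 * d \<le> N"
    and S: "\<And>i. i \<in> cycle_verts N \<Longrightarrow> (S i, S' i) = ((x - i) mod int N, (y - i) mod int N) \<or>
      (S' i, S i) = ((x - i) mod int N, (y - i) mod int N)"
    and a: "\<And>i. S i = (a - i) mod int N" "\<And>i. S' i = (S i + int d) mod int N"
  shows "split_const / 3 * ln (1 + real N / real d) \<le> (\<Sum>i\<in>cycle_verts N. split_prob N x y i)"
proof -
  \<comment> \<open>Edges outside of the longer arc are discarded.\<close>
  define h where "h p = (if p < int N - int d then split_const / (real_of_int p + real d + 1) else 0)" for p :: int
  have sc: "0 \<le> split_const" by (simp add: split_const_def)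
  have "split_const / 3 * ln (1 + real N / real d) \<le> split_const * ln (real (N + 1) / real (d + 1))"
    using mult_left_mono[OF ln_ratio_ge[OF d] sc] by simp
  also have "\<dots> \<le> split_const * (\<Sum>j<N - d. 1 / (real j + real d + 1))"
    using sum_inverse_ge_ln[of "N - d" d] d sc by (intro mult_left_mono) auto
  also have "\<dots> = (\<Sum>j<N. h (int j))"
  proof -
    have "(\<Sum>j<N. h (int j)) = (\<Sum>j<N - d. h (int j))"
      by (intro sum.mono_neutral_right) (auto simp: h_def)
    also have "\<dots> = (\<Sum>j<N - d. split_const * (1 / (real j + real d + 1)))"
      by (intro sum.cong) (auto simp: h_def)
    finally show ?thesis by (simp only: sum_distrib_left)
  qed
  also have "\<dots> = (\<Sum>i\<in>cycle_verts N. h (S i))" unfolding a(1) by (rule sum_cycle_verts_shift[symmetric])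
  also have "\<dots> \<le> (\<Sum>i\<in>cycle_verts N. split_prob N x y i)"
  proof (rule sum_mono)
    fix i assume i: "i \<in> cycle_verts N"
    have range: "0 \<le> S i" "S i < int N" "0 \<le> S' i" "S' i < int N" unfolding a using N by auto
    show "h (S i) \<le> split_prob N x y i"
    proof (cases "S i < int N - int d")
      case True
      then have S': "S' i = S i + int d" unfolding a(2) using range by simp
      have "0 < edge_dist N (S i) \<or> 0 < edge_dist N (S' i)"
        using range S' d N unfolding edge_dist_def by auto
      note ge = prob_splits_ge[OF N range this]
      have "real (max (edge_dist N (S i)) (edge_dist N (S' i))) \<le> real_of_int (S i) + real d"
        using range S' unfolding edge_dist_def by auto
      then have "h (S i) \<le> split_const / (real (max (edge_dist N (S i)) (edge_dist N (S' i))) + 1)"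
        using True sc range unfolding h_def by (auto intro!: divide_left_mono mult_pos_pos)
      also have "\<dots> \<le> \<P>(\<omega> in pair_law. splits N (S i) (S' i) (fst \<omega>) (snd \<omega>))" by (rule ge)
      also have "\<dots> = split_prob N x y i"
        using S[OF i] prob_splits_commute[of N "S i" "S' i"] unfolding split_prob_def by auto
      finally show ?thesis .
    qed (simp add: h_def split_prob_def)
  qed
  finally show ?thesis .
qed

lemma expected_interface_lower:
  assumes N: "3 \<le> N" and d: "0 < d" "2 * d \<le> N" "y = (x + int d) mod int N \<or> x = (y + int d) mod int N"
  shows "split_const / 3 * ln (1 + real N / real d) \<le> expected_interface N x y"
proof -
  have "split_const / 3 * ln (1 + real N / real d) \<le> (\<Sum>i\<in>cycle_verts N. split_prob N x y i)"
    using d(3)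
  proof
    assume y: "y = (x + int d) mod int N"
    show ?thesis
      by (rule sum_split_prob_lower[OF N d(1,2),
            where S = "\<lambda>i. (x - i) mod int N" and S' = "\<lambda>i. (y - i) mod int N" and a = x])
         (simp_all only: mod_shift[OF y] simp_thms)
  next
    assume x: "x = (y + int d) mod int N"
    show ?thesis
      by (rule sum_split_prob_lower[OF N d(1,2),
            where S = "\<lambda>i. (y - i) mod int N" and S' = "\<lambda>i. (x - i) mod int N" and a = y])
         (simp_all only: mod_shift[OF x] simp_thms)
  qed
  then show ?thesis unfolding expected_interface_eq[OF N] .
qed

text \<open>
  On two vertices, each walker claims its own starting vertex.
\<close>

lemma expected_interface_two:
  assumes x: "x \<in> cycle_verts 2" and y: "y \<in> cycle_verts 2" and xy: "x \<noteq> y"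
  shows "1 \<le> expected_interface 2 x y"
proof -
  have xy01: "(x = 0 \<and> y = 1) \<or> (x = 1 \<and> y = 0)" using x y xy by (auto simp: cycle_verts_def)
  have win: "wins 2 p q \<omega> \<eta> p" if "regular \<eta>" "p \<noteq> q" "0 \<le> p" "p < 2" "0 \<le> q" "q < 2" for p q \<omega> \<eta>
    unfolding wins_def
  proof (intro exI[of _ 0] conjI allI impI)
    show "site 2 p (snd \<omega>) 0 = p" using that by (simp add: site_def)
    fix m assume "arrival (fst \<eta>) m \<le> arrival (fst \<omega>) 0"
    then have "arrival (fst \<eta>) m \<le> arrival (fst \<eta>) 0" by simp
    then have "m = 0" using arrival_le_iff[OF that(1), of m 0] by simp
    then show "site 2 q (snd \<eta>) m \<noteq> p" using that by (simp add: site_def)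
  qed
  have "splits 2 x y \<omega> \<eta>" if "regular \<omega>" "regular \<eta>" for \<omega> \<eta>
    using win[OF that(2), of x y \<omega>] win[OF that(1), of y x \<eta>] xy01 unfolding splits_def by auto
  then have "AE \<omega> in pair_law. splits 2 x y (fst \<omega>) (snd \<omega>)"
    using AE_pair_regular by (auto elim: eventually_mono)
  moreover have "{\<omega> \<in> space pair_law. splits 2 x y (fst \<omega>) (snd \<omega>)} \<in> sets pair_law"
    using measurable_splits unfolding pred_def .
  ultimately have "pair_prob (splits 2 x y) = 1"
    by (subst two_drivers.P.prob_Collect_eq_1) auto
  moreover have "x mod 2 = x" "y mod 2 = y" using xy01 by auto
  ultimately have "split_prob 2 x y 0 = 1" by (simp add: split_prob_def)
  then show ?thesis using split_prob_le_expected_interface[of 0 2 x y] by (simp add: cycle_verts_def)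
qed

theorem theorem1p1:
  shows "\<exists>c C :: real. 0 < c \<and> c \<le> C \<and>
    (\<forall>(d :: nat) (N :: nat) (x :: int) (y :: int).
       0 < d \<and> 0 < N \<and> real d \<le> real N / 2 \<and>
       x \<in> cycle_verts N \<and> y \<in> cycle_verts N \<and> cycle_dist N x y = d \<longrightarrow>
       c * ln (1 + real N / real d) \<le> expected_interface N x y \<and>
       expected_interface N x y \<le> C * ln (1 + real N / real d))"
proof (intro exI conjI allI impI)
  have "split_const \<le> 1 / 384" by (simp add: split_const_def)
  then show "split_const / 3 \<le> (2640::real)" by linarith
  show "0 < split_const / 3" by (simp add: split_const_def)
  fix d N x y
  assume A: "0 < d \<and> 0 < N \<and> real d \<le> real N / 2 \<and>
       x \<in> cycle_verts N \<and> y \<in> cycle_verts N \<and> cycle_dist N x y = d"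
  then have d: "0 < d" "2 * d \<le> N" by auto
  have rel: "y = (x + int d) mod int N \<or> x = (y + int d) mod int N"
    using A cycle_dist_eqD by blast
  show "expected_interface N x y \<le> 2640 * ln (1 + real N / real d)"
    by (rule expected_interface_upper[OF d rel])
  show "split_const / 3 * ln (1 + real N / real d) \<le> expected_interface N x y"
  proof (cases "3 \<le> N")
    case True
    then show ?thesis by (rule expected_interface_lower[OF _ d rel])
  next
    case False
    \<comment> \<open>Two adjacent walkers on the cycle of length \<open>2\<close>, whose two edges coincide.\<close>
    then have N: "N = 2" "d = 1" using d by auto
    have "x \<noteq> y" using A rel unfolding N by (auto simp: cycle_verts_def) presburger+
    then have "1 \<le> expected_interface N x y" using A expected_interface_two unfolding N by blast
    moreover have "ln (1 + real N / real d) \<le> 3"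
      using ln_add_one_self_le_self[of "real N / real d"] unfolding N by simp
    then have "split_const / 3 * ln (1 + real N / real d) \<le> 1 / 384 / 3 * 3"
      using \<open>split_const \<le> 1 / 384\<close> unfolding N by (intro mult_mono) auto
    ultimately show ?thesis by simp
  qed
qed

end
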